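(* Let $\mathcal F\in\{A\mathrm J,B\mathrm J,A\mathrm M,B\mathrm M\}$ be any of the four families of interpolation polynomials, let $\lambda,\mu\in\mathcal P_n$ with $\lambda\supseteq\mu$, and put $k=|\lambda|-|\mu|$. (1) The binomial coefficient satisfies $$b_{\lambda\mu}=\sum_{\zeta\in\mathfrak C_{\lambda\mu}}\mathrm{wt}(\zeta)\prod_{i=0}^{k-1}a_{\zeta_i\zeta_{i+1}},\qquad \mathrm{wt}(\zeta)=\prod_{i=0}^{k-1}\frac{\|\overline{\zeta_i}\|-\|\overline{\zeta_{i+1}}\|}{\|\overline{\zeta_0}\|-\|\overline{\zeta_{i+1}}\|}.$$ (2) The inverse binomial coefficient satisfies $$b'_{\lambda\mu}=\sum_{\zeta\in\mathfrak C_{\lambda\mu}}\mathrm{wt}'(\zeta)\prod_{i=0}^{k-1}a_{\zeta_i\zeta_{i+1}},\qquad \mathrm{wt}'(\zeta)=(-1)^k\prod_{i=0}^{k-1}\frac{\|\overline{\zeta_{i+1}}\|-\|\overline{\zeta_i}\|}{\|\overline{\zeta_k}\|-\|\overline{\zeta_i}\|}.$$ Here $\mathfrak C_{\lambda\mu}$ is the set of saturated chains $\zeta=(\zeta_0,\dots,\zeta_k)$ from $\lambda$ to $\mu$.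
   Context: Fix $n\geqslant1$. $\mathcal P_n=\{\lambda\in\mathbb Z^n:\lambda_1\geqslant\cdots\geqslant\lambda_n\geqslant0\}$, $|\lambda|=\lambda_1+\dots+\lambda_n$; $\lambda\supseteq\mu$ means $\lambda_i\geqslant\mu_i$ for all $i$; $\lambda\gtrdot\mu$ means $\lambda\supseteq\mu$ and $|\lambda|=|\mu|+1$. A saturated chain from $\lambda$ to $\mu$ is a sequence in $\mathcal P_n$ with $\lambda=\zeta_0\gtrdot\zeta_1\gtrdot\cdots\gtrdot\zeta_k=\mu$. The four families $\mathcal F$ have the following data (base field $\mathbb F$, ring $\Lambda$, shifting map $\mathcal P_n\to\mathbb F^n$, $\lambda\mapsto\overline\lambda$, and "norm" $\|x\|$), with indeterminate parameters: - $A\mathrm J$: $\mathbb F=\mathbb Q(\tau)$; $\Lambda=\mathbb F[x_1,\dots,x_n]^{S_n}$; $\overline\lambda_i=\lambda_i+(n-i)\tau$; $\|x\|=\sum_i x_i$. - $B\mathrm J$: $\mathbb F=\mathbb Q(\tau,\alpha)$; $\Lambda=\mathbb F[x_1^2,\dots,x_n^2]^{S_n}$; $\overline\lambda_i=\lambda_i+(n-i)\tau+\alpha$; $\|x\|=\sum_i x_i^2$. - $A\mathrm M$: $\mathbb F=\mathbb Q(q,t)$; $\Lambda=\mathbb F[x_1,\dots,x_n]^{S_n}$; $\overline\lambda_i=q^{\lambda_i}t^{n-i}$; $\|x\|=\sum_i x_i$. - $B\mathrm M$: $\mathbb F=\mathbb Q(q,t,a)$; $\Lambda=\mathbb F[x_1+x_1^{-1},\dots,x_n+x_n^{-1}]^{S_n}$;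 $\overline\lambda_i=aq^{\lambda_i}t^{n-i}$; $\|x\|=\sum_i(x_i+x_i^{-1})$. The degree of a Laurent polynomial is the maximum of $|\alpha_1|+\dots+|\alpha_n|$ over monomials $x^\alpha$ occurring in it. For $\mu\in\mathcal P_n$, the (unital) interpolation polynomial $h_\mu$ is the unique element of $\Lambda$ of degree at most $|\mu|$ (at most $2|\mu|$ when $\mathcal F=B\mathrm J$) with $h_\mu(\overline\lambda)=\delta_{\lambda\mu}$ for all $\lambda\in\mathcal P_n$ with $|\lambda|\leqslant|\mu|$ (existence and uniqueness are known). The binomial coefficients are $b_{\lambda\mu}=h_\mu(\overline\lambda)\in\mathbb F$, and the adjacent binomial coefficients are $a_{\lambda\mu}=b_{\lambda\mu}$ for $\lambda\gtrdot\mu$. The infinite matrix $B=(b_{\lambda\mu})_{\lambda,\mu\in\mathcal P_n}$ is unitriangular (with respect to any total order on $\mathcal P_n$ compatible with size), hence invertible, and the inverse binomial coefficients $b'_{\lambda\mu}$ are the entries of $B^{-1}$. *)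

theory Defs
  imports
    "HOL-Library.Poly_Mapping"
    "HOL-Combinatorics.Permutations"
    "HOL-Computational_Algebra.Polynomial"
    "HOL-Computational_Algebra.Fraction_Field"
begin

section \<open>Partitions with at most n parts\<close>

text \<open>
  An element of Z^n with nonnegative entries is a function on nat, read on the index set
  {1..n}. It is required to vanish off {1..n}, so that equality of partitions is equality
  of functions.
\<close>

definition partitions :: "nat \<Rightarrow> (nat \<Rightarrow> nat) set" where
  "partitions n = {lam. (\<forall>i j. 1 \<le> i \<and> i \<le> j \<and> j \<le> n \<longrightarrow> lam j \<le> lam i) \<and>
                        (\<forall>i. i \<notin> {1..n} \<longrightarrow> lam i = 0)}"

definition psize :: "nat \<Rightarrow> (nat \<Rightarrow> nat) \<Rightarrow> nat" where
  "psize n lam = (\<Sum>i=1..n. lam i)"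

definition pcontains :: "nat \<Rightarrow> (nat \<Rightarrow> nat) \<Rightarrow> (nat \<Rightarrow> nat) \<Rightarrow> bool" where
  "pcontains n lam mu \<longleftrightarrow> (\<forall>i\<in>{1..n}. mu i \<le> lam i)"

definition pcovers :: "nat \<Rightarrow> (nat \<Rightarrow> nat) \<Rightarrow> (nat \<Rightarrow> nat) \<Rightarrow> bool" where
  "pcovers n lam mu \<longleftrightarrow> pcontains n lam mu \<and> psize n lam = psize n mu + 1"

definition saturated_chains ::
  "nat \<Rightarrow> (nat \<Rightarrow> nat) \<Rightarrow> (nat \<Rightarrow> nat) \<Rightarrow> (nat \<Rightarrow> nat) list set" where
  "saturated_chains n lam mu =
     {zs. zs \<noteq> [] \<and> set zs \<subseteq> partitions n \<and> hd zs = lam \<and> last zs = mu \<and>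
          (\<forall>i. Suc i < length zs \<longrightarrow> pcovers n (zs ! i) (zs ! Suc i))}"

section \<open>Laurent polynomials\<close>

text \<open>
  A Laurent polynomial is a finitely supported map from exponent vectors to coefficients;
  an exponent vector is a finitely supported map from variable indices to int. The
  multiplication of \<^typ>\<open>(nat \<Rightarrow>\<^sub>0 int) \<Rightarrow>\<^sub>0 'f::comm_ring_1\<close> is convolution.
\<close>

type_synonym 'f laurent = "(nat \<Rightarrow>\<^sub>0 int) \<Rightarrow>\<^sub>0 'f"

definition lconst :: "'f::field \<Rightarrow> 'f laurent" where
  "lconst c = Poly_Mapping.single 0 c"

definition lvar :: "nat \<Rightarrow> 'f::field laurent" where
  "lvar i = Poly_Mapping.single (Poly_Mapping.single i 1) 1"

definition lvar_inv :: "nat \<Rightarrow> 'f::field laurent" where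
  "lvar_inv i = Poly_Mapping.single (Poly_Mapping.single i (-1)) 1"

definition leval :: "'f::field laurent \<Rightarrow> (nat \<Rightarrow> 'f) \<Rightarrow> 'f" where
  "leval f x = (\<Sum>e\<in>Poly_Mapping.keys f. Poly_Mapping.lookup f e *
                  (\<Prod>i\<in>Poly_Mapping.keys e. x i powi Poly_Mapping.lookup e i))"

text \<open>The zero polynomial gets degree 0, which affects no upper bound on degrees below.\<close>

definition ldegree :: "'f::field laurent \<Rightarrow> nat" where
  "ldegree f = Max (insert 0 ((\<lambda>e. \<Sum>i\<in>Poly_Mapping.keys e. nat \<bar>Poly_Mapping.lookup e i\<bar>)
                                 ` Poly_Mapping.keys f))"

inductive_set subalgebra :: "'f::field laurent set \<Rightarrow> 'f laurent set" for G where
  gen: "g \<in> G \<Longrightarrow> g \<in> subalgebra G"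
| const: "lconst c \<in> subalgebra G"
| add: "f \<in> subalgebra G \<Longrightarrow> g \<in> subalgebra G \<Longrightarrow> f + g \<in> subalgebra G"
| mult: "f \<in> subalgebra G \<Longrightarrow> g \<in> subalgebra G \<Longrightarrow> f * g \<in> subalgebra G"

definition lsymmetric :: "nat \<Rightarrow> 'f::field laurent \<Rightarrow> bool" where
  "lsymmetric n f \<longleftrightarrow> (\<forall>\<sigma>. \<sigma> permutes {1..n} \<longrightarrow>
     (\<forall>e. Poly_Mapping.lookup f (Poly_Mapping.map_key \<sigma> e) = Poly_Mapping.lookup f e))"

section \<open>Interpolation polynomials and binomial coefficients\<close>

text \<open>
  In each family, with \<open>g\<^sub>i\<close> denoting \<open>x\<^sub>i\<close>, \<open>x\<^sub>i^2\<close> or \<open>x\<^sub>i + x\<^sub>i^(-1)\<close>, the ring is the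
  algebra of symmetric elements of \<open>F[g\<^sub>1, ..., g\<^sub>n]\<close>; \<open>ring_gen i\<close> is \<open>g\<^sub>i\<close>.
  The interpolation polynomial indexed by mu has degree at most \<open>deg_scale * |mu|\<close>.
  The i-th coordinate of the shift of lam is \<open>shift n lam i\<close>, for i in {1..n}.
\<close>

record (overloaded) ('f::field) family =
  ring_gen :: "nat \<Rightarrow> 'f laurent"
  deg_scale :: nat
  shift :: "nat \<Rightarrow> (nat \<Rightarrow> nat) \<Rightarrow> nat \<Rightarrow> 'f"
  fnorm :: "nat \<Rightarrow> (nat \<Rightarrow> 'f) \<Rightarrow> 'f"

definition Lambda :: "'f::field family \<Rightarrow> nat \<Rightarrow> 'f laurent set" where
  "Lambda F n = {f \<in> subalgebra (ring_gen F ` {1..n}). lsymmetric n f}"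

definition interp :: "'f::field family \<Rightarrow> nat \<Rightarrow> (nat \<Rightarrow> nat) \<Rightarrow> 'f laurent" where
  "interp F n mu = (THE h. h \<in> Lambda F n \<and> ldegree h \<le> deg_scale F * psize n mu \<and>
     (\<forall>lam\<in>partitions n. psize n lam \<le> psize n mu \<longrightarrow>
        leval h (shift F n lam) = (if lam = mu then 1 else 0)))"

definition binom :: "'f::field family \<Rightarrow> nat \<Rightarrow> (nat \<Rightarrow> nat) \<Rightarrow> (nat \<Rightarrow> nat) \<Rightarrow> 'f" where
  "binom F n lam mu = leval (interp F n mu) (shift F n lam)"

text \<open>Used only when lam covers mu.\<close>

definition adj_binom :: "'f::field family \<Rightarrow> nat \<Rightarrow> (nat \<Rightarrow> nat) \<Rightarrow> (nat \<Rightarrow> nat) \<Rightarrow> 'f" where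
  "adj_binom F n lam mu = binom F n lam mu"

text \<open>
  Infinite matrices with rows and columns indexed by \<^term>\<open>partitions n\<close>. The product is
  meaningful when the left factor is row-finite. The inverse is the two-sided inverse in the
  ring of row-finite matrices, extended by 0 off the index set to make it a unique function.
\<close>

definition row_finite :: "nat \<Rightarrow> ((nat \<Rightarrow> nat) \<Rightarrow> (nat \<Rightarrow> nat) \<Rightarrow> 'f::field) \<Rightarrow> bool" where
  "row_finite n A \<longleftrightarrow> (\<forall>lam\<in>partitions n. finite {mu\<in>partitions n. A lam mu \<noteq> 0})"

definition mat_prod :: "nat \<Rightarrow> ((nat \<Rightarrow> nat) \<Rightarrow> (nat \<Rightarrow> nat) \<Rightarrow> 'f::field) \<Rightarrow>
    ((nat \<Rightarrow> nat) \<Rightarrow> (nat \<Rightarrow> nat) \<Rightarrow> 'f) \<Rightarrow> (nat \<Rightarrow> nat) \<Rightarrow> (nat \<Rightarrow> nat) \<Rightarrow> 'f" where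
  "mat_prod n A B lam nu = (\<Sum>mu\<in>{mu\<in>partitions n. A lam mu \<noteq> 0}. A lam mu * B mu nu)"

definition inverse_matrix :: "nat \<Rightarrow> ((nat \<Rightarrow> nat) \<Rightarrow> (nat \<Rightarrow> nat) \<Rightarrow> 'f::field) \<Rightarrow>
    (nat \<Rightarrow> nat) \<Rightarrow> (nat \<Rightarrow> nat) \<Rightarrow> 'f" where
  "inverse_matrix n B = (THE C. row_finite n C \<and>
     (\<forall>lam mu. lam \<notin> partitions n \<or> mu \<notin> partitions n \<longrightarrow> C lam mu = 0) \<and>
     (\<forall>lam\<in>partitions n. \<forall>mu\<in>partitions n.
        mat_prod n B C lam mu = (if lam = mu then 1 else 0) \<and>
        mat_prod n C B lam mu = (if lam = mu then 1 else 0)))"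

definition inv_binom :: "'f::field family \<Rightarrow> nat \<Rightarrow> (nat \<Rightarrow> nat) \<Rightarrow> (nat \<Rightarrow> nat) \<Rightarrow> 'f" where
  "inv_binom F n = inverse_matrix n (binom F n)"

definition snorm :: "'f::field family \<Rightarrow> nat \<Rightarrow> (nat \<Rightarrow> nat) \<Rightarrow> 'f" where
  "snorm F n lam = fnorm F n (shift F n lam)"

definition wt :: "'f::field family \<Rightarrow> nat \<Rightarrow> nat \<Rightarrow> (nat \<Rightarrow> nat) list \<Rightarrow> 'f" where
  "wt F n k zs = (\<Prod>i<k. (snorm F n (zs ! i) - snorm F n (zs ! Suc i)) /
                          (snorm F n (zs ! 0) - snorm F n (zs ! Suc i)))"

definition wt' :: "'f::field family \<Rightarrow> nat \<Rightarrow> nat \<Rightarrow> (nat \<Rightarrow> nat) list \<Rightarrow> 'f" where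
  "wt' F n k zs = (-1) ^ k * (\<Prod>i<k. (snorm F n (zs ! Suc i) - snorm F n (zs ! i)) /
                                      (snorm F n (zs ! k) - snorm F n (zs ! i)))"

section \<open>The four families\<close>

text \<open>
  Fields of rational functions are fraction fields of iterated univariate polynomial rings
  over the rationals. The indeterminates are adjoined in the order in which they are listed
  in Q(tau, alpha), Q(q, t) and Q(q, t, a), so the last one is the outermost.
\<close>

definition incl :: "'a::idom \<Rightarrow> 'a fract" where
  "incl p = Fraction_Field.Fract p 1"

definition AJ :: "rat poly fract family" where
  "AJ = (let tau = incl [:0, 1:] in
     \<lparr> ring_gen = lvar,
       deg_scale = 1,
       shift = (\<lambda>n lam i. of_nat (lam i) + of_nat (n - i) * tau),
       fnorm = (\<lambda>n x. \<Sum>i=1..n. x i) \<rparr>)"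

definition BJ :: "rat poly poly fract family" where
  "BJ = (let tau = incl [:[:0, 1:]:]; alpha = incl [:0, 1:] in
     \<lparr> ring_gen = (\<lambda>i. lvar i ^ 2),
       deg_scale = 2,
       shift = (\<lambda>n lam i. of_nat (lam i) + of_nat (n - i) * tau + alpha),
       fnorm = (\<lambda>n x. \<Sum>i=1..n. x i ^ 2) \<rparr>)"

definition AM :: "rat poly poly fract family" where
  "AM = (let q = incl [:[:0, 1:]:]; t = incl [:0, 1:] in
     \<lparr> ring_gen = lvar,
       deg_scale = 1,
       shift = (\<lambda>n lam i. q ^ lam i * t ^ (n - i)),
       fnorm = (\<lambda>n x. \<Sum>i=1..n. x i) \<rparr>)"

definition BM :: "rat poly poly poly fract family" where
  "BM = (let q = incl [:[:[:0, 1:]:]:]; t = incl [:[:0, 1:]:]; a = incl [:0, 1:] in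
     \<lparr> ring_gen = (\<lambda>i. lvar i + lvar_inv i),
       deg_scale = 1,
       shift = (\<lambda>n lam i. a * q ^ lam i * t ^ (n - i)),
       fnorm = (\<lambda>n x. \<Sum>i=1..n. (x i + inverse (x i))) \<rparr>)"

end

theory Submission
  imports Defs
begin

text \<open>
  Multiplying an interpolation polynomial h_mu by the norm minus its value at mu gives an element
  of degree |mu| + 1 that vanishes at all partitions of size at most |mu|. Expanding it in the h_nu
  with |nu| = |mu| + 1 and writing N for the norm yields
  (N lam - N mu) b(lam, mu) = sum over nu of (N nu - N mu) b(nu, mu) b(lam, nu).
  Only those nu covering mu contribute, by the extra vanishing property, and iterating over
  saturated chains gives (1). In matrix form the recursion reads X B - B X = B K with X diagonal;
  the right-hand side C of (2) satisfies C X - X C = K C, so B C commutes with X, is unitriangular,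
  and hence is the identity.

  In the coordinates y_i = x_i, x_i^2 or x_i + 1/x_i all families consist of symmetric polynomials
  interpolated at the points with coordinates Y (lam_i) (n - i) for an injective Y, where existence
  and uniqueness hold. Extra vanishing comes from a difference operator that lowers some of the
  parts of lam and whose eigenvalue on h_mu vanishes for a suitable choice of its parameter.
\<close>

section \<open>Polynomial functions\<close>

text \<open>The operator behind extra vanishing is usually divided by a Vandermonde determinant.
  Here it is left undivided: it turns symmetric functions into alternating ones, and uniqueness of
  interpolation is proved for alternating functions first. That proof and the proof of existence
  change the points: setting the last variable to \<open>Y 0 0\<close> shifts the second argument of
  \<open>Y\<close>, removing a full column shifts the first. Hence \<open>Y\<close> is an arbitrary
  injective function of two indices. The degree condition on h_mu is one on Laurent polynomials,
  while membership in the subalgebra bounds no degree in the generators; the two degrees are matched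
  by evaluating along x = T w and comparing powers of T. Norms separate partitions of different
  sizes only; in the family AJ the norm depends on the size alone. So commutation with X settles the
  entries of B C between different sizes, and triangularity the others.\<close>

instance fract :: ("{idom, ring_char_0}") field_char_0
proof
  show "inj (of_nat :: nat \<Rightarrow> 'a fract)"
  proof (rule injI)
    fix m k :: nat
    assume "(of_nat m :: 'a fract) = of_nat k"
    then show "m = k"
      by (simp add: of_nat_fract eq_fract)
  qed
qed

definition monom_fn :: "nat \<Rightarrow> (nat \<Rightarrow> nat) \<Rightarrow> (nat \<Rightarrow> 'a::field) \<Rightarrow> 'a" where
  "monom_fn n e y = (\<Prod>i=1..n. y i ^ e i)"

text \<open>Degrees are integers, so that a polynomial function of negative degree is zero.\<close>

inductive polyfn :: "nat \<Rightarrow> int \<Rightarrow> ((nat \<Rightarrow> 'a::field) \<Rightarrow> 'a) \<Rightarrow> bool" for n d where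
  zero: "polyfn n d (\<lambda>y. 0)"
| add: "polyfn n d f \<Longrightarrow> int (psize n e) \<le> d \<Longrightarrow> polyfn n d (\<lambda>y. c * monom_fn n e y + f y)"

lemma polyfn_add:
  assumes "polyfn n d f" "polyfn n d g"
  shows "polyfn n d (\<lambda>y. f y + g y)"
  using assms
proof (induction rule: polyfn.induct)
  case (add f e c)
  then show ?case
    using polyfn.add[of n d "\<lambda>y. f y + g y" e c] by (simp add: add.assoc)
qed simp

lemma polyfn_mono:
  assumes "polyfn n d f" "d \<le> d'" shows "polyfn n d' f"
  using assms by (induction rule: polyfn.induct) (auto intro: polyfn.intros)

lemma polyfn_scale:
  assumes "polyfn n d f" shows "polyfn n d (\<lambda>y. c * f y)"
  using assms
proof (induction rule: polyfn.induct)
  case (add f e c')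
  then show ?case
    using polyfn.add[of n d "\<lambda>y. c * f y" e "c * c'"] by (simp add: algebra_simps)
qed (simp add: polyfn.zero)

lemma polyfn_uminus: "polyfn n d f \<Longrightarrow> polyfn n d (\<lambda>y. - f y)"
  using polyfn_scale[of n d f "-1"] by simp

lemma polyfn_diff: "polyfn n d f \<Longrightarrow> polyfn n d g \<Longrightarrow> polyfn n d (\<lambda>y. f y - g y)"
  using polyfn_add[of n d f "\<lambda>y. - g y"] polyfn_uminus[of n d g] by simp

lemma polyfn_sum:
  assumes "\<And>a. a \<in> A \<Longrightarrow> polyfn n d (f a)"
  shows "polyfn n d (\<lambda>y. \<Sum>a\<in>A. f a y)"
  using assms
  by (induction A rule: infinite_finite_induct) (auto intro: polyfn.zero polyfn_add)

lemma polyfn_monom: "int (psize n e) \<le> d \<Longrightarrow> polyfn n d (monom_fn n e)"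
  using polyfn.add[OF polyfn.zero, of n e d 1] by simp

lemma polyfn_const: "0 \<le> d \<Longrightarrow> polyfn n d (\<lambda>y. c)"
  using polyfn.add[OF polyfn.zero, of n "\<lambda>_. 0" d c] by (simp add: monom_fn_def psize_def)

lemma monom_fn_mult: "monom_fn n e y * monom_fn n e' y = monom_fn n (\<lambda>i. e i + e' i) y"
  by (simp add: monom_fn_def prod.distrib power_add)

lemma psize_add: "psize n (\<lambda>i. e i + e' i) = psize n e + psize n e'"
  by (simp add: psize_def sum.distrib)

lemma polyfn_monom_mult:
  assumes "polyfn n d f"
  shows "polyfn n (int (psize n e) + d) (\<lambda>y. monom_fn n e y * f y)"
  using assms
proof (induction rule: polyfn.induct)
  case (add f e' c)
  then show ?case
    using polyfn.add[of n "int (psize n e) + d" "\<lambda>y. monom_fn n e y * f y" "\<lambda>i. e i + e' i" c]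
    by (simp add: algebra_simps psize_add flip: monom_fn_mult)
qed (simp add: polyfn.zero)

lemma polyfn_mult:
  assumes "polyfn n d f" "polyfn n d' g"
  shows "polyfn n (d + d') (\<lambda>y. f y * g y)"
  using assms(1)
proof (induction rule: polyfn.induct)
  case (add f e c)
  have "polyfn n (d + d') (\<lambda>y. monom_fn n e y * g y)"
    using polyfn_monom_mult[OF assms(2)] by (rule polyfn_mono) (use add in simp)
  from polyfn_add[OF polyfn_scale[OF this, of c] add.IH] show ?case
    by (simp add: algebra_simps)
qed (simp add: polyfn.zero)

lemma polyfn_var:
  assumes "i \<in> {1..n}" shows "polyfn n 1 (\<lambda>y :: nat \<Rightarrow> 'a::field. y i)"
proof -
  have "monom_fn n (\<lambda>j. if j = i then 1 else 0) = (\<lambda>y :: nat \<Rightarrow> 'a. y i)"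
    using assms by (auto simp: monom_fn_def fun_eq_iff if_distrib[of "power _"] cong: if_cong)
  moreover have "psize n (\<lambda>j. if j = i then 1 else 0) = 1"
    using assms by (simp add: psize_def)
  ultimately show ?thesis
    using polyfn_monom[of n "\<lambda>j. if j = i then 1 else 0" 1, where 'a = 'a] by simp
qed

lemma polyfn_power: "polyfn n d f \<Longrightarrow> polyfn n (int k * d) (\<lambda>y. f y ^ k)"
proof (induction k)
  case (Suc k)
  then show ?case using polyfn_mult[of n d f "int k * d" "\<lambda>y. f y ^ k"] by (simp add: algebra_simps)
qed (simp add: polyfn_const)

lemma polyfn_prod:
  assumes "\<And>a. a \<in> A \<Longrightarrow> polyfn n (d a) (f a)"
  shows "polyfn n (\<Sum>a\<in>A. d a) (\<lambda>y. \<Prod>a\<in>A. f a y)"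
  using assms
  by (induction A rule: infinite_finite_induct) (auto intro: polyfn_const polyfn_mult)

lemma polyfn_neg:
  assumes "polyfn n d f" "d < 0" shows "f y = 0"
  using assms by (induction rule: polyfn.induct) auto

lemma polyfn_cong:
  assumes "polyfn n d f" "\<And>i. i \<in> {1..n} \<Longrightarrow> y i = z i" shows "f y = f z"
proof -
  have eq: "monom_fn n e y = monom_fn n e z" for e
    unfolding monom_fn_def using assms(2) by (intro prod.cong) auto
  show ?thesis using assms(1) by (induction rule: polyfn.induct) (auto simp: eq)
qed

lemma polyfn_subst:
  assumes "polyfn m d f" "\<And>i. i \<in> {1..m} \<Longrightarrow> polyfn n 1 (s i)"
  shows "polyfn n d (\<lambda>y. f (\<lambda>i. s i y))"
  using assms(1)
proof (induction rule: polyfn.induct)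
  case (add f e c)
  have "polyfn n (\<Sum>i=1..m. int (e i) * 1) (\<lambda>y. \<Prod>i=1..m. s i y ^ e i)"
    by (intro polyfn_prod polyfn_power assms(2))
  then have "polyfn n d (\<lambda>y. monom_fn m e (\<lambda>i. s i y))"
    unfolding monom_fn_def by (rule polyfn_mono) (use add in \<open>simp add: psize_def\<close>)
  from polyfn_add[OF polyfn_scale[OF this] add.IH] show ?case .
qed (simp add: polyfn.zero)

lemma polyfn_permute:
  assumes "polyfn n d f" "p permutes {1..n}"
  shows "polyfn n d (\<lambda>y. f (y \<circ> p))"
  unfolding comp_def
  using assms(1) by (rule polyfn_subst) (use assms(2) permutes_in_image in \<open>force intro!: polyfn_var\<close>)

lemma polyfn_fix_var:
  assumes "polyfn m d f" "{1..m} - {i} \<subseteq> {1..n}"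
  shows "polyfn n d (\<lambda>y. f (y(i := c)))"
proof -
  have "(\<lambda>y. f (y(i := c))) = (\<lambda>y. f (\<lambda>j. if j = i then c else y j))"
    by (intro ext arg_cong[of _ _ f]) auto
  moreover have "polyfn n d (\<lambda>y. f (\<lambda>j. if j = i then c else y j))"
    using assms(1)
  proof (rule polyfn_subst)
    fix j assume "j \<in> {1..m}"
    then show "polyfn n 1 (\<lambda>y. if j = i then c else y j)"
      using polyfn_const[of 1 n c] polyfn_var[of j n] assms(2) by (cases "j = i") auto
  qed
  ultimately show ?thesis by simp
qed

section \<open>Vanishing of polynomial functions via restriction to lines\<close>

lemma polyfn_on_line:
  assumes "polyfn n d f"
  obtains p where "\<And>s. poly p s = f (\<lambda>i. y i + s * v i)"
proof -
  have "\<exists>p. \<forall>s. poly p s = f (\<lambda>i. y i + s * v i)"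
    using assms
  proof (induction rule: polyfn.induct)
    case (add f e c)
    then obtain p where p: "\<And>s. poly p s = f (\<lambda>i. y i + s * v i)" by blast
    have "poly (smult c (\<Prod>i=1..n. [:y i, v i:] ^ e i) + p) s =
        c * monom_fn n e (\<lambda>i. y i + s * v i) + f (\<lambda>i. y i + s * v i)" for s
      by (simp add: p monom_fn_def poly_prod)
    then show ?case by blast
  qed (auto intro: exI[of _ 0])
  then show ?thesis using that by blast
qed

lemma poly_zero_on_infinite:
  assumes "infinite S" "\<And>s. s \<in> S \<Longrightarrow> poly p s = (0::'a::field)"
  shows "p = 0"
proof (rule ccontr)
  assume "p \<noteq> 0"
  then have "finite {s. poly p s = 0}" by (rule poly_roots_finite)
  with assms show False using finite_subset[of S "{s. poly p s = 0}"] by auto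
qed

text \<open>On the line from \<open>y\<close> to \<open>y0\<close> both functions become univariate
  polynomials with product zero. The one for \<open>g\<close> is nonzero at parameter 1, so the one
  for \<open>f\<close> is zero, and parameter 0 gives \<open>f y\<close>.\<close>

lemma polyfn_mult_eq_0:
  fixes f :: "(nat \<Rightarrow> 'a::field_char_0) \<Rightarrow> 'a"
  assumes f: "polyfn n d f" and g: "polyfn n d' g" and eq: "\<And>y. g y * f y = 0" and y0: "g y0 \<noteq> 0"
  shows "f y = 0"
proof -
  obtain p where p: "\<And>s. poly p s = f (\<lambda>i. y i + s * (y0 i - y i))"
    using polyfn_on_line[OF f, of y "\<lambda>i. y0 i - y i"] by blast
  obtain q where q: "\<And>s. poly q s = g (\<lambda>i. y i + s * (y0 i - y i))"
    using polyfn_on_line[OF g, of y "\<lambda>i. y0 i - y i"] by blast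
  have "q * p = 0"
    by (rule poly_zero_on_infinite[OF infinite_UNIV_char_0]) (simp add: p q eq)
  moreover have "q \<noteq> 0" using q[of 1] y0 by auto
  ultimately show ?thesis using p[of 0] by simp
qed

text \<open>The coordinates are freed one at a time: a line in one coordinate direction has
  infinitely many points at which that coordinate lies in \<open>S\<close>.\<close>

lemma polyfn_zero_on_grid:
  assumes f: "polyfn n d f" and S: "infinite S"
    and zero: "\<And>y. (\<And>i. i \<in> {1..n} \<Longrightarrow> y i \<in> S) \<Longrightarrow> f y = 0"
  shows "f y = 0"
proof -
  have "(\<forall>i\<in>{Suc k..n}. y i \<in> S) \<longrightarrow> f y = 0" for k y
  proof (induction k arbitrary: y)
    case 0
    then show ?case using zero by auto
  next
    case (Suc k)
    show ?case
    proof
      assume y: "\<forall>i\<in>{Suc (Suc k)..n}. y i \<in> S"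
      obtain p where p: "\<And>s. poly p s = f (\<lambda>i. y i + s * (if i = Suc k then 1 else 0))"
        using polyfn_on_line[OF f, of y "\<lambda>i. if i = Suc k then 1 else 0"] by blast
      have "p = 0"
      proof (rule poly_zero_on_infinite)
        show "infinite ((\<lambda>s. s - y (Suc k)) ` S)"
          using S by (subst finite_image_iff) (auto simp: inj_on_def)
        fix s assume "s \<in> (\<lambda>s. s - y (Suc k)) ` S"
        then show "poly p s = 0" unfolding p
          by (intro Suc.IH[rule_format]) (use y in auto)
      qed
      then show "f y = 0" using p[of 0] by simp
    qed
  qed
  from this[of n y] show ?thesis by simp
qed

section \<open>Division by linear factors\<close>

lemma polyfn_divide_var:
  assumes "polyfn n d f" "i \<in> {1..n}"
  obtains g where "polyfn n (d - 1) g" "\<And>y. f y = f (y(i := c)) + (y i - c) * g y"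
proof -
  have "\<exists>g. polyfn n (d - 1) g \<and> (\<forall>y. f y = f (y(i := c)) + (y i - c) * g y)"
    using assms(1)
  proof (induction rule: polyfn.induct)
    case zero
    then show ?case using polyfn.zero by (intro exI[of _ "\<lambda>y. 0"]) auto
  next
    case (add f e a)
    then obtain g where g: "polyfn n (d - 1) g" "\<And>y. f y = f (y(i := c)) + (y i - c) * g y" by blast
    define r where "r y = (\<Prod>j\<in>{1..n} - {i}. y j ^ e j)" for y :: "nat \<Rightarrow> 'a"
    \<comment> \<open>Dividing \<open>y i ^ e i - c ^ e i\<close> by \<open>y i - c\<close> gives a
      geometric sum; \<open>h\<close> is this quotient times the part \<open>r\<close> of the
      monomial that is free of \<open>y i\<close>.\<close>
    define h where "h y = (\<Sum>k<e i. y i ^ k * (c ^ (e i - Suc k) * r y))" for y :: "nat \<Rightarrow> 'a"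
    have mon: "monom_fn n e y = y i ^ e i * r y" for y
      unfolding monom_fn_def r_def using assms(2) by (simp add: prod.remove)
    have r: "r (y(i := c)) = r y" for y
      unfolding r_def by (intro prod.cong) auto
    have "y i ^ e i - c ^ e i = (y i - c) * (\<Sum>k<e i. y i ^ k * c ^ (e i - Suc k))" for y
      by (simp only: power_diff_sumr2 mult.commute)
    then have eq: "(y i ^ e i - c ^ e i) * r y = (y i - c) * h y" for y
      unfolding h_def mult.assoc[symmetric] sum_distrib_right[symmetric] by simp
    have eq: "monom_fn n e y = monom_fn n e (y(i := c)) + (y i - c) * h y" for y
      using eq[of y] unfolding mon r by (simp add: algebra_simps)
    have "polyfn n (d - 1) h"
      unfolding h_def
    proof (rule polyfn_sum)
      fix k assume k: "k \<in> {..<e i}"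
      have "psize n e = e i + (\<Sum>j\<in>{1..n} - {i}. e j)"
        unfolding psize_def using assms(2) by (simp add: sum.remove)
      then have le: "int k * 1 + (0 + (\<Sum>j\<in>{1..n} - {i}. int (e j) * 1)) \<le> d - 1"
        using k add.hyps by simp
      have "polyfn n (int k * 1 + (0 + (\<Sum>j\<in>{1..n} - {i}. int (e j) * 1)))
          (\<lambda>y. y i ^ k * (c ^ (e i - Suc k) * r y))"
        unfolding r_def
        by (intro polyfn_mult polyfn_power polyfn_const polyfn_prod polyfn_var) (use assms(2) in auto)
      then show "polyfn n (d - 1) (\<lambda>y. y i ^ k * (c ^ (e i - Suc k) * r y))"
        by (rule polyfn_mono) (rule le)
    qed
    then have "polyfn n (d - 1) (\<lambda>y. a * h y + g y)"
      using g by (auto intro: polyfn_add polyfn_scale)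
    moreover have "a * monom_fn n e y + f y = a * monom_fn n e (y(i := c)) + f (y(i := c)) +
        (y i - c) * (a * h y + g y)" for y
      unfolding eq[of y] g(2)[of y] by (simp add: algebra_simps)
    ultimately show ?case by blast
  qed
  then show ?thesis using that by blast
qed

text \<open>The factors are split off one by one. The remainder of the quotient \<open>g\<close> at
  \<open>y (Suc m) = c\<close> is 0 because its product with the factors already removed is a
  vanishing value of \<open>f\<close>, and that product is not the zero function: it equals 1 at the
  constant point \<open>c + 1\<close>.\<close>

lemma polyfn_divide_linear_prod:
  fixes f :: "(nat \<Rightarrow> 'a::field_char_0) \<Rightarrow> 'a"
  assumes f: "polyfn n d f" and m: "m \<le> n"
    and zero: "\<And>i y. i \<in> {1..m} \<Longrightarrow> y i = c \<Longrightarrow> f y = 0"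
  obtains g where "polyfn n (d - int m) g" "\<And>y. f y = (\<Prod>i=1..m. y i - c) * g y"
proof -
  have "\<exists>g. polyfn n (d - int m) g \<and> (\<forall>y. f y = (\<Prod>i=1..m. y i - c) * g y)"
    using m zero
  proof (induction m)
    case 0
    then show ?case using f by auto
  next
    case (Suc m)
    then obtain g where g: "polyfn n (d - int m) g" "\<And>y. f y = (\<Prod>i=1..m. y i - c) * g y"
      by (metis Suc_leD atLeastAtMost_iff le_SucI)
    have "Suc m \<in> {1..n}" using Suc.prems by auto
    then obtain h where h: "polyfn n (d - int m - 1) h"
      "\<And>y. g y = g (y(Suc m := c)) + (y (Suc m) - c) * h y"
      using polyfn_divide_var[OF g(1)] by metis
    have "g (y(Suc m := c)) = 0" for y
    proof (rule polyfn_mult_eq_0[where f = "\<lambda>y. g (y(Suc m := c))"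
          and g = "\<lambda>y. \<Prod>i=1..m. y i - c" and ?y0.0 = "\<lambda>_. c + 1"])
      show "polyfn n (d - int m) (\<lambda>y. g (y(Suc m := c)))"
        using g(1) by (rule polyfn_fix_var) auto
      show "polyfn n (\<Sum>i=1..m. 1) (\<lambda>y. \<Prod>i=1..m. y i - c)"
        by (intro polyfn_prod polyfn_diff polyfn_var polyfn_const) (use Suc.prems in auto)
      fix y :: "nat \<Rightarrow> 'a"
      have "(\<Prod>i=1..m. y i - c) = (\<Prod>i=1..m. (y(Suc m := c)) i - c)"
        by (intro prod.cong) auto
      then show "(\<Prod>i=1..m. y i - c) * g (y(Suc m := c)) = 0"
        using g(2)[of "y(Suc m := c)"] Suc.prems(2)[of "Suc m" "y(Suc m := c)"] by simp
    qed simp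
    then have "f y = (\<Prod>i=1..Suc m. y i - c) * h y" for y
      using g(2)[of y] h(2)[of y] by simp
    moreover have "polyfn n (d - int (Suc m)) h"
      using h(1) by (simp add: algebra_simps)
    ultimately show ?case by blast
  qed
  then show ?thesis using that by blast
qed

section \<open>Symmetric and alternating functions on partitions\<close>

definition symfn :: "nat \<Rightarrow> ((nat \<Rightarrow> 'a) \<Rightarrow> 'b) \<Rightarrow> bool" where
  "symfn n f \<longleftrightarrow> (\<forall>p. p permutes {1..n} \<longrightarrow> (\<forall>y. f (y \<circ> p) = f y))"

text \<open>Adjacent transpositions generate the symmetric group, so the sign of a permutation never
  has to be mentioned.\<close>

definition altfn :: "nat \<Rightarrow> ((nat \<Rightarrow> 'a) \<Rightarrow> 'b::ab_group_add) \<Rightarrow> bool" where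
  "altfn n f \<longleftrightarrow> (\<forall>k y. 1 \<le> k \<longrightarrow> k < n \<longrightarrow> f (y \<circ> transpose k (Suc k)) = - f y)"

lemma symfnD: "symfn n f \<Longrightarrow> p permutes {1..n} \<Longrightarrow> f (y \<circ> p) = f y"
  by (simp add: symfn_def)

lemma altfnD: "altfn n f \<Longrightarrow> 1 \<le> k \<Longrightarrow> k < n \<Longrightarrow> f (y \<circ> transpose k (Suc k)) = - f y"
  by (simp add: altfn_def)

lemma symfn_transpose:
  assumes "symfn n f" "i \<in> {1..n}" "j \<in> {1..n}"
  shows "f (y \<circ> transpose i j) = f y"
  using assms by (intro symfnD permutes_swap_id)

lemma symfn_linear_prod: "symfn n (\<lambda>y :: nat \<Rightarrow> 'a::field. \<Prod>i=1..n. y i - c)"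
  unfolding symfn_def
proof (intro allI impI)
  fix p :: "nat \<Rightarrow> nat" and y :: "nat \<Rightarrow> 'a"
  assume "p permutes {1..n}"
  then show "(\<Prod>i=1..n. (y \<circ> p) i - c) = (\<Prod>i=1..n. y i - c)"
    using prod.permute[of p "{1..n}" "\<lambda>i. y i - c"] by (simp add: comp_def)
qed

lemma polyfn_linear_prod: "m \<le> n \<Longrightarrow> polyfn n (int m) (\<lambda>y. \<Prod>i=1..m. y i - c)"
  using polyfn_prod[of "{1..m}" n "\<lambda>_. 1" "\<lambda>i y. y i - c"]
  by (simp add: polyfn_diff polyfn_var polyfn_const)

text \<open>Adjacent swaps bring the two equal entries next to each other; exchanging them then
  gives \<open>f y = - f y\<close>, which forces 0 in characteristic zero.\<close>

lemma altfn_eq_0: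
  fixes f :: "(nat \<Rightarrow> 'a) \<Rightarrow> 'b::field_char_0"
  assumes "altfn n f" "1 \<le> i" "i < j" "j \<le> n" "y i = y j"
  shows "f y = 0"
  using assms(3-)
proof (induction "j - i" arbitrary: j y)
  case 0
  then show ?case by simp
next
  case (Suc d)
  show ?case
  proof (cases "j = Suc i")
    case True
    have "y \<circ> transpose i (Suc i) = y"
      using Suc.prems True by (auto simp: fun_eq_iff transpose_def)
    then have "f y = - f y"
      using altfnD[OF assms(1,2), of y] Suc.prems True by simp
    then show ?thesis by simp
  next
    case False
    then obtain k where k: "j = Suc k" "i < k"
      using Suc.prems(1) by (metis Suc_lessI less_SucE not0_implies_Suc not_less_zero)
    have "f (y \<circ> transpose k (Suc k)) = 0"
      by (rule Suc.hyps(1)[of k]) (use Suc.prems Suc.hyps(2) k in \<open>auto simp: transpose_def\<close>)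
    then show ?thesis
      using altfnD[OF assms(1), of k y] Suc.prems k assms(2) by simp
  qed
qed

lemma altfn_eq_0_of_last:
  fixes f :: "(nat \<Rightarrow> 'a) \<Rightarrow> 'b::field_char_0"
  assumes "altfn n f" and last: "\<And>y. y n = c \<Longrightarrow> f y = 0" and i: "1 \<le> i" "i \<le> n" "y i = c"
  shows "f y = 0"
  using i
proof (induction "n - i" arbitrary: i y)
  case 0
  then show ?case using last by simp
next
  case (Suc d)
  have "f (y \<circ> transpose i (Suc i)) = 0"
    by (rule Suc.hyps(1)[of "Suc i"]) (use Suc.prems Suc.hyps(2) in auto)
  then show ?case
    using altfnD[OF assms(1), of i y] Suc.prems Suc.hyps(2) by simp
qed

text \<open>The symmetric factor is cancelled from the sign rule as a nonzero polynomial function,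
  so the conclusion holds also at the zeros of \<open>h\<close>.\<close>

lemma altfn_divide:
  fixes g :: "(nat \<Rightarrow> 'a::field_char_0) \<Rightarrow> 'a"
  assumes g: "polyfn n d g" and h: "polyfn n d' h" "symfn n h" "h y0 \<noteq> 0"
    and "altfn n (\<lambda>y. h y * g y)"
  shows "altfn n g"
  unfolding altfn_def
proof (intro allI impI)
  fix k :: nat and y :: "nat \<Rightarrow> 'a"
  assume k: "1 \<le> k" "k < n"
  let ?t = "transpose k (Suc k)"
  have t: "?t permutes {1..n}" using k by (intro permutes_swap_id) auto
  have "g (y \<circ> ?t) + g y = 0"
  proof (rule polyfn_mult_eq_0[OF _ h(1), where f = "\<lambda>y. g (y \<circ> ?t) + g y" and ?y0.0 = y0])
    show "polyfn n d (\<lambda>y. g (y \<circ> ?t) + g y)"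
      by (intro polyfn_add polyfn_permute g t)
    fix y
    have "h (y \<circ> ?t) * g (y \<circ> ?t) = - (h y * g y)"
      using altfnD[OF assms(5) k] by simp
    then show "h y * (g (y \<circ> ?t) + g y) = 0"
      using symfnD[OF h(2) t, of y] by (simp add: algebra_simps)
  qed (rule h(3))
  then show "g (y \<circ> ?t) = - g y" by (simp add: eq_neg_iff_add_eq_0)
qed

section \<open>Partitions with a zero last part or with a full column\<close>

lemma partitions_Suc_last:
  "lam \<in> partitions n \<longleftrightarrow> lam \<in> partitions (Suc n) \<and> lam (Suc n) = 0"
proof
  assume lam: "lam \<in> partitions n"
  then have zero: "lam i = 0" if "i \<notin> {1..n}" for i
    using that by (auto simp: partitions_def)
  have "lam j \<le> lam i" if "1 \<le> i" "i \<le> j" "j \<le> Suc n" for i j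
  proof (cases "j = Suc n")
    case False
    then show ?thesis using that lam by (auto simp: partitions_def)
  qed (use zero in simp)
  then show "lam \<in> partitions (Suc n) \<and> lam (Suc n) = 0"
    using zero by (auto simp: partitions_def)
next
  assume lam: "lam \<in> partitions (Suc n) \<and> lam (Suc n) = 0"
  have "lam i = 0" if "i \<notin> {1..n}" for i
    using that lam by (cases "i = Suc n") (auto simp: partitions_def)
  then show "lam \<in> partitions n" using lam by (auto simp: partitions_def)
qed

definition add_column :: "nat \<Rightarrow> (nat \<Rightarrow> nat) \<Rightarrow> nat \<Rightarrow> nat" where
  "add_column n lam = (\<lambda>i. if i \<in> {1..n} then Suc (lam i) else 0)"

lemma add_column_partitions: "lam \<in> partitions n \<Longrightarrow> add_column n lam \<in> partitions n"
  by (auto simp: partitions_def add_column_def)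

lemma psize_add_column: "psize n (add_column n lam) = psize n lam + n"
proof -
  have "psize n (add_column n lam) = (\<Sum>i=1..n. lam i + 1)"
    unfolding psize_def by (intro sum.cong) (auto simp: add_column_def)
  then show ?thesis by (simp only: sum.distrib psize_def) simp
qed

lemma partitions_add_column_cases:
  assumes "lam \<in> partitions n" "lam n \<noteq> 0"
  obtains lam' where "lam' \<in> partitions n" "lam = add_column n lam'"
proof
  have pos: "lam i \<noteq> 0" if "i \<in> {1..n}" for i
    using assms that unfolding partitions_def
    by (metis (no_types, lifting) atLeastAtMost_iff bot_nat_0.extremum_uniqueI mem_Collect_eq order_refl)
  show "(\<lambda>i. lam i - 1) \<in> partitions n"
    using assms(1) by (auto simp: partitions_def intro: diff_le_mono)
  show "lam = add_column n (\<lambda>i. lam i - 1)"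
    using assms(1) pos by (auto simp: add_column_def fun_eq_iff partitions_def)
qed

text \<open>Positions are counted from the end: a partition with last part 0 has, with n + 1 parts
  and \<open>Y\<close>, the same first n coordinates as with n parts and
  \<open>\<lambda>l j. Y l (Suc j)\<close>.\<close>

definition grid_point :: "(nat \<Rightarrow> nat \<Rightarrow> 'a) \<Rightarrow> nat \<Rightarrow> (nat \<Rightarrow> nat) \<Rightarrow> nat \<Rightarrow> 'a" where
  "grid_point Y n lam = (\<lambda>i. Y (lam i) (n - i))"

definition inj2 :: "(nat \<Rightarrow> nat \<Rightarrow> 'a) \<Rightarrow> bool" where
  "inj2 Y \<longleftrightarrow> (\<forall>l j l' j'. Y l j = Y l' j' \<longrightarrow> l = l' \<and> j = j')"

lemma choose_two_Suc: "int (Suc n choose 2) = int (n choose 2) + int n"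
  by (simp add: numeral_2_eq_2)

text \<open>
  The function is divisible by the product of the y_i - Y 0 0: this follows by induction on n after
  setting y_n = Y 0 0. The quotient vanishes at the partitions with a column of length n removed,
  and its degree is smaller by n.
\<close>

theorem altfn_unique:
  fixes A :: "(nat \<Rightarrow> 'a::field_char_0) \<Rightarrow> 'a"
  assumes "inj2 Y" "polyfn n (int (n choose 2) + d) A" "altfn n A"
    "\<And>lam. lam \<in> partitions n \<Longrightarrow> int (psize n lam) \<le> d \<Longrightarrow> A (grid_point Y n lam) = 0"
  shows "A y = 0"
  using assms
proof (induction n arbitrary: Y A d y)
  case 0
  show ?case
  proof (cases "d < 0")
    case True
    then show ?thesis using polyfn_neg[OF 0(2)] by (simp add: binomial_eq_0)
  next
    case False
    have A0: "A (grid_point Y 0 (\<lambda>_. 0)) = 0"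
      by (rule 0(4)) (use False in \<open>auto simp: partitions_def psize_def\<close>)
    have "A y = A (grid_point Y 0 (\<lambda>_. 0))"
      by (rule polyfn_cong[OF 0(2)]) simp
    then show ?thesis using A0 by simp
  qed
next
  case (Suc n)
  define N where "N = Suc n"
  show ?case
    using Suc.prems unfolding N_def[symmetric]
  \<comment> \<open>The measure is the degree bound plus 1, cut off at 0. Removing a column lowers
    \<open>d\<close> by \<open>N\<close>.\<close>
  proof (induction "nat (int (N choose 2) + d + 1)" arbitrary: Y A d y rule: less_induct)
    case less
    note inj = less.prems(1) and A = less.prems(2) and alt = less.prems(3) and zero = less.prems(4)
    show ?case
    proof (cases "int (N choose 2) + d < 0")
      case True
      then show ?thesis using polyfn_neg[OF A] by simp
    next
      case False
      define c where "c = Y 0 0"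
      have A_last: "A y = 0" if "y N = c" for y
      proof -
        \<comment> \<open>With \<open>y N = c\<close> the function is still alternating in the other
          variables and vanishes whenever one of them equals \<open>c\<close>. Dividing by these n
          linear factors replaces \<open>N choose 2\<close> by \<open>n choose 2\<close> in the
          degree bound and keeps \<open>d\<close>, so the induction on n applies.\<close>
        define R where "R y = A (y(N := c))" for y
        have R: "polyfn n (int (N choose 2) + d) R"
          unfolding R_def N_def using A[unfolded N_def] by (rule polyfn_fix_var) auto
        have R0: "R y = 0" if "i \<in> {1..n}" "y i = c" for i y
          unfolding R_def by (rule altfn_eq_0[OF alt, of i N]) (use that N_def in auto)
        obtain R' where R': "polyfn n (int (N choose 2) + d - int n) R'"
            "\<And>y. R y = (\<Prod>i=1..n. y i - c) * R' y"
          by (rule polyfn_divide_linear_prod[OF R order_refl]) (use R0 in blast)+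
        have altR: "altfn n R"
          unfolding altfn_def
        proof (intro allI impI)
          fix k :: nat and y :: "nat \<Rightarrow> 'a" assume k: "1 \<le> k" "k < n"
          have "(y \<circ> transpose k (Suc k))(N := c) = y(N := c) \<circ> transpose k (Suc k)"
            using k by (auto simp: N_def transpose_def fun_eq_iff)
          then show "R (y \<circ> transpose k (Suc k)) = - R y"
            using altfnD[OF alt k(1)] k by (simp add: R_def N_def)
        qed
        have "R' y = 0" for y
        proof (rule Suc.IH[where Y = "\<lambda>l j. Y l (Suc j)" and A = R' and d = d])
          show "inj2 (\<lambda>l j. Y l (Suc j))" using inj unfolding inj2_def by blast
          show "polyfn n (int (n choose 2) + d) R'"
            using R'(1) unfolding N_def choose_two_Suc by (simp add: algebra_simps)
          show "altfn n R'"
            using R'(1) polyfn_linear_prod[OF order_refl] symfn_linear_prod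
            by (rule altfn_divide[where h = "\<lambda>y. \<Prod>i=1..n. y i - c" and ?y0.0 = "\<lambda>_. c + 1"])
              (simp_all add: altR del: One_nat_def flip: R'(2))
          fix lam assume lam: "lam \<in> partitions n" "int (psize n lam) \<le> d"
          let ?z = "grid_point (\<lambda>l j. Y l (Suc j)) n lam"
          have lamN: "lam \<in> partitions N" "lam N = 0"
            unfolding N_def using lam(1) partitions_Suc_last by blast+
          have "R ?z = A (grid_point Y N lam)"
            unfolding R_def
          proof (rule polyfn_cong[OF A])
            fix i assume "i \<in> {1..N}"
            then show "(?z(N := c)) i = grid_point Y N lam i"
              using lamN(2) by (cases "i = N") (auto simp: grid_point_def c_def N_def Suc_diff_le)
          qed
          also have "\<dots> = 0"
            by (rule zero) (use lam lamN in \<open>auto simp: psize_def N_def\<close>)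
          finally have "(\<Prod>i=1..n. ?z i - c) * R' ?z = 0" by (simp add: R'(2))
          moreover have "(\<Prod>i=1..n. ?z i - c) \<noteq> 0"
            using inj by (auto simp: grid_point_def c_def inj2_def)
          ultimately show "R' ?z = 0" by simp
        qed
        then show ?thesis using R'(2)[of y] that by (simp add: R_def fun_upd_idem)
      qed
      have A0: "A y = 0" if "i \<in> {1..N}" "y i = c" for i y
        using altfn_eq_0_of_last[OF alt A_last, of c i y] that by simp
      obtain A' where A': "polyfn N (int (N choose 2) + d - int N) A'"
          "\<And>y. A y = (\<Prod>i=1..N. y i - c) * A' y"
        by (rule polyfn_divide_linear_prod[OF A order_refl]) (use A0 in blast)+
      have "A' y = 0" for y
      proof (rule less.hyps[where d = "d - int N" and Y = "\<lambda>l j. Y (Suc l) j" and A = A'])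
        show "nat (int (N choose 2) + (d - int N) + 1) < nat (int (N choose 2) + d + 1)"
          using False by (simp add: N_def)
        show "inj2 (\<lambda>l j. Y (Suc l) j)" using inj unfolding inj2_def by blast
        show "polyfn N (int (N choose 2) + (d - int N)) A'"
          using A'(1) by (simp add: algebra_simps)
        show "altfn N A'"
          using A'(1) polyfn_linear_prod[OF order_refl] symfn_linear_prod
          by (rule altfn_divide[where h = "\<lambda>y. \<Prod>i=1..N. y i - c" and ?y0.0 = "\<lambda>_. c + 1"])
            (simp_all add: alt del: One_nat_def flip: A'(2))
        fix lam assume lam: "lam \<in> partitions N" "int (psize N lam) \<le> d - int N"
        let ?z = "grid_point (\<lambda>l j. Y (Suc l) j) N lam"
        have "A ?z = A (grid_point Y N (add_column N lam))"
          by (rule polyfn_cong[OF A]) (auto simp: grid_point_def add_column_def)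
        also have "\<dots> = 0"
          using lam by (intro zero add_column_partitions) (auto simp: psize_add_column)
        finally have "(\<Prod>i=1..N. ?z i - c) * A' ?z = 0" by (simp add: A'(2))
        moreover have "(\<Prod>i=1..N. ?z i - c) \<noteq> 0"
          using inj by (auto simp: grid_point_def c_def inj2_def)
        ultimately show "A' ?z = 0" by simp
      qed
      then show ?thesis by (simp add: A'(2))
    qed
  qed
qed

section \<open>The Vandermonde product\<close>

fun vandermonde :: "nat \<Rightarrow> (nat \<Rightarrow> 'a::comm_ring_1) \<Rightarrow> 'a" where
  "vandermonde 0 y = 1"
| "vandermonde (Suc n) y = vandermonde n y * (\<Prod>i=1..n. y i - y (Suc n))"

lemma vandermonde_cong:
  "(\<And>i. i \<in> {1..n} \<Longrightarrow> y i = z i) \<Longrightarrow> vandermonde n y = vandermonde n z"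
  by (induction n) (auto intro!: arg_cong2[of _ _ _ _ "(*)"] prod.cong)

lemma polyfn_vandermonde:
  "n \<le> m \<Longrightarrow> polyfn m (int (n choose 2)) (vandermonde n :: (nat \<Rightarrow> 'a::field) \<Rightarrow> 'a)"
proof (induction n)
  case 0
  then show ?case by (simp add: polyfn_const eta_contract_eq)
next
  case (Suc n)
  have "polyfn m (\<Sum>i=1..n. 1) (\<lambda>y :: nat \<Rightarrow> 'a. \<Prod>i=1..n. y i - y (Suc n))"
    by (intro polyfn_prod polyfn_diff polyfn_var) (use Suc.prems in auto)
  then have "polyfn m (int n) (\<lambda>y :: nat \<Rightarrow> 'a. \<Prod>i=1..n. y i - y (Suc n))" by simp
  then have "polyfn m (int (n choose 2) + int n)
      (\<lambda>y :: nat \<Rightarrow> 'a. vandermonde n y * (\<Prod>i=1..n. y i - y (Suc n)))"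
    by (rule polyfn_mult[OF Suc.IH[OF Suc_leD[OF Suc.prems]]])
  then show ?case unfolding choose_two_Suc vandermonde.simps .
qed

lemma vandermonde_eq_0_iff:
  fixes y :: "nat \<Rightarrow> 'a::idom"
  shows "vandermonde n y = 0 \<longleftrightarrow> (\<exists>i j. 1 \<le> i \<and> i < j \<and> j \<le> n \<and> y i = y j)"
proof (induction n)
  case (Suc n)
  have "vandermonde (Suc n) y = 0 \<longleftrightarrow> vandermonde n y = 0 \<or> (\<exists>i\<in>{1..n}. y i = y (Suc n))"
    by auto
  also have "\<dots> \<longleftrightarrow> (\<exists>i j. 1 \<le> i \<and> i < j \<and> j \<le> Suc n \<and> y i = y j)"
    unfolding Suc.IH by (metis Suc_leI atLeastAtMost_iff le_Suc_eq le_imp_less_Suc less_Suc_eq_le)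
  finally show ?case .
qed auto

lemma vandermonde_altfn: "altfn n (vandermonde n :: (nat \<Rightarrow> 'a::comm_ring_1) \<Rightarrow> 'a)"
  unfolding altfn_def
proof (intro allI impI)
  fix k :: nat and y :: "nat \<Rightarrow> 'a"
  assume k: "1 \<le> k" "k < n"
  then show "vandermonde n (y \<circ> transpose k (Suc k)) = - vandermonde n y"
  proof (induction n)
    case (Suc n)
    let ?t = "transpose k (Suc k)"
    show ?case
    proof (cases "k < n")
      case True
      have t: "?t permutes {1..n}" using Suc.prems True by (intro permutes_swap_id) auto
      have "?t (Suc n) = Suc n" using True by (simp add: transpose_def)
      moreover have "(\<Prod>i=1..n. y (?t i) - y (Suc n)) = (\<Prod>i=1..n. y i - y (Suc n))"
        using prod.permute[OF t, of "\<lambda>i. y i - y (Suc n)"] by (simp add: comp_def)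
      ultimately show ?thesis using Suc.IH Suc.prems True by simp
    next
      case False
      then obtain m where n: "k = n" "n = Suc m" using Suc.prems by (cases n) auto
      \<comment> \<open>Exchanging the last two variables exchanges the two values of
        \<open>P\<close> at them; only the factor containing both variables changes sign.\<close>
      define P where "P c = (\<Prod>i=1..m. y i - c)" for c
      have van: "vandermonde (Suc k) z = vandermonde m z *
          (\<Prod>i=1..m. z i - z k) * ((\<Prod>i=1..m. z i - z (Suc k)) * (z k - z (Suc k)))"
        for z :: "nat \<Rightarrow> 'a"
        by (simp add: n)
      have t1: "vandermonde m (y \<circ> ?t) = vandermonde m y"
        by (rule vandermonde_cong) (auto simp: n transpose_def)
      have t2: "(\<Prod>i=1..m. (y \<circ> ?t) i - c) = P c" for c
        unfolding P_def by (rule prod.cong) (auto simp: n transpose_def)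
      have t3: "(y \<circ> ?t) k = y (Suc k)" "(y \<circ> ?t) (Suc k) = y k"
        by simp_all
      have "vandermonde (Suc k) (y \<circ> ?t) =
          vandermonde m y * P (y (Suc k)) * (P (y k) * (y (Suc k) - y k))"
        unfolding van[of "y \<circ> ?t"] t1 t2 t3 ..
      moreover have "vandermonde (Suc k) y =
          vandermonde m y * P (y k) * (P (y (Suc k)) * (y k - y (Suc k)))"
        unfolding van P_def ..
      ultimately show ?thesis
        unfolding n(1)[symmetric] by (simp only: mult_minus_right[symmetric] minus_diff_eq mult_ac)
    qed
  qed simp
qed

text \<open>Multiplication by the Vandermonde product reduces this to alternating functions. It can
  be cancelled since it is nonzero at the point \<open>of_nat\<close>, whose coordinates are
  distinct.\<close>

theorem symfn_unique:
  fixes f :: "(nat \<Rightarrow> 'a::field_char_0) \<Rightarrow> 'a"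
  assumes "inj2 Y" "polyfn n d f" "symfn n f"
    "\<And>lam. lam \<in> partitions n \<Longrightarrow> int (psize n lam) \<le> d \<Longrightarrow> f (grid_point Y n lam) = 0"
  shows "f y = 0"
proof (rule polyfn_mult_eq_0[OF assms(2) polyfn_vandermonde[OF order_refl], where ?y0.0 = of_nat])
  show "vandermonde n (of_nat :: nat \<Rightarrow> 'a) \<noteq> 0"
    unfolding vandermonde_eq_0_iff by simp
  fix y
  show "vandermonde n y * f y = 0"
  proof (rule altfn_unique[OF assms(1), where A = "\<lambda>y. vandermonde n y * f y" and d = d])
    show "polyfn n (int (n choose 2) + d) (\<lambda>y. vandermonde n y * f y)"
      by (rule polyfn_mult[OF polyfn_vandermonde[OF order_refl] assms(2)])
    show "altfn n (\<lambda>y. vandermonde n y * f y)"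
      unfolding altfn_def
    proof (intro allI impI)
      fix k :: nat and y :: "nat \<Rightarrow> 'a" assume k: "1 \<le> k" "k < n"
      then show "vandermonde n (y \<circ> transpose k (Suc k)) * f (y \<circ> transpose k (Suc k)) =
          - (vandermonde n y * f y)"
        using altfnD[OF vandermonde_altfn k, of y] symfn_transpose[OF assms(3), of k "Suc k" y]
        by simp
    qed
  qed (simp add: assms(4))
qed

section \<open>Existence of interpolating functions\<close>

definition pad :: "'a \<Rightarrow> nat set \<Rightarrow> (nat \<Rightarrow> 'a) \<Rightarrow> nat \<Rightarrow> 'a" where
  "pad c S y = (\<lambda>i. if i \<in> S then y i else c)"

text \<open>\<open>f\<close> is meant to be a symmetric function of n variables, while
  \<open>y\<close> has n + 1 coordinates. For a proper subset \<open>S\<close> of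
  \<open>{1..Suc n}\<close> some padded coordinate is moved to position \<open>Suc n\<close>, where
  \<open>f\<close> does not look, so that \<open>f\<close> receives the other n coordinates.\<close>

definition pad_value :: "nat \<Rightarrow> 'a \<Rightarrow> ((nat \<Rightarrow> 'a) \<Rightarrow> 'b) \<Rightarrow> nat set \<Rightarrow> (nat \<Rightarrow> 'a) \<Rightarrow> 'b" where
  "pad_value n c f S y =
    f (pad c S y \<circ> transpose (SOME m. m \<in> {1..Suc n} - S) (Suc n))"

lemma symfn_comp_perm:
  assumes f: "symfn n f" and p: "p permutes {1..Suc n}" and q: "q permutes {1..Suc n}"
    and eq: "p (Suc n) = q (Suc n)"
  shows "f (w \<circ> p) = f (w \<circ> q)"
proof -
  have iq: "inv q permutes {1..Suc n}" using q by (rule permutes_inv)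
  have "inv q \<circ> p permutes {1..Suc n}" using p iq by (rule permutes_compose)
  moreover have "(inv q \<circ> p) x = x" if "x \<in> {1..Suc n} - {1..n}" for x
  proof -
    have "x = Suc n" using that by auto
    then show ?thesis using eq permutes_inverses(2)[OF q] by simp
  qed
  ultimately have "inv q \<circ> p permutes {1..n}"
    by (rule permutes_superset) blast
  then have "f ((w \<circ> q) \<circ> (inv q \<circ> p)) = f (w \<circ> q)" by (rule symfnD[OF f])
  moreover have "(w \<circ> q) \<circ> (inv q \<circ> p) = w \<circ> p"
    using permutes_inverses(1)[OF q] by (simp add: fun_eq_iff)
  ultimately show ?thesis by simp
qed

text \<open>Any padded index may be the discarded one: all of them carry the value \<open>c\<close>,
  so exchanging two of them leaves the padded point unchanged.\<close>

lemma pad_value_eq: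
  assumes f: "symfn n f" and m: "m \<in> {1..Suc n} - S"
    and p: "p permutes {1..Suc n}" "p (Suc n) = m"
  shows "pad_value n c f S y = f (pad c S y \<circ> p)"
proof -
  define k where "k = (SOME m. m \<in> {1..Suc n} - S)"
  have k: "k \<in> {1..Suc n} - S" unfolding k_def using m by (metis someI_ex)
  have "pad c S y = pad c S y \<circ> transpose k m"
    using k m by (auto simp: pad_def transpose_def fun_eq_iff)
  then have "f (pad c S y \<circ> p) = f (pad c S y \<circ> (transpose k m \<circ> p))"
    by (metis comp_assoc)
  also have "\<dots> = f (pad c S y \<circ> transpose k (Suc n))"
    by (rule symfn_comp_perm[OF f])
      (use k m p in \<open>auto intro!: permutes_compose permutes_swap_id simp: transpose_def\<close>)
  finally show ?thesis by (simp add: pad_value_def k_def)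
qed

text \<open>A last coordinate that already equals \<open>c\<close> may be kept or padded with the
  same effect. Properness of \<open>S\<close> in \<open>{1..n}\<close> leaves an index to discard in
  both cases.\<close>

lemma pad_value_insert_last:
  assumes f: "symfn n f" and S: "S \<subset> {1..n}" and y: "y (Suc n) = c"
  shows "pad_value n c f (insert (Suc n) S) y = pad_value n c f S y"
proof -
  obtain m where m: "m \<in> {1..n}" "m \<notin> S" using S by blast
  have t: "transpose m (Suc n) permutes {1..Suc n}"
    using m by (intro permutes_swap_id) auto
  have "pad c (insert (Suc n) S) y = pad c S y"
    using y by (auto simp: pad_def)
  then show ?thesis
    using pad_value_eq[OF f _ t, of m S c y] pad_value_eq[OF f _ t, of m "insert (Suc n) S" c y] m
    by simp
qed

text \<open>
  Inclusion-exclusion over the set of variables that are replaced by c: once the last variable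
  equals c, all terms cancel in pairs except the one keeping exactly the first n variables.
\<close>

lemma polyfn_lift:
  fixes f :: "(nat \<Rightarrow> 'a::field) \<Rightarrow> 'a"
  assumes f: "polyfn n d f" "symfn n f"
  obtains g where "polyfn (Suc n) d g" "symfn (Suc n) g"
    "\<And>y. y (Suc n) = c \<Longrightarrow> g y = f y"
proof
  define N where "N = Suc n"
  let ?P = "Pow {1..N} - {{1..N}}" and ?Q = "Pow {1..n} - {{1..n}}"
  \<comment> \<open>The full set is left out because no coordinate could be discarded for it. The
    shift of the sign by \<open>n\<close> gives the surviving term \<open>S = {1..n}\<close> the
    coefficient 1.\<close>
  define g where "g y = (\<Sum>S \<in> ?P. (-1) ^ (n + card S) * pad_value n c f S y)" for y
  show "polyfn (Suc n) d g"
    unfolding g_def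
  proof (intro polyfn_sum polyfn_scale)
    fix S assume S: "S \<in> ?P"
    define k where "k = (SOME m. m \<in> {1..Suc n} - S)"
    show "polyfn (Suc n) d (pad_value n c f S)"
      unfolding pad_value_def k_def[symmetric] comp_def
    proof (rule polyfn_subst[OF f(1)])
      fix i assume "i \<in> {1..n}"
      show "polyfn (Suc n) 1 (\<lambda>y. pad c S y (transpose k (Suc n) i))"
      proof (cases "transpose k (Suc n) i \<in> S")
        case True
        then have "transpose k (Suc n) i \<in> {1..Suc n}" using S by (auto simp: N_def)
        then show ?thesis using True polyfn_var by (simp add: pad_def)
      next
        case False
        then show ?thesis by (simp add: pad_def polyfn_const)
      qed
    qed
  qed
  show "symfn (Suc n) g"
    unfolding symfn_def
  proof (intro allI impI)
    fix p :: "nat \<Rightarrow> nat" and y :: "nat \<Rightarrow> 'a" assume p: "p permutes {1..Suc n}"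
    have inj: "inj p" using p by (rule permutes_inj)
    have bij: "bij_betw ((`) p) (?P) (?P)"
    proof (rule bij_betwI[where g = "(`) (inv p)"])
      have ip: "inv p permutes {1..N}" using p permutes_inv by (auto simp: N_def)
      have "p ` S \<in> ?P" if "p permutes {1..N}" "S \<in> ?P" for p S
        using that permutes_image[OF that(1)] permutes_inj[OF that(1)]
        by (metis Diff_iff PowD PowI image_mono inj_image_eq_iff singletonD singletonI)
      then show "(`) p \<in> ?P \<rightarrow> ?P"
        "(`) (inv p) \<in> ?P \<rightarrow> ?P"
        using p ip unfolding N_def by blast+
    qed (use permutes_inverses[OF p] in \<open>auto simp: image_image\<close>)
    have "pad_value n c f S (y \<circ> p) = pad_value n c f (p ` S) y"
      if S: "S \<in> ?P" for S
    proof -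
      obtain m where m: "m \<in> {1..Suc n} - S" using S unfolding N_def by blast
      have t: "transpose m (Suc n) permutes {1..Suc n}"
        using m by (intro permutes_swap_id) auto
      have "pad c S (y \<circ> p) = pad c (p ` S) y \<circ> p"
        using inj by (auto simp: pad_def fun_eq_iff inj_image_mem_iff)
      then have "pad_value n c f S (y \<circ> p) = f (pad c (p ` S) y \<circ> (p \<circ> transpose m (Suc n)))"
        using pad_value_eq[OF f(2) m t, of c "y \<circ> p"] by (simp add: comp_assoc)
      also have "\<dots> = pad_value n c f (p ` S) y"
        by (rule pad_value_eq[OF f(2), symmetric, of "p m"])
          (use m inj t p permutes_in_image[OF p] in \<open>auto simp: inj_image_mem_iff intro: permutes_compose\<close>)
      finally show ?thesis .
    qed
    then have "g (y \<circ> p) = (\<Sum>S \<in> ?P.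
        (-1) ^ (n + card (p ` S)) * pad_value n c f (p ` S) y)"
      unfolding g_def using card_image[OF inj_on_subset[OF inj subset_UNIV]] by (intro sum.cong) auto
    also have "\<dots> = g y"
      unfolding g_def by (rule sum.reindex_bij_betw[OF bij])
    finally show "g (y \<circ> p) = g y" .
  qed
  fix y :: "nat \<Rightarrow> 'a" assume y: "y (Suc n) = c"
  let ?t = "\<lambda>S. (-1) ^ (n + card S) * pad_value n c f S y"
  have N: "{1..N} = insert N {1..n}" "N \<notin> {1..n}" by (auto simp: N_def)
  have ins: "insert N S = insert N T \<longleftrightarrow> S = T" if "S \<subseteq> {1..n}" "T \<subseteq> {1..n}" for S T
    using that N(2) by (intro insert_ident) blast+
  have "insert N {1..n} \<notin> Pow {1..n}" using N(2) by blast
  \<comment> \<open>Each proper subset \<open>S\<close> of \<open>{1..n}\<close> is paired with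
    \<open>insert N S\<close>; the set \<open>{1..n}\<close> has no partner since the full set was
    left out.\<close>
  with ins have Pow: "?P = Pow {1..n} \<union> insert N ` (?Q)"
    unfolding N(1) Pow_insert by blast
  have "Pow {1..n} \<inter> insert N ` (?Q) = {}" using N(2) by blast
  then have "g y = (\<Sum>S \<in> Pow {1..n}. ?t S) + (\<Sum>S \<in> insert N ` (?Q). ?t S)"
    unfolding g_def Pow by (intro sum.union_disjoint finite_imageI finite_Diff) simp_all
  also have "(\<Sum>S \<in> insert N ` (?Q). ?t S) =
      (\<Sum>S \<in> ?Q. ?t (insert N S))"
    by (subst sum.reindex) (use ins in \<open>auto simp: inj_on_def\<close>)
  also have "\<dots> = (\<Sum>S \<in> ?Q. - ?t S)"
  proof (rule sum.cong[OF refl])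
    fix S assume S: "S \<in> ?Q"
    then have "card (insert N S) = Suc (card S)"
      using N(2) by (intro card_insert_disjoint) (auto intro: finite_subset)
    moreover have "S \<subset> {1..n}" using S by blast
    ultimately show "?t (insert N S) = - ?t S"
      using pad_value_insert_last[where y = y and c = c, OF f(2) _ y, of S] by (simp add: N_def)
  qed
  also have "(\<Sum>S \<in> Pow {1..n}. ?t S) = ?t {1..n} + (\<Sum>S \<in> ?Q. ?t S)"
    by (rule sum.remove) auto
  finally have "g y = pad_value n c f {1..n} y"
    by (simp add: sum_negf flip: mult_2)
  also have "\<dots> = f (pad c {1..n} y \<circ> id)"
    by (rule pad_value_eq[OF f(2), of "Suc n"]) (auto simp: permutes_id)
  also have "\<dots> = f y"
    by (rule polyfn_cong[OF f(1)]) (simp add: pad_def)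
  finally show "g y = f y" .
qed

lemma symfn_add: "symfn n f \<Longrightarrow> symfn n g \<Longrightarrow> symfn n (\<lambda>y. f y + g y)"
  by (simp add: symfn_def)

lemma symfn_mult: "symfn n f \<Longrightarrow> symfn n g \<Longrightarrow> symfn n (\<lambda>y. f y * g y)"
  by (simp add: symfn_def)

text \<open>A Newton type construction along the induction of \<open>altfn_unique\<close>. A
  function lifted from one variable less takes the right values at partitions with last part 0; the
  product \<open>P\<close> vanishes at their points, so a multiple of \<open>P\<close> can correct
  the values at partitions with a full column without disturbing the others.\<close>

theorem symfn_interpolation_exists:
  fixes v :: "(nat \<Rightarrow> nat) \<Rightarrow> 'a::field_char_0"
  assumes "inj2 Y"
  shows "\<exists>f. polyfn n d f \<and> symfn n f \<and>
    (\<forall>lam\<in>partitions n. int (psize n lam) \<le> d \<longrightarrow> f (grid_point Y n lam) = v lam)"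
  using assms
proof (induction n arbitrary: Y v d)
  case 0
  show ?case
  proof (cases "d < 0")
    case True
    then show ?thesis by (intro exI[of _ "\<lambda>_. 0"]) (auto simp: symfn_def polyfn.zero)
  next
    case False
    have "lam = (\<lambda>_. 0)" if "lam \<in> partitions 0" for lam
      using that by (auto simp: partitions_def)
    then show ?thesis using False
      by (intro exI[of _ "\<lambda>_. v (\<lambda>_. 0)"]) (auto simp: symfn_def polyfn_const)
  qed
next
  case (Suc n)
  define N where "N = Suc n"
  show ?case
    using Suc.prems unfolding N_def[symmetric]
  proof (induction "nat (d + 1)" arbitrary: Y v d rule: less_induct)
    case less
    note inj = less.prems
    show ?case
    proof (cases "d < 0")
      case True
      then show ?thesis by (intro exI[of _ "\<lambda>_. 0"]) (auto simp: symfn_def polyfn.zero)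
    next
      case False
      define c where "c = Y 0 0"
      have "inj2 (\<lambda>l j. Y l (Suc j))" using inj unfolding inj2_def by blast
      from Suc.IH[OF this, of d v] obtain f0 where f0: "polyfn n d f0" "symfn n f0"
        "\<And>lam. lam \<in> partitions n \<Longrightarrow> int (psize n lam) \<le> d \<Longrightarrow>
          f0 (grid_point (\<lambda>l j. Y l (Suc j)) n lam) = v lam" by blast
      obtain f where f: "polyfn N d f" "symfn N f" "\<And>y. y N = c \<Longrightarrow> f y = f0 y"
        using polyfn_lift[OF f0(1,2), of c] unfolding N_def by blast
      define P where "P y = (\<Prod>i=1..N. y i - c)" for y
      define z where "z lam = grid_point Y N (add_column N lam)" for lam
      have inj': "inj2 (\<lambda>l j. Y (Suc l) j)" using inj unfolding inj2_def by blast
      have "nat (d - int N + 1) < nat (d + 1)" using False by (simp add: N_def)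
      \<comment> \<open>The values prescribed to the correction are the remaining errors divided by
        \<open>P\<close>, which is nonzero at these points.\<close>
      from less.hyps[OF this inj', of "\<lambda>lam. (v (add_column N lam) - f (z lam)) / P (z lam)"]
      obtain f1 where f1: "polyfn N (d - int N) f1" "symfn N f1"
        "\<And>lam. lam \<in> partitions N \<Longrightarrow> int (psize N lam) \<le> d - int N \<Longrightarrow>
          f1 (grid_point (\<lambda>l j. Y (Suc l) j) N lam) = (v (add_column N lam) - f (z lam)) / P (z lam)"
        by blast
      have P: "polyfn N (int N) P" "symfn N P"
        unfolding P_def using polyfn_linear_prod[OF order_refl] symfn_linear_prod by auto
      define g where "g y = f y + P y * f1 y" for y
      have "polyfn N (int N + (d - int N)) (\<lambda>y. P y * f1 y)"
        using P(1) f1(1) by (rule polyfn_mult)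
      then have "polyfn N d g"
        unfolding g_def using f(1) by (intro polyfn_add) auto
      moreover have "symfn N g"
        unfolding g_def by (intro symfn_add symfn_mult f f1 P)
      moreover have "g (grid_point Y N lam) = v lam"
        if lam: "lam \<in> partitions N" "int (psize N lam) \<le> d" for lam
      proof (cases "lam N = 0")
        case True
        have last: "grid_point Y N lam N = c" using True by (simp add: grid_point_def c_def)
        then have "P (grid_point Y N lam) = 0"
          unfolding P_def by (auto simp: N_def)
        then have "g (grid_point Y N lam) = f0 (grid_point Y N lam)"
          using f(3)[of "grid_point Y N lam"] last by (simp add: g_def)
        also have "\<dots> = f0 (grid_point (\<lambda>l j. Y l (Suc j)) n lam)"
          by (rule polyfn_cong[OF f0(1)]) (auto simp: grid_point_def N_def Suc_diff_le)
        also have "\<dots> = v lam"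
        proof (rule f0(3))
          show "lam \<in> partitions n"
            using lam(1) True partitions_Suc_last unfolding N_def by blast
          show "int (psize n lam) \<le> d"
            using lam(2) True by (simp add: psize_def N_def)
        qed
        finally show ?thesis .
      next
        case False
        obtain lam' where lam': "lam' \<in> partitions N" "lam = add_column N lam'"
          using partitions_add_column_cases[OF lam(1) False] by blast
        have "f1 (grid_point Y N lam) = f1 (grid_point (\<lambda>l j. Y (Suc l) j) N lam')"
          by (rule polyfn_cong[OF f1(1)]) (auto simp: grid_point_def lam'(2) add_column_def)
        also have "\<dots> = (v lam - f (z lam')) / P (z lam')"
          using lam lam' by (subst f1(3)) (auto simp: psize_add_column)
        finally have "f1 (grid_point Y N lam) = (v lam - f (grid_point Y N lam)) / P (grid_point Y N lam)"
          by (simp add: z_def lam'(2))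
        moreover have "P (grid_point Y N lam) \<noteq> 0"
          using inj by (auto simp: P_def grid_point_def c_def inj2_def lam'(2) add_column_def)
        ultimately show ?thesis by (simp add: g_def)
      qed
      ultimately show ?thesis by blast
    qed
  qed
qed

section \<open>Extra vanishing\<close>

text \<open>
  The data of a difference operator acting on symmetric functions of n variables. A variable at
  the point (l, j) is replaced by Y l j with weight U0, or by the lowered value R1 l j with
  weight U1. Conjugation by the Vandermonde determinant in the values P0, P1 makes the weights of
  all lowerings that leave the set of partitions vanish. By poly_shift the operator sends functions
  on the grid Y to functions on the grid W without raising the degree. The free point (l0, j0) at which
  U0 vanishes plays the role of a spectral parameter.
\<close>

locale shift_data =
  fixes Y W P0 P1 R1 :: "nat \<Rightarrow> nat \<Rightarrow> 'a::field_char_0"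
    and U0 U1 :: "nat \<Rightarrow> nat \<Rightarrow> nat \<Rightarrow> nat \<Rightarrow> 'a"
  assumes inj_Y: "inj2 Y" and inj_W: "inj2 W"
    and R1_Suc: "R1 (Suc l) j = Y l j"
    and P1_Suc: "P1 l (Suc j) = P0 l j"
    and P0_neq: "j \<noteq> j' \<Longrightarrow> P0 l j \<noteq> P0 l' j'"
    and U1_0: "U1 l0 j0 0 0 = 0"
    and U0_eq_0_iff: "U0 l0 j0 l j = 0 \<longleftrightarrow> l = l0 \<and> j = j0"
    and poly_shift: "\<exists>p. degree p \<le> k + m \<and>
      (\<forall>l j. U0 l0 j0 l j * P0 l j ^ k * Y l j ^ m + U1 l0 j0 l j * P1 l j ^ k * R1 l j ^ m = poly p (W l j))"
begin

definition choice :: "nat set \<Rightarrow> (nat \<Rightarrow> nat \<Rightarrow> 'a) \<Rightarrow> (nat \<Rightarrow> nat \<Rightarrow> 'a) \<Rightarrow>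
    (nat \<Rightarrow> nat) \<Rightarrow> (nat \<Rightarrow> nat) \<Rightarrow> nat \<Rightarrow> 'a" where
  "choice I A B l j = (\<lambda>i. if i \<in> I then B (l i) (j i) else A (l i) (j i))"

text \<open>The index functions \<open>l\<close> and \<open>j\<close> are arbitrary instead of a
  partition and \<open>\<lambda>i. n - i\<close>, and \<open>V\<close> is arbitrary too: this allows
  permuting the positions and expanding \<open>V\<close> in monomials. The operator is left
  undivided by \<open>V\<close>.\<close>

definition shift_term :: "nat \<Rightarrow> nat \<Rightarrow> nat \<Rightarrow> ((nat \<Rightarrow> 'a) \<Rightarrow> 'a) \<Rightarrow> ((nat \<Rightarrow> 'a) \<Rightarrow> 'a) \<Rightarrow>
    (nat \<Rightarrow> nat) \<Rightarrow> (nat \<Rightarrow> nat) \<Rightarrow> nat set \<Rightarrow> 'a" where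
  "shift_term n l0 j0 V f l j I = (\<Prod>i=1..n. choice I (U0 l0 j0) (U1 l0 j0) l j i) *
     (V (choice I P0 P1 l j) * f (choice I Y R1 l j))"

definition shift_op :: "nat \<Rightarrow> nat \<Rightarrow> nat \<Rightarrow> ((nat \<Rightarrow> 'a) \<Rightarrow> 'a) \<Rightarrow> ((nat \<Rightarrow> 'a) \<Rightarrow> 'a) \<Rightarrow>
    (nat \<Rightarrow> nat) \<Rightarrow> (nat \<Rightarrow> nat) \<Rightarrow> 'a" where
  "shift_op n l0 j0 V f l j = (\<Sum>I\<in>Pow {1..n}. shift_term n l0 j0 V f l j I)"

lemma shift_op_add_right: "shift_op n l0 j0 V (\<lambda>y. c * f y + g y) l j =
    c * shift_op n l0 j0 V f l j + shift_op n l0 j0 V g l j"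
  by (simp add: shift_op_def shift_term_def algebra_simps sum_distrib_left sum.distrib)

lemma shift_op_add_left: "shift_op n l0 j0 (\<lambda>y. c * V y + V' y) f l j =
    c * shift_op n l0 j0 V f l j + shift_op n l0 j0 V' f l j"
  by (simp add: shift_op_def shift_term_def algebra_simps sum_distrib_left sum.distrib)

text \<open>For two monomials the sum over all subsets \<open>I\<close> is the expansion of a
  product of n binomials, one for each position, and \<open>poly_shift\<close> makes each binomial a
  polynomial in the value of \<open>W\<close> there.\<close>

lemma shift_op_monom:
  "\<exists>g. polyfn n (int (psize n a) + int (psize n b)) g \<and>
    (\<forall>l j. shift_op n l0 j0 (monom_fn n a) (monom_fn n b) l j = g (\<lambda>i. W (l i) (j i)))"
proof -
  have "\<forall>i. \<exists>p. degree p \<le> a i + b i \<and> (\<forall>l j. U0 l0 j0 l j * P0 l j ^ a i * Y l j ^ b i +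
      U1 l0 j0 l j * P1 l j ^ a i * R1 l j ^ b i = poly p (W l j))"
    using poly_shift by blast
  then obtain p where p: "\<And>i. degree (p i) \<le> a i + b i"
    "\<And>i l j. U0 l0 j0 l j * P0 l j ^ a i * Y l j ^ b i +
      U1 l0 j0 l j * P1 l j ^ a i * R1 l j ^ b i = poly (p i) (W l j)"
    by metis
  define g where "g y = (\<Prod>i=1..n. poly (p i) (y i))" for y :: "nat \<Rightarrow> 'a"
  have "polyfn n (\<Sum>i=1..n. int (a i + b i)) g"
    unfolding g_def
  proof (rule polyfn_prod)
    fix i assume i: "i \<in> {1..n}"
    have "polyfn n (int (a i + b i)) (\<lambda>y. \<Sum>k\<le>degree (p i). coeff (p i) k * y i ^ k)"
    proof (intro polyfn_sum polyfn_scale)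
      fix k assume "k \<in> {..degree (p i)}"
      then have "int k * 1 \<le> int (a i + b i)" using p(1)[of i] by simp
      then show "polyfn n (int (a i + b i)) (\<lambda>y. y i ^ k)"
        by (rule polyfn_mono[rotated]) (intro polyfn_power polyfn_var i)
    qed
    then show "polyfn n (int (a i + b i)) (\<lambda>y. poly (p i) (y i))"
      by (simp add: poly_altdef)
  qed
  moreover have "(\<Sum>i=1..n. int (a i + b i)) = int (psize n a) + int (psize n b)"
    by (simp add: psize_def sum.distrib)
  moreover have "shift_op n l0 j0 (monom_fn n a) (monom_fn n b) l j = g (\<lambda>i. W (l i) (j i))" for l j
  proof -
    let ?A = "\<lambda>i. U0 l0 j0 (l i) (j i) * P0 (l i) (j i) ^ a i * Y (l i) (j i) ^ b i"
    let ?B = "\<lambda>i. U1 l0 j0 (l i) (j i) * P1 (l i) (j i) ^ a i * R1 (l i) (j i) ^ b i"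
    have "shift_op n l0 j0 (monom_fn n a) (monom_fn n b) l j =
        (\<Sum>I\<in>Pow {1..n}. \<Prod>i=1..n. if i \<in> I then ?B i else ?A i)"
      unfolding shift_op_def shift_term_def monom_fn_def prod.distrib[symmetric]
      by (intro sum.cong prod.cong refl) (simp add: choice_def mult.assoc)
    also have "\<dots> = (\<Sum>I\<in>Pow {1..n}. (\<Prod>i\<in>I. ?B i) * (\<Prod>i\<in>{1..n} - I. ?A i))"
    proof (rule sum.cong[OF refl])
      fix I assume "I \<in> Pow {1..n}"
      then have "{1..n} \<inter> {i. i \<in> I} = I" "{1..n} \<inter> - {i. i \<in> I} = {1..n} - I" by auto
      then show "(\<Prod>i=1..n. if i \<in> I then ?B i else ?A i) = (\<Prod>i\<in>I. ?B i) * (\<Prod>i\<in>{1..n} - I. ?A i)"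
        by (simp add: prod.If_cases)
    qed
    also have "\<dots> = (\<Prod>i=1..n. ?B i + ?A i)"
      by (rule prod_add[symmetric]) simp
    finally show ?thesis by (simp add: g_def add.commute flip: p(2))
  qed
  ultimately show ?thesis by metis
qed

lemma shift_op_polyfn:
  assumes V: "polyfn n e V" and f: "polyfn n d f"
  obtains g where "polyfn n (e + d) g"
    "\<And>l j. shift_op n l0 j0 V f l j = g (\<lambda>i. W (l i) (j i))"
proof -
  have "\<exists>g. polyfn n (e + d) g \<and> (\<forall>l j. shift_op n l0 j0 V f l j = g (\<lambda>i. W (l i) (j i)))"
    using V
  proof (induction rule: polyfn.induct)
    case zero
    then show ?case by (intro exI[of _ "\<lambda>_. 0"]) (simp add: shift_op_def shift_term_def polyfn.zero)
  next
    case (add V' a c)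
    have "\<exists>g. polyfn n (e + d) g \<and> (\<forall>l j. shift_op n l0 j0 (monom_fn n a) f l j = g (\<lambda>i. W (l i) (j i)))"
      using f
    proof (induction rule: polyfn.induct)
      case zero
      then show ?case by (intro exI[of _ "\<lambda>_. 0"]) (simp add: shift_op_def shift_term_def polyfn.zero)
    next
      case (add f' b c')
      obtain g1 where g1: "polyfn n (e + d) g1"
        "\<And>l j. shift_op n l0 j0 (monom_fn n a) f' l j = g1 (\<lambda>i. W (l i) (j i))"
        using add.IH by blast
      obtain g2 where g2: "polyfn n (int (psize n a) + int (psize n b)) g2"
        "\<And>l j. shift_op n l0 j0 (monom_fn n a) (monom_fn n b) l j = g2 (\<lambda>i. W (l i) (j i))"
        using shift_op_monom[of n a b l0 j0] by blast
      have "polyfn n (e + d) g2"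
        using g2(1) by (rule polyfn_mono) (use add.hyps \<open>int (psize n a) \<le> e\<close> in simp)
      then have "polyfn n (e + d) (\<lambda>y. c' * g2 y + g1 y)"
        by (intro polyfn_add polyfn_scale g1)
      then show ?case using g1(2) g2(2) by (auto simp: shift_op_add_right)
    qed
    then obtain g1 where g1: "polyfn n (e + d) g1"
      "\<And>l j. shift_op n l0 j0 (monom_fn n a) f l j = g1 (\<lambda>i. W (l i) (j i))" by blast
    obtain g2 where g2: "polyfn n (e + d) g2"
      "\<And>l j. shift_op n l0 j0 V' f l j = g2 (\<lambda>i. W (l i) (j i))" using add.IH by blast
    have "polyfn n (e + d) (\<lambda>y. c * g1 y + g2 y)"
      by (intro polyfn_add polyfn_scale g1 g2)
    then show ?case using g1(2) g2(2) by (auto simp: shift_op_add_left)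
  qed
  then show ?thesis using that by blast
qed

text \<open>Permuting the positions permutes the subsets \<open>I\<close> over which the operator
  sums, so only the sign of \<open>V\<close> remains.\<close>

lemma shift_op_alternating:
  assumes V: "altfn n V" and f: "symfn n f" and k: "1 \<le> k" "k < n"
  shows "shift_op n l0 j0 V f (l \<circ> transpose k (Suc k)) (j \<circ> transpose k (Suc k)) =
    - shift_op n l0 j0 V f l j"
proof -
  let ?t = "transpose k (Suc k)"
  have t: "?t permutes {1..n}" using k by (intro permutes_swap_id) auto
  have ch: "choice I A B (l \<circ> ?t) (j \<circ> ?t) = choice (?t ` I) A B l j \<circ> ?t" for I A B
    by (auto simp: choice_def fun_eq_iff inj_image_mem_iff)
  have bij: "bij_betw ((`) ?t) (Pow {1..n}) (Pow {1..n})"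
  proof (rule bij_betwI[where g = "(`) ?t"])
    show "(`) ?t \<in> Pow {1..n} \<rightarrow> Pow {1..n}" "(`) ?t \<in> Pow {1..n} \<rightarrow> Pow {1..n}"
      using permutes_image[OF t] by (metis Pi_I PowD PowI image_mono)+
  qed (auto simp: image_image)
  let ?u = "\<lambda>I i. choice I (U0 l0 j0) (U1 l0 j0) l j i"
  let ?T = "shift_term n l0 j0 V f l j"
  have "shift_op n l0 j0 V f (l \<circ> ?t) (j \<circ> ?t) = (\<Sum>I\<in>Pow {1..n}. - ?T (?t ` I))"
    unfolding shift_op_def
  proof (rule sum.cong[OF refl])
    fix I
    have "(\<Prod>i=1..n. ?u (?t ` I) (?t i)) = (\<Prod>i=1..n. ?u (?t ` I) i)"
      using prod.permute[OF t, of "?u (?t ` I)"] by (simp add: comp_def)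
    then show "shift_term n l0 j0 V f (l \<circ> ?t) (j \<circ> ?t) I = - ?T (?t ` I)"
      unfolding shift_term_def ch altfnD[OF V k] symfnD[OF f t] by simp
  qed
  also have "\<dots> = - (\<Sum>I\<in>Pow {1..n}. ?T (?t ` I))" by (simp add: sum_negf)
  also have "(\<Sum>I\<in>Pow {1..n}. ?T (?t ` I)) = (\<Sum>I\<in>Pow {1..n}. ?T I)"
    by (rule sum.reindex_bij_betw[OF bij])
  finally show ?thesis unfolding shift_op_def .
qed

lemma partitionsI_adjacent:
  assumes step: "\<And>k. 1 \<le> k \<Longrightarrow> k < n \<Longrightarrow> lam (Suc k) \<le> lam k" and zero: "\<And>i. i \<notin> {1..n} \<Longrightarrow> lam i = 0"
  shows "lam \<in> partitions n"
proof -
  have "lam j \<le> lam i" if "1 \<le> i" "i \<le> j" "j \<le> n" for i j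
    using that(2,3)
  proof (induction j rule: dec_induct)
    case (step j)
    then show ?case using assms(1)[of j] that(1) by simp
  qed simp
  then show ?thesis using zero by (simp add: partitions_def)
qed

text \<open>If part \<open>k\<close> is lowered while an equal part \<open>k + 1\<close> is kept,
  \<open>P1_Suc\<close> makes two arguments of the Vandermonde product equal; if a last part 0 is
  lowered, \<open>U1_0\<close> applies. So every surviving term evaluates \<open>f\<close> at a
  genuine partition.\<close>

lemma shift_term_nonzero:
  assumes lam: "lam \<in> partitions n" and f: "polyfn n d f" and I: "I \<subseteq> {1..n}"
    and nz: "shift_term n l0 j0 (vandermonde n) f lam (\<lambda>i. n - i) I \<noteq> 0"
  obtains kap where "kap \<in> partitions n" "\<And>i. kap i \<le> lam i"
    "I \<noteq> {} \<Longrightarrow> psize n kap < psize n lam" "I = {} \<Longrightarrow> kap = lam"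
    "f (grid_point Y n kap) \<noteq> 0"
proof
  let ?u = "choice I (U0 l0 j0) (U1 l0 j0) lam (\<lambda>i. n - i)" and ?v = "choice I P0 P1 lam (\<lambda>i. n - i)"
  define kap where "kap i = (if i \<in> I then lam i - 1 else lam i)" for i
  have decr: "lam (Suc k) \<le> lam k" if "1 \<le> k" "k < n" for k
    using lam that by (auto simp: partitions_def)
  have I_up: "Suc k \<in> I" if "k \<in> I" "k < n" "lam (Suc k) = lam k" for k
  proof (rule ccontr)
    assume "Suc k \<notin> I"
    moreover have "n - k = Suc (n - Suc k)" using that by simp
    ultimately have "?v k = ?v (Suc k)"
      using that P1_Suc by (simp add: choice_def)
    then have "vandermonde n ?v = 0"
      using that I unfolding vandermonde_eq_0_iff by (intro exI[of _ k] exI[of _ "Suc k"]) auto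
    then show False using nz by (simp add: shift_term_def)
  qed
  have last: "lam n \<noteq> 0" if "n \<in> I"
  proof
    assume "lam n = 0"
    then have "?u n = 0"
      using that U1_0 by (simp add: choice_def)
    moreover have "n \<in> {1..n}" using that I by blast
    ultimately have "(\<Prod>i=1..n. ?u i) = 0"
      by (meson finite_atLeastAtMost prod_zero)
    then show False using nz by (simp add: shift_term_def)
  qed
  have pos: "lam i \<noteq> 0" if "i \<in> I" for i
  proof -
    have "i \<le> n" using that I by auto
    \<comment> \<open>A lowered part 0 would force all later parts, which are also 0, to be lowered,
      down to position \<open>n\<close>.\<close>
    then have "i \<in> I \<longrightarrow> 1 \<le> i \<longrightarrow> lam i \<noteq> 0"
    proof (induction i rule: inc_induct)
      case (step i)
      then show ?case using I_up[of i] decr[of i] by (metis Suc_leD le_zero_eq le_SucI One_nat_def)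
    qed (use last in simp)
    then show ?thesis using that I by auto
  qed
  show "kap \<in> partitions n"
  proof (rule partitionsI_adjacent)
    fix k assume k: "1 \<le> k" "k < n"
    show "kap (Suc k) \<le> kap k"
      using decr[OF k] I_up[of k] k by (cases "lam (Suc k) = lam k") (auto simp: kap_def)
  next
    fix i assume "i \<notin> {1..n}"
    then show "kap i = 0" using lam I by (auto simp: kap_def partitions_def)
  qed
  show "kap i \<le> lam i" for i by (simp add: kap_def)
  show "psize n kap < psize n lam" if "I \<noteq> {}"
  proof -
    obtain i where "i \<in> I" using \<open>I \<noteq> {}\<close> by blast
    then show ?thesis unfolding psize_def
      by (intro sum_strict_mono_ex1) (use pos I in \<open>auto simp: kap_def intro!: bexI[of _ i]\<close>)
  qed
  show "kap = lam" if "I = {}" using that by (simp add: kap_def fun_eq_iff)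
  have "f (choice I Y R1 lam (\<lambda>i. n - i)) = f (grid_point Y n kap)"
  proof (rule polyfn_cong[OF f])
    fix i assume "i \<in> {1..n}"
    show "choice I Y R1 lam (\<lambda>i. n - i) i = grid_point Y n kap i"
      using pos[of i] R1_Suc[of "lam i - 1"] by (auto simp: choice_def grid_point_def kap_def)
  qed
  then show "f (grid_point Y n kap) \<noteq> 0" using nz by (auto simp: shift_term_def)
qed

text \<open>The operator with parameter \<open>(mu i0, n - i0)\<close> annihilates \<open>f\<close>:
  at a partition of size at most that of \<open>mu\<close> the only term that could survive is the
  unlowered one at \<open>mu\<close>, whose weight is 0, and uniqueness for alternating functions
  applies. At \<open>nu\<close> every lowered term meets a zero of \<open>f\<close>, since
  \<open>mu\<close> is not contained in \<open>nu\<close>; hence the unlowered term, a nonzero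
  multiple of the value of \<open>f\<close>, is 0 as well.\<close>

theorem extra_vanishing:
  assumes mu: "mu \<in> partitions n" and f: "polyfn n (int (psize n mu)) f" "symfn n f"
    and zero: "\<And>lam. lam \<in> partitions n \<Longrightarrow> psize n lam \<le> psize n mu \<Longrightarrow> lam \<noteq> mu \<Longrightarrow>
      f (grid_point Y n lam) = 0"
    and nu: "nu \<in> partitions n" "psize n nu \<le> psize n mu + 1" "\<not> pcontains n nu mu"
  shows "f (grid_point Y n nu) = 0"
proof (rule ccontr)
  assume fnu: "f (grid_point Y n nu) \<noteq> 0"
  obtain i0 where i0: "i0 \<in> {1..n}" "nu i0 < mu i0"
    using nu(3) by (auto simp: pcontains_def not_le)
  define l0 where "l0 = mu i0"
  define j0 where "j0 = n - i0"
  let ?D = "\<lambda>l j. shift_op n l0 j0 (vandermonde n) f l j"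
  let ?T = "\<lambda>lam. shift_term n l0 j0 (vandermonde n) f lam (\<lambda>i. n - i)"
  obtain g where g: "polyfn n (int (n choose 2) + int (psize n mu)) g"
    "\<And>l j. ?D l j = g (\<lambda>i. W (l i) (j i))"
    using shift_op_polyfn[OF polyfn_vandermonde[OF order_refl] f(1)] by blast
  have "altfn n g"
    unfolding altfn_def
  proof (intro allI impI)
    fix k :: nat and y :: "nat \<Rightarrow> 'a" assume k: "1 \<le> k" "k < n"
    let ?t = "transpose k (Suc k)"
    have t: "?t permutes {1..n}" using k by (intro permutes_swap_id) auto
    have gt: "polyfn n (int (n choose 2) + int (psize n mu)) (\<lambda>y. g (y \<circ> ?t))"
      by (rule polyfn_permute[OF g(1) t])
    have "g (y \<circ> ?t) + g y = 0"
    \<comment> \<open>Alternation of the operator concerns simultaneous permutations of both index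
      functions. Taking all second indices 0 makes them invariant and still leaves infinitely many
      values of \<open>W\<close>.\<close>
    proof (rule polyfn_zero_on_grid[where S = "range (\<lambda>l. W l 0)" and f = "\<lambda>y. g (y \<circ> ?t) + g y"])
      show "polyfn n (int (n choose 2) + int (psize n mu)) (\<lambda>y. g (y \<circ> ?t) + g y)"
        using gt g(1) by (rule polyfn_add)
      show "infinite (range (\<lambda>l. W l 0))"
        using inj_W by (intro range_inj_infinite) (auto simp: inj_def inj2_def)
      fix y :: "nat \<Rightarrow> 'a" assume "\<And>i. i \<in> {1..n} \<Longrightarrow> y i \<in> range (\<lambda>l. W l 0)"
      then have "\<forall>i\<in>{1..n}. \<exists>l. y i = W l 0" by blast
      then obtain l where l: "\<And>i. i \<in> {1..n} \<Longrightarrow> y i = W (l i) 0" by metis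
      have "g y = ?D l (\<lambda>_. 0)"
        unfolding g(2) by (rule polyfn_cong[OF g(1)]) (rule l)
      moreover have "g (y \<circ> ?t) = ?D (l \<circ> ?t) ((\<lambda>_. 0) \<circ> ?t)"
        unfolding g(2) comp_def
        by (rule polyfn_cong[OF g(1)]) (rule l, use permutes_in_image[OF t] in blast)
      ultimately show "g (y \<circ> ?t) + g y = 0"
        using shift_op_alternating[OF vandermonde_altfn f(2) k, of l0 j0 l "\<lambda>_. 0"] by simp
    qed
    then show "g (y \<circ> ?t) = - g y" by (simp add: eq_neg_iff_add_eq_0)
  qed
  moreover have "g (grid_point W n lam) = 0"
    if lam: "lam \<in> partitions n" "int (psize n lam) \<le> int (psize n mu)" for lam
  proof -
    have "?D lam (\<lambda>i. n - i) = 0"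
      unfolding shift_op_def
    proof (rule sum.neutral, rule ballI, rule ccontr)
      fix I assume I: "I \<in> Pow {1..n}"
        and nz: "?T lam I \<noteq> 0"
      obtain kap where kap: "kap \<in> partitions n" "\<And>i. kap i \<le> lam i"
        "I \<noteq> {} \<Longrightarrow> psize n kap < psize n lam" "I = {} \<Longrightarrow> kap = lam"
        "f (grid_point Y n kap) \<noteq> 0"
        using shift_term_nonzero[OF lam(1) f(1) _ nz] I by blast
      have "psize n kap \<le> psize n mu" using kap(3,4) lam(2) by (cases "I = {}") auto
      then have "kap = mu" using zero[OF kap(1)] kap(5) by blast
      then have "I = {}" "lam = mu" using kap(3,4) lam(2) by auto
      then have "choice I (U0 l0 j0) (U1 l0 j0) lam (\<lambda>i. n - i) i0 = 0"
        using U0_eq_0_iff by (simp add: choice_def l0_def j0_def)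
      then have "(\<Prod>i=1..n. choice I (U0 l0 j0) (U1 l0 j0) lam (\<lambda>i. n - i) i) = 0"
        using i0(1) by (meson finite_atLeastAtMost prod_zero)
      then show False using nz by (simp add: shift_term_def)
    qed
    then show ?thesis by (simp add: g(2) grid_point_def)
  qed
  ultimately have "g y = 0" for y
    using altfn_unique[OF inj_W g(1)] by blast
  then have "?D nu (\<lambda>i. n - i) = 0" by (simp add: g(2))
  moreover have "?D nu (\<lambda>i. n - i) = ?T nu {}"
    unfolding shift_op_def
  proof (rule sum.remove[THEN trans])
    show "{} \<in> Pow {1..n}" "finite (Pow {1..n})" by auto
    have "?T nu I = 0" if I: "I \<in> Pow {1..n} - {{}}" for I
    proof (rule ccontr)
      assume nz: "?T nu I \<noteq> 0"
      obtain kap where kap: "kap \<in> partitions n" "\<And>i. kap i \<le> nu i"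
        "I \<noteq> {} \<Longrightarrow> psize n kap < psize n nu" "I = {} \<Longrightarrow> kap = nu"
        "f (grid_point Y n kap) \<noteq> 0"
        using shift_term_nonzero[OF nu(1) f(1) _ nz] I by blast
      have "psize n kap \<le> psize n mu" using kap(3) nu(2) I by auto
      then have "kap = mu" using zero[OF kap(1)] kap(5) by blast
      then show False using kap(2) nu(3) by (auto simp: pcontains_def)
    qed
    then have "(\<Sum>I\<in>Pow {1..n} - {{}}. ?T nu I) = 0" by (intro sum.neutral ballI)
    then show "?T nu {} + (\<Sum>I\<in>Pow {1..n} - {{}}. ?T nu I) = ?T nu {}" by simp
  qed
  \<comment> \<open>The weight could vanish only at \<open>i = i0\<close> with
    \<open>nu i0 = mu i0\<close>, but \<open>nu i0 < mu i0\<close>.\<close>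
  moreover have "(\<Prod>i=1..n. choice {} (U0 l0 j0) (U1 l0 j0) nu (\<lambda>i. n - i) i) \<noteq> 0"
  proof
    assume "(\<Prod>i=1..n. choice {} (U0 l0 j0) (U1 l0 j0) nu (\<lambda>i. n - i) i) = 0"
    then obtain i where "i \<in> {1..n}" "U0 l0 j0 (nu i) (n - i) = 0"
      by (auto simp: choice_def)
    then have "n - i = n - i0" "nu i = mu i0" "i \<le> n"
      using U0_eq_0_iff by (auto simp: l0_def j0_def)
    then show False using i0 by (metis atLeastAtMost_iff diff_diff_cancel less_irrefl)
  qed
  moreover have "vandermonde n (choice {} P0 P1 nu (\<lambda>i. n - i)) \<noteq> 0"
  proof
    assume "vandermonde n (choice {} P0 P1 nu (\<lambda>i. n - i)) = 0"
    then obtain i j where "1 \<le> i" "i < j" "j \<le> n" "P0 (nu i) (n - i) = P0 (nu j) (n - j)"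
      by (auto simp: vandermonde_eq_0_iff choice_def)
    then show False using P0_neq[of "n - i" "n - j"] by auto
  qed
  moreover have "choice {} Y R1 nu (\<lambda>i. n - i) = grid_point Y n nu"
    by (simp add: choice_def grid_point_def)
  ultimately show False using fnu by (simp add: shift_term_def)
qed

end

section \<open>Sums over saturated chains\<close>

definition partitions_upto :: "nat \<Rightarrow> nat \<Rightarrow> (nat \<Rightarrow> nat) set" where
  "partitions_upto n d = {lam \<in> partitions n. psize n lam \<le> d}"

lemma finite_partitions_upto: "finite (partitions_upto n d)"
proof (rule finite_subset)
  show "partitions_upto n d \<subseteq> {f. \<forall>i. (i \<in> {1..n} \<longrightarrow> f i \<in> {..d}) \<and> (i \<notin> {1..n} \<longrightarrow> f i = 0)}"
  proof
    fix lam assume lam: "lam \<in> partitions_upto n d"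
    have "lam i \<le> d" if "i \<in> {1..n}" for i
      using lam member_le_sum[of i "{1..n}" lam] that by (auto simp: partitions_upto_def psize_def)
    then show "lam \<in> {f. \<forall>i. (i \<in> {1..n} \<longrightarrow> f i \<in> {..d}) \<and> (i \<notin> {1..n} \<longrightarrow> f i = 0)}"
      using lam by (auto simp: partitions_upto_def partitions_def)
  qed
qed (intro finite_set_of_finite_funs finite_atLeastAtMost finite_atMost)

lemma pcovers_psize: "pcovers n nu mu \<Longrightarrow> psize n nu = Suc (psize n mu)"
  by (simp add: pcovers_def)

lemma saturated_chains_psize_nth:
  assumes "zs \<in> saturated_chains n lam mu" "i < length zs"
  shows "psize n (zs ! i) + i = psize n lam"
  using assms(2)
proof (induction i)
  case 0
  then show ?case using assms(1) by (auto simp: saturated_chains_def hd_conv_nth)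
next
  case (Suc i)
  then have "pcovers n (zs ! i) (zs ! Suc i)" using assms(1) by (auto simp: saturated_chains_def)
  with Suc show ?case using pcovers_psize by fastforce
qed

lemma saturated_chains_length:
  assumes "zs \<in> saturated_chains n lam mu"
  shows "psize n mu \<le> psize n lam" "length zs = Suc (psize n lam - psize n mu)"
proof -
  have zs: "zs \<noteq> []" "last zs = mu" using assms by (auto simp: saturated_chains_def)
  then have "psize n mu + (length zs - 1) = psize n lam"
    using saturated_chains_psize_nth[OF assms, of "length zs - 1"] by (simp add: last_conv_nth)
  then show "psize n mu \<le> psize n lam" "length zs = Suc (psize n lam - psize n mu)"
    using zs(1) by (cases zs; simp)+
qed

lemma finite_saturated_chains: "finite (saturated_chains n lam mu)"
proof (rule finite_subset)
  show "saturated_chains n lam mu \<subseteq>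
    {zs. set zs \<subseteq> partitions_upto n (psize n lam) \<and> length zs = Suc (psize n lam - psize n mu)}"
  proof (intro subsetI CollectI conjI)
    fix zs x assume zs: "zs \<in> saturated_chains n lam mu" and "x \<in> set zs"
    then obtain i where i: "i < length zs" "x = zs ! i" by (auto simp: in_set_conv_nth)
    have "x \<in> partitions n" using zs \<open>x \<in> set zs\<close> by (auto simp: saturated_chains_def)
    then show "x \<in> partitions_upto n (psize n lam)"
      using saturated_chains_psize_nth[OF zs i(1)] i(2) by (auto simp: partitions_upto_def)
  qed (rule saturated_chains_length)
qed (intro finite_lists_length_eq finite_partitions_upto)

lemma saturated_chains_refl: "lam \<in> partitions n \<Longrightarrow> saturated_chains n lam lam = {[lam]}"
proof (intro equalityI subsetI)
  fix zs assume zs: "zs \<in> saturated_chains n lam lam"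
  then show "zs \<in> {[lam]}"
    using saturated_chains_length(2)[OF zs] by (auto simp: saturated_chains_def length_Suc_conv)
qed (auto simp: saturated_chains_def)

lemma saturated_chains_empty:
  assumes "psize n lam \<le> psize n mu" "lam \<noteq> mu"
  shows "saturated_chains n lam mu = {}"
proof (rule ccontr)
  assume "saturated_chains n lam mu \<noteq> {}"
  then obtain zs where zs: "zs \<in> saturated_chains n lam mu" by blast
  then have "length zs = Suc 0" using saturated_chains_length(2)[OF zs] assms(1) by simp
  then show False using zs assms(2) by (auto simp: saturated_chains_def length_Suc_conv)
qed

lemma saturated_chains_Cons_iff:
  assumes "lam \<in> partitions n" "lam \<noteq> mu"
  shows "zs \<in> saturated_chains n lam mu \<longleftrightarrow>
    (\<exists>kap zs'. zs = lam # zs' \<and> kap \<in> partitions n \<and> pcovers n lam kap \<and> zs' \<in> saturated_chains n kap mu)"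
proof
  assume zs: "zs \<in> saturated_chains n lam mu"
  then obtain kap zs' where eq: "zs = lam # kap # zs'"
    using assms(2) by (cases zs; cases "tl zs") (auto simp: saturated_chains_def)
  have step: "pcovers n (zs ! i) (zs ! Suc i)" if "Suc i < length zs" for i
    using zs that by (auto simp: saturated_chains_def)
  have "pcovers n lam kap" using step[of 0] by (simp add: eq)
  moreover have "pcovers n ((kap # zs') ! i) ((kap # zs') ! Suc i)" if "Suc i < length (kap # zs')" for i
    using step[of "Suc i"] that by (simp add: eq)
  then have "kap # zs' \<in> saturated_chains n kap mu"
    using zs by (auto simp: saturated_chains_def eq)
  ultimately show "\<exists>kap zs'. zs = lam # zs' \<and> kap \<in> partitions n \<and> pcovers n lam kap \<and>
      zs' \<in> saturated_chains n kap mu"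
    using zs by (auto simp: saturated_chains_def eq)
next
  assume "\<exists>kap zs'. zs = lam # zs' \<and> kap \<in> partitions n \<and> pcovers n lam kap \<and>
      zs' \<in> saturated_chains n kap mu"
  then obtain kap zs' where eq: "zs = lam # zs'" and kap: "pcovers n lam kap"
    and zs': "zs' \<in> saturated_chains n kap mu" by blast
  have "pcovers n (zs ! i) (zs ! Suc i)" if "Suc i < length zs" for i
    using that zs' kap by (cases i) (auto simp: eq saturated_chains_def hd_conv_nth)
  then show "zs \<in> saturated_chains n lam mu"
    using zs' assms(1) by (auto simp: eq saturated_chains_def)
qed

lemma saturated_chains_snoc_iff:
  assumes "mu \<in> partitions n" "lam \<noteq> mu"
  shows "zs \<in> saturated_chains n lam mu \<longleftrightarrow>
    (\<exists>nu zs'. zs = zs' @ [mu] \<and> nu \<in> partitions n \<and> pcovers n nu mu \<and> zs' \<in> saturated_chains n lam nu)"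
proof
  assume zs: "zs \<in> saturated_chains n lam mu"
  then have "zs \<noteq> []" "last zs = mu" by (auto simp: saturated_chains_def)
  then obtain ys where ys: "zs = ys @ [mu]" by (metis append_butlast_last_id)
  have "ys \<noteq> []" using zs assms(2) by (auto simp: ys saturated_chains_def)
  then obtain nu zs' where eq: "zs = zs' @ [nu] @ [mu]" using ys by (metis append_assoc rev_exhaust)
  have step: "pcovers n (zs ! i) (zs ! Suc i)" if "Suc i < length zs" for i
    using zs that by (auto simp: saturated_chains_def)
  have "pcovers n nu mu" using step[of "length zs'"] by (simp add: eq nth_append)
  moreover have "pcovers n ((zs' @ [nu]) ! i) ((zs' @ [nu]) ! Suc i)" if "Suc i < length (zs' @ [nu])" for i
    using step[of i] that by (auto simp: eq nth_append split: if_splits)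
  then have "zs' @ [nu] \<in> saturated_chains n lam nu"
    using zs by (auto simp: saturated_chains_def eq hd_append)
  ultimately show "\<exists>nu zs'. zs = zs' @ [mu] \<and> nu \<in> partitions n \<and> pcovers n nu mu \<and>
      zs' \<in> saturated_chains n lam nu"
    using zs by (intro exI[of _ nu] exI[of _ "zs' @ [nu]"]) (auto simp: saturated_chains_def eq)
next
  assume "\<exists>nu zs'. zs = zs' @ [mu] \<and> nu \<in> partitions n \<and> pcovers n nu mu \<and>
      zs' \<in> saturated_chains n lam nu"
  then obtain nu zs' where eq: "zs = zs' @ [mu]" and nu: "pcovers n nu mu"
    and zs': "zs' \<in> saturated_chains n lam nu" by blast
  have "pcovers n (zs ! i) (zs ! Suc i)" if i: "Suc i < length zs" for i
  proof (cases "Suc i < length zs'")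
    case True
    then show ?thesis using zs' by (auto simp: eq saturated_chains_def nth_append)
  next
    case False
    then have "i = length zs' - 1" "Suc i = length zs'"
      using i zs' by (auto simp: eq saturated_chains_def)
    moreover have "zs' ! (length zs' - 1) = nu" "zs' \<noteq> []"
      using zs' by (auto simp: saturated_chains_def last_conv_nth)
    ultimately show ?thesis using nu by (simp add: eq nth_append)
  qed
  then show "zs \<in> saturated_chains n lam mu"
    using zs' assms(1) by (auto simp: eq saturated_chains_def)
qed

text \<open>In (1) the denominators involve only the step and the fixed top \<open>lam\<close>, in
  (2) only the step and the fixed bottom \<open>mu\<close>. With that end fixed, each summand is a
  product of step weights \<open>F\<close>, so one notion serves both formulas.\<close>

definition chain_sum :: "nat \<Rightarrow> ((nat \<Rightarrow> nat) \<Rightarrow> (nat \<Rightarrow> nat) \<Rightarrow> 'a::comm_ring_1) \<Rightarrow>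
    (nat \<Rightarrow> nat) \<Rightarrow> (nat \<Rightarrow> nat) \<Rightarrow> 'a" where
  "chain_sum n F lam mu =
    (\<Sum>zs\<in>saturated_chains n lam mu. \<Prod>i<psize n lam - psize n mu. F (zs ! i) (zs ! Suc i))"

lemma chain_sum_base:
  assumes "lam \<in> partitions n" "psize n lam \<le> psize n mu"
  shows "chain_sum n F lam mu = (if lam = mu then 1 else 0)"
  using assms by (cases "lam = mu") (auto simp: chain_sum_def saturated_chains_refl saturated_chains_empty)

text \<open>Removing the first step keeps the bottom of the chain, on which the step weights of (2)
  depend.\<close>

lemma chain_sum_Cons:
  assumes lam: "lam \<in> partitions n" and gt: "psize n mu < psize n lam"
  shows "chain_sum n F lam mu =
    (\<Sum>kap | kap \<in> partitions n \<and> pcovers n lam kap. F lam kap * chain_sum n F kap mu)"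
proof -
  have ne: "lam \<noteq> mu" using gt by auto
  let ?A = "{kap \<in> partitions n. pcovers n lam kap}"
  have "?A \<subseteq> partitions_upto n (psize n lam)" using pcovers_psize by (auto simp: partitions_upto_def)
  then have fin: "finite ?A" by (rule finite_subset) (rule finite_partitions_upto)
  let ?S = "\<lambda>kap. (#) lam ` saturated_chains n kap mu"
  let ?p = "\<lambda>zs. \<Prod>i<psize n lam - psize n mu. F (zs ! i) (zs ! Suc i)"
  have "saturated_chains n lam mu = (\<Union>kap\<in>?A. ?S kap)"
    using saturated_chains_Cons_iff[OF lam ne] by blast
  then have "chain_sum n F lam mu = (\<Sum>zs\<in>(\<Union>kap\<in>?A. ?S kap). ?p zs)"
    by (simp add: chain_sum_def)
  also have "\<dots> = (\<Sum>kap\<in>?A. \<Sum>zs\<in>?S kap. ?p zs)"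
    by (rule sum.UNION_disjoint)
      (use fin finite_saturated_chains in \<open>auto simp: saturated_chains_def\<close>)
  also have "\<dots> = (\<Sum>kap\<in>?A. F lam kap * chain_sum n F kap mu)"
  proof (rule sum.cong[OF refl])
    fix kap assume kap: "kap \<in> ?A"
    then have k: "psize n lam - psize n mu = Suc (psize n kap - psize n mu)"
      using gt pcovers_psize by fastforce
    have "(\<Sum>zs\<in>?S kap. ?p zs) =
        (\<Sum>zs\<in>saturated_chains n kap mu. ?p (lam # zs))"
      by (subst sum.reindex) (auto simp: inj_on_def)
    also have "\<dots> = (\<Sum>zs\<in>saturated_chains n kap mu. F lam kap *
        (\<Prod>i<psize n kap - psize n mu. F (zs ! i) (zs ! Suc i)))"
    proof (rule sum.cong[OF refl])
      fix zs assume "zs \<in> saturated_chains n kap mu"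
      then have "zs ! 0 = kap" by (auto simp: saturated_chains_def hd_conv_nth)
      then show "?p (lam # zs) = F lam kap * (\<Prod>i<psize n kap - psize n mu. F (zs ! i) (zs ! Suc i))"
        unfolding k prod.lessThan_Suc_shift by simp
    qed
    finally show "(\<Sum>zs\<in>?S kap. ?p zs) = F lam kap * chain_sum n F kap mu"
      by (simp add: chain_sum_def sum_distrib_left)
  qed
  finally show ?thesis .
qed

text \<open>Removing the last step keeps the top of the chain, on which the step weights of (1)
  depend.\<close>

lemma chain_sum_snoc:
  assumes lam: "lam \<in> partitions n" and mu: "mu \<in> partitions n" and gt: "psize n mu < psize n lam"
  shows "chain_sum n F lam mu =
    (\<Sum>nu | nu \<in> partitions n \<and> pcovers n nu mu. chain_sum n F lam nu * F nu mu)"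
proof -
  have ne: "lam \<noteq> mu" using gt by auto
  let ?A = "{nu \<in> partitions n. pcovers n nu mu}"
  have "?A \<subseteq> partitions_upto n (Suc (psize n mu))" using pcovers_psize by (auto simp: partitions_upto_def)
  then have fin: "finite ?A" by (rule finite_subset) (rule finite_partitions_upto)
  let ?S = "\<lambda>nu. (\<lambda>zs. zs @ [mu]) ` saturated_chains n lam nu"
  let ?p = "\<lambda>zs. \<Prod>i<psize n lam - psize n mu. F (zs ! i) (zs ! Suc i)"
  have "saturated_chains n lam mu = (\<Union>nu\<in>?A. ?S nu)"
    using saturated_chains_snoc_iff[OF mu ne] by blast
  then have "chain_sum n F lam mu = (\<Sum>zs\<in>(\<Union>nu\<in>?A. ?S nu). ?p zs)"
    by (simp add: chain_sum_def)
  also have "\<dots> = (\<Sum>nu\<in>?A. \<Sum>zs\<in>?S nu. ?p zs)"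
    by (rule sum.UNION_disjoint)
      (use fin finite_saturated_chains in \<open>auto simp: saturated_chains_def\<close>)
  also have "\<dots> = (\<Sum>nu\<in>?A. chain_sum n F lam nu * F nu mu)"
  proof (rule sum.cong[OF refl])
    fix nu assume nu: "nu \<in> ?A"
    then have k: "psize n lam - psize n mu = Suc (psize n lam - psize n nu)"
      using gt pcovers_psize by fastforce
    have "(\<Sum>zs\<in>?S nu. ?p zs) =
        (\<Sum>zs\<in>saturated_chains n lam nu. ?p (zs @ [mu]))"
      by (subst sum.reindex) (auto simp: inj_on_def)
    also have "\<dots> = (\<Sum>zs\<in>saturated_chains n lam nu.
        (\<Prod>i<psize n lam - psize n nu. F (zs ! i) (zs ! Suc i)) * F nu mu)"
    proof (rule sum.cong[OF refl])
      fix zs assume zs: "zs \<in> saturated_chains n lam nu"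
      note len = saturated_chains_length(2)[OF zs]
      have "zs ! (length zs - 1) = nu"
        using zs by (auto simp: saturated_chains_def last_conv_nth)
      then have "zs ! (psize n lam - psize n nu) = nu"
        by (simp add: len)
      then show "?p (zs @ [mu]) = (\<Prod>i<psize n lam - psize n nu. F (zs ! i) (zs ! Suc i)) * F nu mu"
        unfolding k using len by (simp add: nth_append)
    qed
    finally show "(\<Sum>zs\<in>?S nu. ?p zs) = chain_sum n F lam nu * F nu mu"
      by (simp add: chain_sum_def sum_distrib_right)
  qed
  finally show ?thesis .
qed

section \<open>Chain formulas from triangularity and the recursion\<close>

locale chain_data =
  fixes n :: nat and b :: "(nat \<Rightarrow> nat) \<Rightarrow> (nat \<Rightarrow> nat) \<Rightarrow> 'a::field" and N :: "(nat \<Rightarrow> nat) \<Rightarrow> 'a"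
  assumes b_triangular: "lam \<in> partitions n \<Longrightarrow> mu \<in> partitions n \<Longrightarrow> psize n lam \<le> psize n mu \<Longrightarrow>
      b lam mu = (if lam = mu then 1 else 0)"
    and N_neq: "lam \<in> partitions n \<Longrightarrow> mu \<in> partitions n \<Longrightarrow> psize n lam \<noteq> psize n mu \<Longrightarrow> N lam \<noteq> N mu"
    and recursion: "lam \<in> partitions n \<Longrightarrow> mu \<in> partitions n \<Longrightarrow>
      (N lam - N mu) * b lam mu =
      (\<Sum>nu | nu \<in> partitions n \<and> pcovers n nu mu. b lam nu * ((N nu - N mu) * b nu mu))"
begin

text \<open>The recursion expresses \<open>b lam mu\<close> by the \<open>b lam nu\<close> with
  \<open>nu\<close> covering \<open>mu\<close>; dividing it by \<open>N lam - N mu\<close>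
  reproduces the removal of the last step. Since the difference of the sizes is one of natural
  numbers, the base case covers every \<open>mu\<close> at least as large as
  \<open>lam\<close>.\<close>

theorem b_eq_chain_sum:
  assumes lam: "lam \<in> partitions n" and mu: "mu \<in> partitions n"
  shows "b lam mu = chain_sum n (\<lambda>x y. (N x - N y) / (N lam - N y) * b x y) lam mu"
  using mu
proof (induction "psize n lam - psize n mu" arbitrary: mu)
  case 0
  then show ?case using lam by (simp add: b_triangular chain_sum_base)
next
  case (Suc k)
  let ?F = "\<lambda>x y. (N x - N y) / (N lam - N y) * b x y"
  have gt: "psize n mu < psize n lam" using Suc.hyps(2) by simp
  have ne: "N lam - N mu \<noteq> 0" using N_neq[OF lam Suc.prems] gt by simp
  have "chain_sum n ?F lam mu =
      (\<Sum>nu | nu \<in> partitions n \<and> pcovers n nu mu. chain_sum n ?F lam nu * ?F nu mu)"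
    by (rule chain_sum_snoc[OF lam Suc.prems gt])
  also have "\<dots> = (\<Sum>nu | nu \<in> partitions n \<and> pcovers n nu mu.
      b lam nu * ((N nu - N mu) * b nu mu) / (N lam - N mu))"
  proof (rule sum.cong[OF refl])
    fix nu assume nu: "nu \<in> {nu. nu \<in> partitions n \<and> pcovers n nu mu}"
    then have "k = psize n lam - psize n nu" using Suc.hyps(2) pcovers_psize by fastforce
    then have "b lam nu = chain_sum n ?F lam nu" using Suc.hyps(1) nu by blast
    then show "chain_sum n ?F lam nu * ?F nu mu = b lam nu * ((N nu - N mu) * b nu mu) / (N lam - N mu)"
      by simp
  qed
  also have "\<dots> = b lam mu"
    unfolding sum_divide_distrib[symmetric] recursion[OF lam Suc.prems, symmetric] using ne by simp
  finally show ?case by simp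
qed

text \<open>The right-hand side of (2), with its sign (-1)^k spread over the k steps. It is 0 off
  the index set because \<open>inverse_matrix\<close> demands it.\<close>

definition c :: "(nat \<Rightarrow> nat) \<Rightarrow> (nat \<Rightarrow> nat) \<Rightarrow> 'a" where
  "c lam mu = (if lam \<in> partitions n \<and> mu \<in> partitions n
    then chain_sum n (\<lambda>x y. - ((N y - N x) / (N mu - N x)) * b x y) lam mu else 0)"

lemma c_triangular:
  assumes "lam \<in> partitions n" "mu \<in> partitions n" "psize n lam \<le> psize n mu"
  shows "c lam mu = (if lam = mu then 1 else 0)"
  using assms by (simp add: c_def chain_sum_base)

text \<open>Multiplying by \<open>N mu - N lam\<close> cancels the denominator of the first step. If
  \<open>lam\<close> is not larger than \<open>mu\<close>, both sides are 0, for
  \<open>lam = mu\<close> because of the factor on the left.\<close>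

lemma c_recursion:
  assumes lam: "lam \<in> partitions n" and mu: "mu \<in> partitions n"
  shows "(N mu - N lam) * c lam mu =
    (\<Sum>kap | kap \<in> partitions n \<and> pcovers n lam kap. (N lam - N kap) * b lam kap * c kap mu)"
proof (cases "psize n mu < psize n lam")
  case True
  then have "N mu - N lam \<noteq> 0" using N_neq[OF mu lam] by simp
  then show ?thesis
    using chain_sum_Cons[OF lam True, of "\<lambda>x y. - ((N y - N x) / (N mu - N x)) * b x y"] lam mu
    by (simp add: c_def sum_distrib_left)
      (intro sum.cong refl, simp add: field_simps)
next
  case False
  have "c kap mu = 0" if "kap \<in> partitions n" "pcovers n lam kap" for kap
    using that False pcovers_psize[OF that(2)] mu by (subst c_triangular) auto
  then have "(\<Sum>kap | kap \<in> partitions n \<and> pcovers n lam kap. (N lam - N kap) * b lam kap * c kap mu) = 0"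
    by (intro sum.neutral) auto
  moreover have "(N mu - N lam) * c lam mu = 0"
    using c_triangular[OF lam mu] False by simp
  ultimately show ?thesis by simp
qed

definition K :: "(nat \<Rightarrow> nat) \<Rightarrow> (nat \<Rightarrow> nat) \<Rightarrow> 'a" where
  "K nu mu = (if pcovers n nu mu then (N nu - N mu) * b nu mu else 0)"

abbreviation below :: "(nat \<Rightarrow> nat) \<Rightarrow> (nat \<Rightarrow> nat) set" where
  "below lam \<equiv> partitions_upto n (psize n lam)"

lemma b_commutator:
  assumes lam: "lam \<in> partitions n" and mu: "mu \<in> partitions n"
  shows "(N lam - N mu) * b lam mu = (\<Sum>nu\<in>below lam. b lam nu * K nu mu)"
proof -
  let ?A = "{nu. nu \<in> partitions n \<and> pcovers n nu mu}"
  have "?A \<subseteq> partitions_upto n (Suc (psize n mu))" using pcovers_psize by (auto simp: partitions_upto_def)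
  then have fin: "finite ?A" by (rule finite_subset) (rule finite_partitions_upto)
  have "(N lam - N mu) * b lam mu = (\<Sum>nu\<in>?A. b lam nu * K nu mu)"
    unfolding recursion[OF lam mu] by (intro sum.cong) (auto simp: K_def)
  also have "\<dots> = (\<Sum>nu\<in>below lam. b lam nu * K nu mu)"
  proof (rule sum.mono_neutral_cong)
    fix nu assume "nu \<in> ?A - below lam"
    then have "nu \<in> partitions n" "psize n lam < psize n nu" by (auto simp: partitions_upto_def)
    then show "b lam nu * K nu mu = 0" using b_triangular[OF lam] by fastforce
  qed (use fin finite_partitions_upto in \<open>auto simp: K_def partitions_upto_def\<close>)
  finally show ?thesis .
qed

lemma c_commutator:
  assumes lam: "lam \<in> partitions_upto n d" and mu: "mu \<in> partitions n"
  shows "(N mu - N lam) * c lam mu = (\<Sum>kap\<in>partitions_upto n d. K lam kap * c kap mu)"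
proof -
  have lam': "lam \<in> partitions n" using lam by (simp add: partitions_upto_def)
  show ?thesis
    unfolding c_recursion[OF lam' mu]
    by (rule sum.mono_neutral_cong_left)
      (use finite_partitions_upto lam pcovers_psize in \<open>auto simp: K_def partitions_upto_def\<close>)
qed

lemma b_mult_c:
  assumes lam: "lam \<in> partitions n" and mu: "mu \<in> partitions n"
  shows "(\<Sum>kap\<in>below lam. b lam kap * c kap mu) = (if lam = mu then 1 else 0)"
proof (cases "psize n lam = psize n mu")
  case True
  \<comment> \<open>For equal sizes the norms need not differ, so the commutator says nothing;
    triangularity leaves only the term \<open>kap = lam\<close>.\<close>
  have "b lam kap * c kap mu = (if kap = lam then c lam mu else 0)"
    if "kap \<in> below lam" for kap
  proof (cases "psize n kap = psize n lam")
    case True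
    then show ?thesis using b_triangular[OF lam, of kap] that by (auto simp: partitions_upto_def)
  next
    case False
    then show ?thesis using c_triangular[of kap mu] that True mu by (auto simp: partitions_upto_def)
  qed
  then have "(\<Sum>kap\<in>below lam. b lam kap * c kap mu) =
      (\<Sum>kap\<in>below lam. if kap = lam then c lam mu else 0)"
    by (rule sum.cong[OF refl])
  also have "\<dots> = c lam mu"
    using lam finite_partitions_upto[of n] by (simp add: partitions_upto_def)
  finally show ?thesis using c_triangular[OF lam mu] True by simp
next
  case False
  have Q: "kap \<in> partitions n" if "kap \<in> below lam" for kap using that by (simp add: partitions_upto_def)
  \<comment> \<open>\<open>N lam - N mu\<close> is split at \<open>N kap\<close>; each of the two
    sums is an entry of B K C, so they cancel.\<close>
  have "(N lam - N mu) * (\<Sum>kap\<in>below lam. b lam kap * c kap mu) =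
      (\<Sum>kap\<in>below lam. ((N lam - N kap) * b lam kap) * c kap mu) -
      (\<Sum>kap\<in>below lam. b lam kap * ((N mu - N kap) * c kap mu))"
    by (simp add: sum_distrib_left algebra_simps flip: sum_subtractf)
  also have "(\<Sum>kap\<in>below lam. ((N lam - N kap) * b lam kap) * c kap mu) =
      (\<Sum>kap\<in>below lam. \<Sum>nu\<in>below lam. b lam nu * K nu kap * c kap mu)"
    using b_commutator[OF lam] Q by (simp add: sum_distrib_right)
  also have "\<dots> = (\<Sum>nu\<in>below lam. \<Sum>kap\<in>below lam. b lam nu * K nu kap * c kap mu)"
    by (rule sum.swap)
  also have "(\<Sum>kap\<in>below lam. b lam kap * ((N mu - N kap) * c kap mu)) =
      (\<Sum>nu\<in>below lam. \<Sum>kap\<in>below lam. b lam nu * K nu kap * c kap mu)"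
    using c_commutator[OF _ mu] by (simp add: sum_distrib_left mult.assoc)
  finally have "(N lam - N mu) * (\<Sum>kap\<in>below lam. b lam kap * c kap mu) = 0" by simp
  then show ?thesis using N_neq[OF lam mu False] False by auto
qed

text \<open>Forward substitution: in row \<open>lam\<close> all entries of \<open>z\<close> other
  than \<open>z lam\<close> belong to smaller partitions or have coefficient 0.\<close>

lemma b_left_cancel:
  assumes "\<And>lam. lam \<in> partitions n \<Longrightarrow> (\<Sum>kap\<in>below lam. b lam kap * z kap) = 0"
    and "lam \<in> partitions n"
  shows "z lam = 0"
  using assms(2)
proof (induction "psize n lam" arbitrary: lam rule: less_induct)
  case less
  have "b lam kap * z kap = 0" if "kap \<in> below lam - {lam}" for kap
  proof (cases "psize n kap < psize n lam")
    case True
    then show ?thesis using less.hyps that by (simp add: partitions_upto_def)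
  next
    case False
    then show ?thesis using b_triangular[OF less.prems, of kap] that by (auto simp: partitions_upto_def)
  qed
  then have "(\<Sum>kap\<in>below lam - {lam}. b lam kap * z kap) = 0" by (intro sum.neutral ballI)
  moreover have "lam \<in> below lam" using less.prems by (simp add: partitions_upto_def)
  ultimately have "b lam lam * z lam = 0"
    using assms(1)[OF less.prems]
      sum.remove[OF finite_partitions_upto, of lam n "psize n lam" "\<lambda>kap. b lam kap * z kap"]
    by simp
  then show ?case using b_triangular[OF less.prems less.prems] by simp
qed

text \<open>Since B C = 1, left multiplication by B sends C B - 1 to 0, and B can be cancelled
  column by column.\<close>

lemma c_mult_b:
  assumes lam: "lam \<in> partitions n" and mu: "mu \<in> partitions n"
  shows "(\<Sum>kap\<in>below lam. c lam kap * b kap mu) = (if lam = mu then 1 else 0)"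
proof -
  define z where "z lam = (\<Sum>kap\<in>below lam. c lam kap * b kap mu) -
    (if lam = mu then 1 else 0)" for lam
  have "z lam = 0"
  proof (rule b_left_cancel[OF _ lam])
    fix lam assume lam: "lam \<in> partitions n"
      have ext: "(\<Sum>kap\<in>below nu. c nu kap * b kap mu) = (\<Sum>kap\<in>below lam. c nu kap * b kap mu)"
      if "nu \<in> below lam" for nu
    proof (rule sum.mono_neutral_left)
      show "\<forall>i\<in>below lam - below nu. c nu i * b i mu = 0"
        using that c_triangular[of nu] by (fastforce simp: partitions_upto_def)
    qed (use that finite_partitions_upto in \<open>auto simp: partitions_upto_def\<close>)
    have "(\<Sum>nu\<in>below lam. b lam nu * z nu) =
        (\<Sum>nu\<in>below lam. \<Sum>kap\<in>below lam. b lam nu * c nu kap * b kap mu) - (\<Sum>nu\<in>below lam. if nu = mu then b lam mu else 0)"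
      unfolding z_def
      by (simp add: ext right_diff_distrib sum_subtractf sum_distrib_left mult.assoc)
        (intro sum.cong refl, simp)
    also have "(\<Sum>nu\<in>below lam. \<Sum>kap\<in>below lam. b lam nu * c nu kap * b kap mu) =
        (\<Sum>kap\<in>below lam. \<Sum>nu\<in>below lam. b lam nu * c nu kap * b kap mu)"
      by (rule sum.swap)
    also have "\<dots> = (\<Sum>kap\<in>below lam. if kap = lam then b lam mu else 0)"
    proof (rule sum.cong[OF refl])
      fix kap assume "kap \<in> below lam"
      then have "kap \<in> partitions n" by (simp add: partitions_upto_def)
      then show "(\<Sum>nu\<in>below lam. b lam nu * c nu kap * b kap mu) = (if kap = lam then b lam mu else 0)"
        using b_mult_c[OF lam, of kap] by (simp flip: sum_distrib_right)
    qed
    also have "\<dots> = b lam mu"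
      using lam finite_partitions_upto[of n] by (simp add: partitions_upto_def)
    also have "(\<Sum>nu\<in>below lam. if nu = mu then b lam mu else 0) = b lam mu"
      using mu finite_partitions_upto[of n] b_triangular[OF lam mu] by (auto simp: partitions_upto_def)
    finally show "(\<Sum>nu\<in>below lam. b lam nu * z nu) = 0" by simp
  qed
  then show ?thesis by (simp add: z_def)
qed

lemma mat_prod_eq:
  assumes lam: "lam \<in> partitions n"
    and A: "\<And>mu. mu \<in> partitions n \<Longrightarrow> psize n lam < psize n mu \<Longrightarrow> A lam mu = 0"
  shows "mat_prod n A B lam nu = (\<Sum>mu\<in>below lam. A lam mu * B mu nu)"
  unfolding mat_prod_def
  by (rule sum.mono_neutral_left)
    (use A finite_partitions_upto in \<open>force simp: partitions_upto_def not_le[symmetric]\<close>)+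

theorem inverse_matrix_eq: "inverse_matrix n b = c"
  unfolding inverse_matrix_def
proof (rule the_equality)
  let ?P = "\<lambda>C. row_finite n C \<and>
     (\<forall>lam mu. lam \<notin> partitions n \<or> mu \<notin> partitions n \<longrightarrow> C lam mu = 0) \<and>
     (\<forall>lam\<in>partitions n. \<forall>mu\<in>partitions n.
        mat_prod n b C lam mu = (if lam = mu then 1 else 0) \<and>
        mat_prod n C b lam mu = (if lam = mu then 1 else 0))"
  have b0: "b lam mu = 0" if "lam \<in> partitions n" "mu \<in> partitions n" "psize n lam < psize n mu" for lam mu
    using that b_triangular[of lam mu] by auto
  have c0: "c lam mu = 0" if "lam \<in> partitions n" "mu \<in> partitions n" "psize n lam < psize n mu" for lam mu
    using that c_triangular[of lam mu] by auto
  have "row_finite n c"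
    unfolding row_finite_def
  proof
    fix lam assume lam: "lam \<in> partitions n"
    have "{mu \<in> partitions n. c lam mu \<noteq> 0} \<subseteq> below lam"
      using c0[OF lam] by (force simp: partitions_upto_def not_le[symmetric])
    then show "finite {mu \<in> partitions n. c lam mu \<noteq> 0}"
      by (rule finite_subset) (rule finite_partitions_upto)
  qed
  then show "?P c"
    by (auto simp: mat_prod_eq b0 c0 b_mult_c c_mult_b) (simp_all add: c_def)
  fix c' assume c': "?P c'"
  have "c' lam mu = c lam mu" for lam mu
  proof (cases "lam \<in> partitions n \<and> mu \<in> partitions n")
    case True
    have "c' lam mu - c lam mu = 0"
    proof (rule b_left_cancel[where z = "\<lambda>kap. c' kap mu - c kap mu"])
      fix nu assume nu: "nu \<in> partitions n"
      then have "(\<Sum>kap\<in>below nu. b nu kap * c' kap mu) = (if nu = mu then 1 else 0)"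
        using c' True b0 by (auto simp: mat_prod_eq)
      then show "(\<Sum>kap\<in>below nu. b nu kap * (c' kap mu - c kap mu)) = 0"
        using b_mult_c[OF nu, of mu] True by (simp add: right_diff_distrib sum_subtractf)
    qed (use True in simp)
    then show ?thesis by simp
  qed (use c' in \<open>auto simp: c_def\<close>)
  then show "c' = c" by (intro ext)
qed

end

section \<open>Evaluation of Laurent polynomials\<close>

abbreviation "lookup \<equiv> Poly_Mapping.lookup"
abbreviation "keys \<equiv> Poly_Mapping.keys"
abbreviation "single \<equiv> Poly_Mapping.single"
abbreviation "map_key \<equiv> Poly_Mapping.map_key"

definition monom_val :: "(nat \<Rightarrow> 'a::field) \<Rightarrow> (nat \<Rightarrow>\<^sub>0 int) \<Rightarrow> 'a" where
  "monom_val x e = (\<Prod>i\<in>keys e. x i powi lookup e i)"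

lemma monom_val_eq:
  assumes "finite A" "keys e \<subseteq> A"
  shows "monom_val x e = (\<Prod>i\<in>A. x i powi lookup e i)"
  unfolding monom_val_def
  by (rule prod.mono_neutral_left) (use assms in \<open>auto simp: in_keys_iff\<close>)

lemma leval_eq:
  assumes "finite A" "keys f \<subseteq> A"
  shows "leval f x = (\<Sum>e\<in>A. lookup f e * monom_val x e)"
  unfolding leval_def monom_val_def[symmetric]
  by (rule sum.mono_neutral_left) (use assms in \<open>auto simp: in_keys_iff\<close>)

lemma leval_add: "leval (f + g) x = leval f x + leval g x"
proof -
  let ?A = "keys f \<union> keys g"
  have "leval (f + g) x = (\<Sum>e\<in>?A. lookup (f + g) e * monom_val x e)"
    by (rule leval_eq) (use Poly_Mapping.keys_add[of f g] in auto)
  also have "\<dots> = leval f x + leval g x"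
    by (simp add: leval_eq[of ?A] lookup_add distrib_right sum.distrib)
  finally show ?thesis .
qed

lemma leval_sum: "leval (\<Sum>a\<in>A. f a) x = (\<Sum>a\<in>A. leval (f a) x)"
  by (induction A rule: infinite_finite_induct) (simp_all add: leval_add, simp_all add: leval_def)

lemma leval_single: "leval (single e c) x = c * monom_val x e"
  by (simp add: leval_def monom_val_def)

lemma monom_val_zero [simp]: "monom_val x 0 = 1"
  by (simp add: monom_val_def)

lemma leval_lconst: "leval (lconst c) x = c"
  by (simp add: lconst_def leval_single)

lemma monom_val_single: "monom_val x (single i k) = x i powi k"
  by (simp add: monom_val_def)

lemma monom_val_add:
  assumes "\<And>i. x i = 0 \<Longrightarrow> 0 \<le> lookup e i \<and> 0 \<le> lookup e' i"
  shows "monom_val x (e + e') = monom_val x e * monom_val x e'"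
proof -
  let ?A = "keys e \<union> keys e'"
  have *: "x i powi (lookup e i + lookup e' i) =
      x i powi lookup e i * x i powi lookup e' i" for i
    using assms[of i]
    by (cases "x i = 0") (auto simp: power_int_add power_int_0_left_if)
  have "monom_val x (e + e') = (\<Prod>i\<in>?A. x i powi lookup (e + e') i)"
    by (rule monom_val_eq) (use Poly_Mapping.keys_add[of e e'] in auto)
  also have "\<dots> = monom_val x e * monom_val x e'"
    by (simp add: monom_val_eq[of ?A] lookup_add * prod.distrib)
  finally show ?thesis .
qed

text \<open>
  Evaluation is multiplicative only where no variable with a negative exponent is set to 0,
  since 0 to a negative power is 0.
\<close>

definition regular_at :: "(nat \<Rightarrow> 'a::field) \<Rightarrow> 'a laurent \<Rightarrow> bool" where
  "regular_at x f \<longleftrightarrow> (\<forall>e\<in>keys f. \<forall>i. x i = 0 \<longrightarrow> 0 \<le> lookup e i)"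

lemma regular_at_nonzero: "(\<And>i. x i \<noteq> 0) \<Longrightarrow> regular_at x f"
  by (simp add: regular_at_def)

lemma regular_at_add: "regular_at x f \<Longrightarrow> regular_at x g \<Longrightarrow> regular_at x (f + g)"
  using Poly_Mapping.keys_add[of f g] unfolding regular_at_def by blast

lemma regular_at_mult:
  assumes "regular_at x f" "regular_at x g" shows "regular_at x (f * g)"
  unfolding regular_at_def
proof (intro ballI allI impI)
  fix e i assume "e \<in> keys (f * g)" "x i = 0"
  then obtain a b where "e = a + b" "a \<in> keys f" "b \<in> keys g"
    using keys_mult[of f g] by blast
  then show "0 \<le> lookup e i"
    using assms \<open>x i = 0\<close> by (simp add: regular_at_def lookup_add)
qed

lemma regular_at_lconst: "regular_at x (lconst c)"
  by (simp add: regular_at_def lconst_def)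

lemma laurent_sum_singles:
  "f = (\<Sum>e\<in>keys f. single e (lookup f e))"
  for f :: "'b \<Rightarrow>\<^sub>0 'a::comm_monoid_add"
proof (rule poly_mapping_eqI)
  fix e
  show "lookup f e =
    lookup (\<Sum>e\<in>keys f. single e (lookup f e)) e"
    by (auto simp: lookup_sum lookup_single when_def in_keys_iff if_distrib cong: if_cong)
qed

lemma leval_mult:
  assumes "regular_at x f" "regular_at x g"
  shows "leval (f * g) x = leval f x * leval g x"
proof -
  have "f * g = (\<Sum>e\<in>keys f. single e (lookup f e)) * (\<Sum>e\<in>keys g. single e (lookup g e))"
    using laurent_sum_singles[of f] laurent_sum_singles[of g] by simp
  also have "\<dots> = (\<Sum>e\<in>keys f. \<Sum>e'\<in>keys g. single (e + e') (lookup f e * lookup g e'))"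
    by (simp add: sum_product mult_single)
  finally have "leval (f * g) x = (\<Sum>e\<in>keys f. \<Sum>e'\<in>keys g. lookup f e * lookup g e' * monom_val x (e + e'))"
    by (simp add: leval_sum leval_single)
  also have "\<dots> = (\<Sum>e\<in>keys f. \<Sum>e'\<in>keys g. (lookup f e * monom_val x e) * (lookup g e' * monom_val x e'))"
  proof (intro sum.cong refl)
    fix e e' assume "e \<in> keys f" "e' \<in> keys g"
    then have "monom_val x (e + e') = monom_val x e * monom_val x e'"
      using assms by (intro monom_val_add) (auto simp: regular_at_def)
    then show "lookup f e * lookup g e' * monom_val x (e + e') = (lookup f e * monom_val x e) * (lookup g e' * monom_val x e')"
      by simp
  qed
  also have "\<dots> = leval f x * leval g x"
    by (simp add: leval_eq[of "keys f"] leval_eq[of "keys g"] sum_product)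
  finally show ?thesis .
qed

lemma power_int_two_inj:
  assumes "(2 :: 'a::field_char_0) powi a = 2 powi b" shows "a = b"
proof -
  have *: "a \<le> b" if "(2 :: 'a) powi a = 2 powi b" for a b :: int
  proof (rule ccontr)
    assume "\<not> a \<le> b"
    then have "(2 :: 'a) powi (a - b) = 2 ^ nat (a - b)" by (simp add: power_int_nonneg_exp)
    moreover have "(2 :: 'a) powi (a - b) = 1" using that by (simp add: power_int_diff)
    ultimately have "of_nat (2 ^ nat (a - b)) = (of_nat 1 :: 'a)" by simp
    then have "2 ^ nat (a - b) = (1 :: nat)" unfolding of_nat_eq_iff .
    then show False using \<open>\<not> a \<le> b\<close> by simp
  qed
  show ?thesis using *[of a b] *[of b a] assms by simp
qed

text \<open>Distinct monomials are distinct characters, told apart by doubling one variable.\<close>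

lemma monom_val_independent:
  fixes c :: "(nat \<Rightarrow>\<^sub>0 int) \<Rightarrow> 'a::field_char_0"
  assumes "finite A" "\<And>x. (\<And>i. x i \<noteq> 0) \<Longrightarrow> (\<Sum>e\<in>A. c e * monom_val x e) = 0" "e \<in> A"
  shows "c e = 0"
  using assms
proof (induction A arbitrary: c e rule: finite_induct)
  case (insert e0 A)
  have A: "c e = 0" if e: "e \<in> A" for e
  proof -
    obtain i where i: "lookup e i \<noteq> lookup e0 i"
      using e insert.hyps(2) poly_mapping_eqI by metis
    \<comment> \<open>Doubling variable \<open>i\<close> multiplies the monomial \<open>e\<close> by
      2 to the power \<open>lookup e i\<close>. Subtracting a multiple of the original relation
      removes the term \<open>e0\<close> and leaves a relation over \<open>A\<close>.\<close>
    let ?d = "\<lambda>e. c e * (2 powi lookup e i - 2 powi lookup e0 i)"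
    have "?d e = 0"
    proof (rule insert.IH[OF _ e])
      fix x :: "nat \<Rightarrow> 'a" assume x: "\<And>i. x i \<noteq> 0"
      have double: "monom_val (x(i := 2 * x i)) e = 2 powi lookup e i * monom_val x e" for e
      proof -
        let ?K = "insert i (keys e)"
        have "monom_val (x(i := 2 * x i)) e = (\<Prod>j\<in>?K. (x(i := 2 * x i)) j powi lookup e j)"
          by (rule monom_val_eq) auto
        also have "\<dots> = (\<Prod>j\<in>?K. (if j = i then 2 powi lookup e i else 1) *
            x j powi lookup e j)"
          by (intro prod.cong) (auto simp: power_int_mult_distrib)
        also have "\<dots> = 2 powi lookup e i * monom_val x e"
          unfolding prod.distrib by (subst monom_val_eq[of ?K]) (auto simp del: prod.insert)
        finally show ?thesis .
      qed
      have "(\<Sum>e\<in>insert e0 A. c e * monom_val (x(i := 2 * x i)) e) = 0"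
        by (rule insert.prems) (simp add: x)
      moreover have "(\<Sum>e\<in>insert e0 A. c e * monom_val x e) = 0"
        by (rule insert.prems) (simp add: x)
      ultimately have "(\<Sum>e\<in>insert e0 A. c e * monom_val (x(i := 2 * x i)) e) -
          2 powi lookup e0 i * (\<Sum>e\<in>insert e0 A. c e * monom_val x e) = 0" by simp
      then have "(\<Sum>e\<in>insert e0 A. ?d e * monom_val x e) = 0"
        unfolding double sum_distrib_left sum_subtractf[symmetric] by (simp only: algebra_simps)
      then show "(\<Sum>e\<in>A. ?d e * monom_val x e) = 0"
        using insert.hyps by simp
    qed
    then show ?thesis using i power_int_two_inj by auto
  qed
  have "(\<Sum>e\<in>insert e0 A. c e * monom_val (\<lambda>_. 1) e) = 0"
    by (rule insert.prems) simp
  then have "c e0 = 0"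
    using insert.hyps A by (simp add: monom_val_def)
  then show ?case using A insert.prems(2) by blast
qed simp

lemma leval_inject:
  fixes f g :: "'a::field_char_0 laurent"
  assumes "\<And>x. (\<And>i. x i \<noteq> 0) \<Longrightarrow> leval f x = leval g x"
  shows "f = g"
proof (rule poly_mapping_eqI)
  fix e
  let ?A = "insert e (keys f \<union> keys g)"
  have "lookup f e - lookup g e = 0"
  proof (rule monom_val_independent[of ?A])
    fix x :: "nat \<Rightarrow> 'a" assume x: "\<And>i. x i \<noteq> 0"
    have K: "finite ?A" "keys f \<subseteq> ?A" "keys g \<subseteq> ?A" by auto
    show "(\<Sum>e\<in>?A. (lookup f e - lookup g e) * monom_val x e) = 0"
      using assms[of x] x leval_eq[OF K(1,2), of x] leval_eq[OF K(1,3), of x]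
      unfolding left_diff_distrib sum_subtractf by simp
  qed auto
  then show "lookup f e = lookup g e" by simp
qed

lemma monom_val_permute:
  assumes "bij p"
  shows "monom_val (x \<circ> p) (map_key p e) = monom_val x e"
proof -
  have inj: "inj p" and surj: "surj p" using assms by (auto simp: bij_def)
  have "monom_val x e = (\<Prod>i\<in>p ` (p -` keys e). x i powi lookup e i)"
    using surj by (simp add: monom_val_def surj_image_vimage_eq)
  also have "\<dots> = (\<Prod>i\<in>p -` keys e. x (p i) powi lookup e (p i))"
    by (subst prod.reindex) (use inj in \<open>auto intro: inj_on_subset\<close>)
  also have "\<dots> = monom_val (x \<circ> p) (map_key p e)"
    using inj by (simp add: monom_val_def keys_map_key Poly_Mapping.map_key.rep_eq)
  finally show ?thesis by simp
qed

lemma map_key_inv: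
  assumes "bij p"
  shows "map_key p (map_key (inv p) e) = e"
  using assms by (simp add: map_key_compose bij_is_inj bij_imp_bij_inv inv_o_cancel map_key_id id_def)

lemma leval_permute:
  assumes "bij p" "finite A" "keys f \<subseteq> map_key p ` A"
  shows "leval f (x \<circ> p) = (\<Sum>e\<in>A. lookup f (map_key p e) * monom_val x e)"
proof -
  have "inj (map_key p :: (nat \<Rightarrow>\<^sub>0 int) \<Rightarrow> _)"
    using map_key_inv[OF bij_imp_bij_inv[OF assms(1)]] by (intro inj_on_inverseI) (simp add: assms(1) inv_inv_eq)
  then have "inj_on (map_key p :: (nat \<Rightarrow>\<^sub>0 int) \<Rightarrow> _) A"
    by (rule inj_on_subset) simp
  then show ?thesis
    using assms by (subst leval_eq[of "map_key p ` A"])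
      (auto simp: sum.reindex monom_val_permute)
qed

lemma permuted_keys_superset:
  fixes f :: "'a::field laurent"
  assumes "bij p"
  obtains A where "finite A" "keys f \<subseteq> A" "keys f \<subseteq> map_key p ` A"
proof -
  let ?A = "keys f \<union> map_key (inv p) ` keys f"
  have "keys f \<subseteq> map_key p ` ?A"
  proof
    fix e assume "e \<in> keys f"
    then show "e \<in> map_key p ` ?A"
      using map_key_inv[OF assms, of e] by (metis UnI2 image_eqI)
  qed
  then show ?thesis by (rule that[of ?A, rotated 2]) auto
qed

lemma lsymmetric_leval:
  assumes "lsymmetric n f" "p permutes {1..n}"
  shows "leval f (x \<circ> p) = leval f x"
proof -
  have bij: "bij p" using assms(2) by (rule permutes_bij)
  obtain A where A: "finite A" "keys f \<subseteq> A" "keys f \<subseteq> map_key p ` A"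
    using permuted_keys_superset[OF bij, of f] by blast
  show ?thesis
    unfolding leval_permute[OF bij A(1,3)] leval_eq[OF A(1,2), of x]
    using assms by (simp add: lsymmetric_def)
qed

text \<open>\<open>lsymmetric\<close> is a condition on coefficients; independence of the monomials
  derives it from the values at points with nonzero coordinates.\<close>

lemma lsymmetricI:
  fixes f :: "'a::field_char_0 laurent"
  assumes "\<And>p x. p permutes {1..n} \<Longrightarrow> (\<And>i. x i \<noteq> 0) \<Longrightarrow> leval f (x \<circ> p) = leval f x"
  shows "lsymmetric n f"
  unfolding lsymmetric_def
proof (intro allI impI)
  fix p e assume p: "p permutes {1..n}"
  have bij: "bij p" using p by (rule permutes_bij)
  obtain A0 where A0: "finite A0" "keys f \<subseteq> A0" "keys f \<subseteq> map_key p ` A0"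
    using permuted_keys_superset[OF bij, of f] by blast
  let ?A = "insert e A0"
  have A: "finite ?A" "keys f \<subseteq> ?A" "keys f \<subseteq> map_key p ` ?A"
    using A0 by auto
  have "lookup f (map_key p e) - lookup f e = 0"
  proof (rule monom_val_independent[OF A(1)])
    fix x :: "nat \<Rightarrow> 'a" assume x: "\<And>i. x i \<noteq> 0"
    show "(\<Sum>e\<in>?A. (lookup f (map_key p e) - lookup f e) *
        monom_val x e) = 0"
      using assms[of p x] p x
      unfolding leval_permute[OF bij A(1,3)] leval_eq[OF A(1,2), of x] left_diff_distrib sum_subtractf
      by simp
  qed simp
  then show "lookup f (map_key p e) = lookup f e" by simp
qed

section \<open>Degrees and the scaling of all variables\<close>

definition exp_degree :: "(nat \<Rightarrow>\<^sub>0 int) \<Rightarrow> nat" where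
  "exp_degree e = (\<Sum>i\<in>keys e. nat \<bar>lookup e i\<bar>)"

lemma ldegree_le_iff: "ldegree f \<le> d \<longleftrightarrow> (\<forall>e\<in>keys f. exp_degree e \<le> d)"
  unfolding ldegree_def exp_degree_def[symmetric] by (subst Max_le_iff) auto

lemma exp_degree_eq:
  assumes "finite A" "keys e \<subseteq> A"
  shows "exp_degree e = (\<Sum>i\<in>A. nat \<bar>lookup e i\<bar>)"
  unfolding exp_degree_def
  by (rule sum.mono_neutral_left) (use assms in \<open>auto simp: in_keys_iff\<close>)

lemma exp_degree_add: "exp_degree (e + e') \<le> exp_degree e + exp_degree e'"
proof -
  let ?A = "keys e \<union> keys e'"
  have "exp_degree (e + e') = (\<Sum>i\<in>?A. nat \<bar>lookup (e + e') i\<bar>)"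
    by (rule exp_degree_eq) (use Poly_Mapping.keys_add[of e e'] in auto)
  also have "\<dots> \<le> (\<Sum>i\<in>?A. nat \<bar>lookup e i\<bar> + nat \<bar>lookup e' i\<bar>)"
    by (intro sum_mono) (simp add: lookup_add)
  also have "\<dots> = exp_degree e + exp_degree e'"
    by (simp add: sum.distrib exp_degree_eq[of ?A])
  finally show ?thesis .
qed

lemma ldegree_add_le: "ldegree f \<le> d \<Longrightarrow> ldegree g \<le> d \<Longrightarrow> ldegree (f + g) \<le> d"
  using Poly_Mapping.keys_add[of f g] unfolding ldegree_le_iff by blast

lemma ldegree_mult_le: "ldegree f \<le> d \<Longrightarrow> ldegree g \<le> d' \<Longrightarrow> ldegree (f * g) \<le> d + d'"
  unfolding ldegree_le_iff
proof
  fix e assume f: "\<forall>e\<in>keys f. exp_degree e \<le> d" and g: "\<forall>e\<in>keys g. exp_degree e \<le> d'"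
    and "e \<in> keys (f * g)"
  then obtain a b where "e = a + b" "a \<in> keys f" "b \<in> keys g"
    using keys_mult[of f g] by blast
  then show "exp_degree e \<le> d + d'" using f g exp_degree_add[of a b] by force
qed

lemma ldegree_single: "ldegree (single (single i k) c) \<le> nat \<bar>k\<bar>"
  unfolding ldegree_le_iff by (simp add: exp_degree_def)

lemma ldegree_lconst: "ldegree (lconst c) \<le> d"
  unfolding ldegree_le_iff by (simp add: lconst_def exp_degree_def)

lemma prod_power_int: "T \<noteq> 0 \<Longrightarrow> (\<Prod>i\<in>A. T powi k i) = (T :: 'a::field) powi (\<Sum>i\<in>A. k i)"
  by (induction A rule: infinite_finite_induct) (simp_all add: power_int_add)

text \<open>Along x = T w a monomial contributes T to its total exponent, which lies between -D and
  D. The factor T^D clears the negative powers, and the degree is then at most 2 D.\<close>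

lemma leval_scale_poly:
  assumes "ldegree h \<le> D" "\<And>i. w i \<noteq> (0::'a::field)"
  obtains p where "degree p \<le> 2 * D" "\<And>T. T \<noteq> 0 \<Longrightarrow> poly p T = T ^ D * leval h (\<lambda>i. T * w i)"
proof
  define k where "k e = nat (int D + (\<Sum>i\<in>keys e. lookup e i))" for e :: "nat \<Rightarrow>\<^sub>0 int"
  define p where "p = (\<Sum>e\<in>keys h. monom (lookup h e * monom_val w e) (k e))"
  have bound: "\<bar>\<Sum>i\<in>keys e. lookup e i\<bar> \<le> int D" if "e \<in> keys h" for e
  proof -
    have "\<bar>\<Sum>i\<in>keys e. lookup e i\<bar> \<le> int (exp_degree e)"
      unfolding exp_degree_def by (rule order_trans[OF sum_abs]) simp
    also have "\<dots> \<le> int D" using assms(1) that unfolding ldegree_le_iff by simp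
    finally show ?thesis .
  qed
  show "degree p \<le> 2 * D"
    unfolding p_def
  proof (rule degree_sum_le)
    fix e assume "e \<in> keys h"
    then have "k e \<le> 2 * D" using bound[of e] by (simp add: k_def)
    then show "degree (monom (lookup h e * monom_val w e) (k e)) \<le> 2 * D"
      using degree_monom_le order_trans by blast
  qed simp
  fix T :: 'a assume T: "T \<noteq> 0"
  have "monom_val (\<lambda>i. T * w i) e * T ^ D = monom_val w e * T ^ k e" if e: "e \<in> keys h" for e
  proof -
    have "monom_val (\<lambda>i. T * w i) e = T powi (\<Sum>i\<in>keys e. lookup e i) * monom_val w e"
      unfolding monom_val_def power_int_mult_distrib prod.distrib
      using T by (simp add: prod_power_int)
    moreover have "T ^ k e = T powi (int D + (\<Sum>i\<in>keys e. lookup e i))"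
      using bound[OF e] by (simp add: k_def power_int_def)
    ultimately show ?thesis using T by (simp add: power_int_add)
  qed
  then show "poly p T = T ^ D * leval h (\<lambda>i. T * w i)"
    unfolding p_def leval_def monom_val_def[symmetric]
    by (simp add: poly_sum poly_monom sum_distrib_left mult_ac)
qed

lemma coeff_mult_top:
  assumes "degree p \<le> a" "degree q \<le> b"
  shows "coeff (p * q) (a + b) = coeff p a * coeff q b"
proof -
  have "coeff p i * coeff q (a + b - i) = (if i = a then coeff p a * coeff q b else 0)" if "i \<le> a + b" for i
  proof (cases "i = a")
    case False
    then have "a < i \<or> b < a + b - i" using that by auto
    then have "coeff p i = 0 \<or> coeff q (a + b - i) = 0"
      using assms by (meson coeff_eq_0 le_less_trans)
    then show ?thesis using False by auto
  qed simp
  then have "coeff (p * q) (a + b) = (\<Sum>i\<le>a + b. if i = a then coeff p a * coeff q b else 0)"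
    unfolding coeff_mult by (intro sum.cong) auto
  then show ?thesis by simp
qed

lemma coeff_prod_top:
  fixes p :: "'b \<Rightarrow> 'a::comm_semiring_1 poly"
  assumes "finite A" "\<And>i. i \<in> A \<Longrightarrow> degree (p i) \<le> d i"
  shows "degree (\<Prod>i\<in>A. p i) \<le> sum d A \<and> coeff (\<Prod>i\<in>A. p i) (sum d A) = (\<Prod>i\<in>A. coeff (p i) (d i))"
  using assms
proof (induction rule: finite_induct)
  case (insert i A)
  then have IH: "degree (\<Prod>i\<in>A. p i) \<le> sum d A"
    "coeff (\<Prod>i\<in>A. p i) (sum d A) = (\<Prod>i\<in>A. coeff (p i) (d i))" "degree (p i) \<le> d i" by auto
  have "degree (p i * (\<Prod>i\<in>A. p i)) \<le> d i + sum d A"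
    using degree_mult_le[of "p i" "\<Prod>i\<in>A. p i"] IH by linarith
  then show ?case using insert.hyps coeff_mult_top[OF IH(3,1)] IH(2) by simp
qed simp

section \<open>Interpolation Laurent polynomials\<close>

text \<open>
  The generators g_i take the value gam (x_i) at points with coordinates in the set Om, on which
  evaluation is multiplicative. Degrees of Laurent polynomials are detected by scaling all
  variables by T and letting T grow; gam_top says that gam (T w) grows like (T w) to the power s.
\<close>

locale laurent_family =
  fixes g :: "nat \<Rightarrow> 'a::field_char_0 laurent" and s :: nat and gam :: "'a \<Rightarrow> 'a" and Om :: "'a set"
  assumes regular_g: "(\<And>i. x i \<in> Om) \<Longrightarrow> regular_at x (g i)"
    and leval_g: "(\<And>i. x i \<in> Om) \<Longrightarrow> leval (g i) x = gam (x i)"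
    and ldegree_g: "ldegree (g i) \<le> s"
    and nonzero_Om: "w \<noteq> 0 \<Longrightarrow> w \<in> Om"
    and s_pos: "0 < s"
    and gam_top: "w \<noteq> 0 \<Longrightarrow> \<exists>p. degree p \<le> 2 * s \<and> coeff p (2 * s) = w ^ s \<and>
      (\<forall>T. T \<noteq> 0 \<longrightarrow> poly p T = T ^ s * gam (T * w))"
begin

text \<open>Relates a Laurent polynomial to a function of the generators. Regularity is part of the
  relation because \<open>leval_mult\<close> depends on it.\<close>

definition represents :: "'a laurent \<Rightarrow> ((nat \<Rightarrow> 'a) \<Rightarrow> 'a) \<Rightarrow> bool" where
  "represents h f \<longleftrightarrow> (\<forall>x. (\<forall>i. x i \<in> Om) \<longrightarrow> regular_at x h \<and> leval h x = f (\<lambda>i. gam (x i)))"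

lemma represents_mult:
  "represents h f \<Longrightarrow> represents h' f' \<Longrightarrow> represents (h * h') (\<lambda>y. f y * f' y)"
  by (auto simp: represents_def regular_at_mult leval_mult)

lemma represents_add:
  "represents h f \<Longrightarrow> represents h' f' \<Longrightarrow> represents (h + h') (\<lambda>y. f y + f' y)"
  by (auto simp: represents_def regular_at_add leval_add)

lemma represents_const: "represents (lconst c) (\<lambda>y. c)"
  by (auto simp: represents_def regular_at_lconst leval_lconst)

lemma represents_gen: "represents (g i) (\<lambda>y. y i)"
  by (auto simp: represents_def regular_g leval_g)

lemma represents_unique:
  assumes "represents h f" "represents h' f" shows "h = h'"
  by (rule leval_inject) (use assms nonzero_Om in \<open>auto simp: represents_def\<close>)

lemma represents_power:
  assumes "i \<in> {1..n}"
  shows "\<exists>h\<in>subalgebra (g ` {1..n}). ldegree h \<le> s * k \<and> represents h (\<lambda>y. y i ^ k)"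
proof (induction k)
  case 0
  show ?case using represents_const[of 1] ldegree_lconst[of 1 0] subalgebra.const by auto
next
  case (Suc k)
  then obtain h where h: "h \<in> subalgebra (g ` {1..n})" "ldegree h \<le> s * k" "represents h (\<lambda>y. y i ^ k)"
    by blast
  have "g i * h \<in> subalgebra (g ` {1..n})"
    by (intro subalgebra.mult[OF subalgebra.gen h(1)] imageI assms)
  moreover have "ldegree (g i * h) \<le> s * Suc k"
    using ldegree_mult_le[OF ldegree_g h(2)] by simp
  moreover have "represents (g i * h) (\<lambda>y. y i ^ Suc k)"
    using represents_mult[OF represents_gen h(3)] by simp
  ultimately show ?case by blast
qed

lemma represents_monom:
  assumes "A \<subseteq> {1..n}"
  shows "\<exists>h\<in>subalgebra (g ` {1..n}). ldegree h \<le> s * sum e A \<and> represents h (\<lambda>y. \<Prod>i\<in>A. y i ^ e i)"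
proof -
  have "finite A" using assms by (rule finite_subset) simp
  then show ?thesis
    using assms
  proof (induction rule: finite_induct)
    case empty
    show ?case using represents_const[of 1] ldegree_lconst[of 1 0] subalgebra.const by auto
  next
    case (insert i A)
    obtain h where h: "h \<in> subalgebra (g ` {1..n})" "ldegree h \<le> s * sum e A"
        "represents h (\<lambda>y. \<Prod>i\<in>A. y i ^ e i)" using insert by auto
    obtain h' where h': "h' \<in> subalgebra (g ` {1..n})" "ldegree h' \<le> s * e i"
        "represents h' (\<lambda>y. y i ^ e i)" using represents_power[of i n "e i"] insert.prems by auto
    have "ldegree (h' * h) \<le> s * sum e (insert i A)"
      using ldegree_mult_le[OF h'(2) h(2)] insert.hyps by (simp add: distrib_left)
    moreover have "represents (h' * h) (\<lambda>y. \<Prod>i\<in>insert i A. y i ^ e i)"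
      using represents_mult[OF h'(3) h(3)] insert.hyps by simp
    ultimately show ?case using subalgebra.mult[OF h'(1) h(1)] by blast
  qed
qed

lemma polyfn_represented:
  assumes "polyfn n (int d) f"
  obtains h where "h \<in> subalgebra (g ` {1..n})" "ldegree h \<le> s * d" "represents h f"
proof -
  have "\<exists>h\<in>subalgebra (g ` {1..n}). ldegree h \<le> s * d \<and> represents h f"
    using assms
  proof (induction rule: polyfn.induct)
    case zero
    show ?case using represents_const[of 0] ldegree_lconst subalgebra.const by blast
  next
    case (add f e c)
    obtain h where h: "h \<in> subalgebra (g ` {1..n})" "ldegree h \<le> s * d" "represents h f"
      using add.IH by blast
    obtain h' where h': "h' \<in> subalgebra (g ` {1..n})" "ldegree h' \<le> s * psize n e"
        "represents h' (monom_fn n e)"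
      using represents_monom[of "{1..n}" n e] unfolding psize_def monom_fn_def by auto
    have "ldegree h' \<le> s * d" using h'(2) add.hyps(2) by (meson le_trans mult_le_mono2 of_nat_le_iff)
    then have "ldegree (lconst c * h' + h) \<le> s * d"
      using ldegree_mult_le[OF ldegree_lconst[of c 0]] h(2) by (intro ldegree_add_le) auto
    moreover have "represents (lconst c * h' + h) (\<lambda>y. c * monom_fn n e y + f y)"
      by (intro represents_add represents_mult represents_const h h')
    moreover have "lconst c * h' + h \<in> subalgebra (g ` {1..n})"
      by (intro subalgebra.add subalgebra.mult subalgebra.const h h')
    ultimately show ?case by blast
  qed
  then show ?thesis using that by blast
qed

text \<open>No degree bound in terms of \<open>ldegree\<close> is available here: sums and products
  may produce high degrees that cancel later. The bound is recovered in
  \<open>represents_degree\<close>.\<close>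

lemma subalgebra_represented:
  assumes "h \<in> subalgebra (g ` {1..n})"
  shows "\<exists>d f. polyfn n (int d) f \<and> represents h f"
  using assms
proof (induction rule: subalgebra.induct)
  case (gen h)
  then obtain i where "i \<in> {1..n}" "h = g i" by blast
  then have "polyfn n (int 1) (\<lambda>y :: nat \<Rightarrow> 'a. y i)" "represents h (\<lambda>y. y i)"
    using polyfn_var represents_gen by auto
  then show ?case by blast
next
  case (const c)
  have "polyfn n (int 0) (\<lambda>y. c)" by (simp add: polyfn_const)
  then show ?case using represents_const by blast
next
  case (add h h')
  then obtain d f d' f' where *: "polyfn n (int d) f" "represents h f" "polyfn n (int d') f'" "represents h' f'"
    by blast
  have "polyfn n (int (max d d')) (\<lambda>y. f y + f' y)"
    by (intro polyfn_add polyfn_mono[OF *(1)] polyfn_mono[OF *(3)]) auto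
  then show ?case using represents_add[OF *(2,4)] by blast
next
  case (mult h h')
  then obtain d f d' f' where *: "polyfn n (int d) f" "represents h f" "polyfn n (int d') f'" "represents h' f'"
    by blast
  have "polyfn n (int (d + d')) (\<lambda>y. f y * f' y)"
    using polyfn_mult[OF *(1,3)] by simp
  then show ?case using represents_mult[OF *(2,4)] by blast
qed

text \<open>The factor T^(s D) clears the negative powers of T that \<open>gam\<close> may bring in;
  the coefficient at 2 s D is the one that sees the degree \<open>D\<close> part of
  \<open>f\<close>.\<close>

definition scaled_poly :: "nat \<Rightarrow> ((nat \<Rightarrow> 'a) \<Rightarrow> 'a) \<Rightarrow> (nat \<Rightarrow> 'a) \<Rightarrow> 'a poly \<Rightarrow> bool" where
  "scaled_poly D f w p \<longleftrightarrow> degree p \<le> 2 * s * D \<and>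
    (\<forall>T. T \<noteq> 0 \<longrightarrow> poly p T = T ^ (s * D) * f (\<lambda>i. gam (T * w i)))"

lemma scaled_poly_monom:
  assumes e: "psize n e \<le> D" and w: "\<And>i. w i \<noteq> 0"
  obtains p where "scaled_poly D (monom_fn n e) w p"
    "coeff p (2 * s * D) = (if psize n e = D then monom_fn n e (\<lambda>i. w i ^ s) else 0)"
proof -
  have "\<forall>i. \<exists>p. degree p \<le> 2 * s \<and> coeff p (2 * s) = w i ^ s \<and>
      (\<forall>T. T \<noteq> 0 \<longrightarrow> poly p T = T ^ s * gam (T * w i))"
    using gam_top w by blast
  then obtain p where p: "\<And>i. degree (p i) \<le> 2 * s" "\<And>i. coeff (p i) (2 * s) = w i ^ s"
      "\<And>i T. T \<noteq> 0 \<Longrightarrow> poly (p i) T = T ^ s * gam (T * w i)"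
    by metis
  have pk: "degree (p i ^ k) \<le> 2 * s * k \<and> coeff (p i ^ k) (2 * s * k) = (w i ^ s) ^ k" for i k
    using coeff_prod_top[of "{..<k}" "\<lambda>_. p i" "\<lambda>_. 2 * s"] p(1,2) by (simp add: mult.commute)
  define P where "P = (\<Prod>i=1..n. p i ^ e i)"
  have P: "degree P \<le> 2 * s * psize n e" "coeff P (2 * s * psize n e) = monom_fn n e (\<lambda>i. w i ^ s)"
    using coeff_prod_top[of "{1..n}" "\<lambda>i. p i ^ e i" "\<lambda>i. 2 * s * e i"] pk
    unfolding P_def psize_def monom_fn_def sum_distrib_left[symmetric] by auto
  \<comment> \<open>Of the factor T^(s D), the monomial absorbs T^(s |e|) for its own denominators.
    For |e| < D the remaining exponent \<open>?m\<close> is less than 2 s (D - |e|), so monomials of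
    smaller degree do not reach the top coefficient.\<close>
  let ?m = "s * (D - psize n e)"
  define R where "R = monom 1 ?m * P"
  have "degree R \<le> ?m + 2 * s * psize n e"
    unfolding R_def using P(1) degree_monom_le[of 1 ?m] by (meson add_mono degree_mult_le order_trans)
  moreover have sD: "s * D = ?m + s * psize n e"
    using e by (simp flip: distrib_left)
  moreover have "0 < ?m" if "psize n e < D" using that s_pos by simp
  ultimately have deg: "degree R \<le> 2 * s * D" "psize n e < D \<Longrightarrow> degree R < 2 * s * D"
    unfolding mult.assoc by linarith+
  have "poly R T = T ^ (s * D) * monom_fn n e (\<lambda>i. gam (T * w i))" if T: "T \<noteq> 0" for T
  proof -
    have "poly R T = T ^ ?m * (\<Prod>i=1..n. (T ^ s * gam (T * w i)) ^ e i)"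
      by (simp add: R_def P_def poly_monom poly_prod p(3)[OF T])
    also have "(\<Prod>i=1..n. (T ^ s * gam (T * w i)) ^ e i) =
        T ^ (s * psize n e) * monom_fn n e (\<lambda>i. gam (T * w i))"
      by (simp add: power_mult_distrib prod.distrib monom_fn_def psize_def power_mult
          flip: power_sum sum_distrib_left)
    finally show ?thesis unfolding sD power_add by simp
  qed
  then have "scaled_poly D (monom_fn n e) w R"
    using deg(1) by (simp add: scaled_poly_def)
  moreover have "coeff R (2 * s * D) = (if psize n e = D then monom_fn n e (\<lambda>i. w i ^ s) else 0)"
  proof (cases "psize n e = D")
    case True
    then show ?thesis using P(2) by (simp add: R_def)
  next
    case False
    then show ?thesis using deg(2) e by (simp add: coeff_eq_0)
  qed
  ultimately show ?thesis using that by blast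
qed

text \<open>\<open>t\<close> is built from the monomials of degree exactly \<open>D\<close>. Under
  the scaling they alone contribute to the coefficient of T^(2 s D), and there each generator acts
  like its leading power w^s.\<close>

lemma top_part:
  assumes "polyfn n (int D) f"
  shows "\<exists>t r. polyfn n (int D) t \<and> polyfn n (int D - 1) r \<and> (\<forall>y. f y = t y + r y) \<and>
    (\<forall>w. (\<forall>i. w i \<noteq> 0) \<longrightarrow> (\<exists>p. scaled_poly D f w p \<and> coeff p (2 * s * D) = t (\<lambda>i. w i ^ s)))"
  using assms
proof (induction rule: polyfn.induct)
  case zero
  show ?case
    by (intro exI[of _ "\<lambda>_. 0"] conjI polyfn.zero) (auto simp: scaled_poly_def intro: exI[of _ 0])
next
  case (add f e c)
  then obtain t r where tr: "polyfn n (int D) t" "polyfn n (int D - 1) r" "\<And>y. f y = t y + r y"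
    "\<And>w. (\<And>i. w i \<noteq> 0) \<Longrightarrow> \<exists>p. scaled_poly D f w p \<and> coeff p (2 * s * D) = t (\<lambda>i. w i ^ s)"
    by metis
  let ?top = "psize n e = D"
  define t' where "t' y = (if ?top then c else 0) * monom_fn n e y + t y" for y
  define r' where "r' y = (if ?top then 0 else c) * monom_fn n e y + r y" for y
  have "polyfn n (int D) t'"
    unfolding t'_def by (rule polyfn.add[OF tr(1) add.hyps(2)])
  moreover have "polyfn n (int D - 1) r'"
    unfolding r'_def using tr(2) add.hyps(2) by (cases ?top) (auto intro!: polyfn.add)
  moreover have "c * monom_fn n e y + f y = t' y + r' y" for y
    by (simp add: t'_def r'_def tr(3))
  moreover have "\<exists>p. scaled_poly D (\<lambda>y. c * monom_fn n e y + f y) w p \<and>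
      coeff p (2 * s * D) = t' (\<lambda>i. w i ^ s)" if w: "\<forall>i. w i \<noteq> 0" for w
  proof -
    obtain p where p: "scaled_poly D f w p" "coeff p (2 * s * D) = t (\<lambda>i. w i ^ s)"
      using tr(4) w by blast
    obtain q where q: "scaled_poly D (monom_fn n e) w q"
      "coeff q (2 * s * D) = (if ?top then monom_fn n e (\<lambda>i. w i ^ s) else 0)"
      using scaled_poly_monom[of n e D w] add.hyps(2) w by auto
    have "scaled_poly D (\<lambda>y. c * monom_fn n e y + f y) w (smult c q + p)"
      using p(1) q(1) unfolding scaled_poly_def
      by (auto intro!: degree_add_le order_trans[OF degree_smult_le] simp: algebra_simps)
    moreover have "coeff (smult c q + p) (2 * s * D) = t' (\<lambda>i. w i ^ s)"
      using p(2) q(2) by (simp add: t'_def)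
    ultimately show ?thesis by blast
  qed
  ultimately show ?case by blast
qed

text \<open>The top part will be known to vanish only at s-th powers; for
  \<open>polyfn_zero_on_grid\<close> there must be infinitely many of them.\<close>

lemma infinite_powers: "infinite ((\<lambda>w :: 'a. w ^ s) ` (UNIV - {0}))"
proof -
  have "inj (\<lambda>k :: nat. (of_nat (Suc k) :: 'a) ^ s)"
  proof (rule injI)
    fix k l :: nat assume "(of_nat (Suc k) :: 'a) ^ s = of_nat (Suc l) ^ s"
    then have "(Suc k) ^ s = (Suc l) ^ s" by (simp only: of_nat_power[symmetric] of_nat_eq_iff)
    then show "k = l" using s_pos by (simp add: power_eq_iff_eq_base)
  qed
  then have "infinite (range (\<lambda>k :: nat. (of_nat (Suc k) :: 'a) ^ s))" by (rule range_inj_infinite)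
  moreover have "range (\<lambda>k :: nat. (of_nat (Suc k) :: 'a) ^ s) \<subseteq> (\<lambda>w. w ^ s) ` (UNIV - {0})"
    by (auto simp del: of_nat_Suc)
  ultimately show ?thesis using finite_subset by blast
qed

text \<open>The value along x = T w is a polynomial in T in two ways, up to powers of T. The degree
  of \<open>h\<close> is too small to produce the coefficient that belongs to the part of degree
  \<open>D\<close>, so this part vanishes at all w^s and is 0.\<close>

lemma represents_degree_step:
  assumes h: "represents h f" "ldegree h \<le> s * d" and f: "polyfn n (int D) f" and D: "d < D"
  shows "polyfn n (int D - 1) f"
proof -
  obtain t r where tr: "polyfn n (int D) t" "polyfn n (int D - 1) r" "\<And>y. f y = t y + r y"
    "\<And>w. (\<And>i. w i \<noteq> 0) \<Longrightarrow> \<exists>p. scaled_poly D f w p \<and> coeff p (2 * s * D) = t (\<lambda>i. w i ^ s)"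
    using top_part[OF f] by metis
  have t0: "t (\<lambda>i. w i ^ s) = 0" if w: "\<And>i. w i \<noteq> 0" for w
  proof -
    obtain p where p: "scaled_poly D f w p" "coeff p (2 * s * D) = t (\<lambda>i. w i ^ s)"
      using tr(4)[of w] w by blast
    obtain q where q: "degree q \<le> 2 * (s * d)"
      "\<And>T. T \<noteq> 0 \<Longrightarrow> poly q T = T ^ (s * d) * leval h (\<lambda>i. T * w i)"
      using leval_scale_poly[OF h(2), of w] w by blast
    \<comment> \<open>\<open>p\<close> and \<open>q\<close> carry the clearing factors T^(s D) and
      T^(s d), which are equalized here. The degree of the second product is at most s D + 2 s d,
      below s d + 2 s D.\<close>
    have "monom 1 (s * d) * p - monom 1 (s * D) * q = 0"
    proof (rule poly_zero_on_infinite)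
      show "infinite (UNIV - {0 :: 'a})" using infinite_UNIV_char_0 by simp
      fix T :: 'a assume "T \<in> UNIV - {0}"
      then have T: "T \<noteq> 0" by simp
      then have "leval h (\<lambda>i. T * w i) = f (\<lambda>i. gam (T * w i))"
        using h(1) w nonzero_Om by (simp add: represents_def)
      then show "poly (monom 1 (s * d) * p - monom 1 (s * D) * q) T = 0"
        using p(1) q(2)[OF T] T by (simp add: scaled_poly_def poly_monom)
    qed
    then have eq: "monom 1 (s * d) * p = monom 1 (s * D) * q" by simp
    have "degree (monom 1 (s * D) * q) \<le> s * D + 2 * (s * d)"
      using q(1) degree_monom_le[of "1::'a" "s * D"] by (meson add_mono degree_mult_le order_trans)
    also have "\<dots> < s * d + 2 * s * D"
      using D s_pos by (simp add: algebra_simps)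
    finally have "coeff (monom 1 (s * D) * q) (s * d + 2 * s * D) = 0" by (rule coeff_eq_0)
    moreover have "coeff (monom 1 (s * d) * p) (s * d + 2 * s * D) = coeff p (2 * s * D)"
      by (simp add: coeff_monom_mult)
    ultimately show ?thesis using eq p(2) by simp
  qed
  have "t y = 0" for y
  proof (rule polyfn_zero_on_grid[OF tr(1) infinite_powers])
    fix y :: "nat \<Rightarrow> 'a" assume y: "\<And>i. i \<in> {1..n} \<Longrightarrow> y i \<in> (\<lambda>w. w ^ s) ` (UNIV - {0})"
    have "\<exists>w. w \<noteq> 0 \<and> (i \<in> {1..n} \<longrightarrow> y i = w ^ s)" for i
    proof (cases "i \<in> {1..n}")
      case True
      then show ?thesis using y[OF True] by blast
    next
      case False
      then show ?thesis by (intro exI[of _ 1]) auto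
    qed
    then obtain w where w: "\<And>i. w i \<noteq> 0" "\<And>i. i \<in> {1..n} \<Longrightarrow> y i = w i ^ s" by metis
    have "t y = t (\<lambda>i. w i ^ s)" by (rule polyfn_cong[OF tr(1)]) (rule w(2))
    then show "t y = 0" using t0 w(1) by simp
  qed
  then have "f = r" using tr(3) by (simp add: fun_eq_iff)
  then show ?thesis using tr(2) by simp
qed

lemma represents_degree:
  assumes h: "represents h f" "ldegree h \<le> s * d" and f: "polyfn n (int D) f"
  shows "polyfn n (int d) f"
  using f
proof (induction D)
  case 0
  then show ?case by (rule polyfn_mono) simp
next
  case (Suc D)
  show ?case
  proof (cases "d < Suc D")
    case True
    then show ?thesis using represents_degree_step[OF h Suc.prems] Suc.IH by simp
  next
    case False
    then show ?thesis using Suc.prems by (auto intro: polyfn_mono)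
  qed
qed

end

locale interpolation_family = laurent_family g s gam Om
  for g :: "nat \<Rightarrow> 'a::field_char_0 laurent" and s gam Om +
  fixes F :: "'a family" and z :: "nat \<Rightarrow> nat \<Rightarrow> 'a"
  assumes F: "ring_gen F = g" "deg_scale F = s" "shift F = (\<lambda>n lam i. z (lam i) (n - i))"
    and z_Om: "z l j \<in> Om"
    and inj_gam_z: "inj2 (\<lambda>l j. gam (z l j))"
begin

abbreviation Y :: "nat \<Rightarrow> nat \<Rightarrow> 'a" where "Y l j \<equiv> gam (z l j)"

lemma represents_shift: "represents h f \<Longrightarrow> leval h (shift F n lam) = f (grid_point Y n lam)"
  by (simp add: represents_def F z_Om grid_point_def)

lemma Lambda_represented:
  assumes "h \<in> Lambda F n" "ldegree h \<le> s * d"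
  obtains f where "polyfn n (int d) f" "symfn n f" "represents h f"
proof -
  have h: "h \<in> subalgebra (g ` {1..n})" "lsymmetric n h" using assms(1) by (auto simp: Lambda_def F)
  obtain D f where f: "polyfn n (int D) f" "represents h f" using subalgebra_represented[OF h(1)] by blast
  have "symfn n f"
    unfolding symfn_def
  proof (intro allI impI)
    fix p :: "nat \<Rightarrow> nat" and y :: "nat \<Rightarrow> 'a" assume p: "p permutes {1..n}"
    have "f (y \<circ> p) - f y = 0"
    \<comment> \<open>Values of \<open>f\<close> are tied to \<open>h\<close> only at points with
      coordinates \<open>gam (x i)\<close>; the infinitely many values \<open>Y l 0\<close> are of
      this form and suffice.\<close>
    proof (rule polyfn_zero_on_grid[where S = "range (\<lambda>l. Y l 0)" and f = "\<lambda>y. f (y \<circ> p) - f y"])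
      show "polyfn n (int D) (\<lambda>y. f (y \<circ> p) - f y)"
        by (rule polyfn_diff[OF polyfn_permute[OF f(1) p] f(1)])
      show "infinite (range (\<lambda>l. Y l 0))"
        using inj_gam_z by (intro range_inj_infinite) (auto simp: inj_def inj2_def)
      fix y :: "nat \<Rightarrow> 'a" assume "\<And>i. i \<in> {1..n} \<Longrightarrow> y i \<in> range (\<lambda>l. Y l 0)"
      then have "\<forall>i\<in>{1..n}. \<exists>l. y i = Y l 0" by blast
      then obtain l where l: "\<And>i. i \<in> {1..n} \<Longrightarrow> y i = Y (l i) 0" by metis
      define x where "x i = z (l i) 0" for i
      have x: "x i \<in> Om" for i by (simp add: x_def z_Om)
      have "f y = leval h x"
      proof -
        have "f y = f (\<lambda>i. gam (x i))" by (rule polyfn_cong[OF f(1)]) (simp add: l x_def)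
        then show ?thesis using f(2) x by (simp add: represents_def)
      qed
      moreover have "f (y \<circ> p) = leval h (x \<circ> p)"
      proof -
        have "f (y \<circ> p) = f (\<lambda>i. gam ((x \<circ> p) i))"
        proof (rule polyfn_cong[OF f(1)])
          fix i assume "i \<in> {1..n}"
          then have "p i \<in> {1..n}" using permutes_in_image[OF p] by blast
          then show "(y \<circ> p) i = gam ((x \<circ> p) i)" by (simp add: l x_def)
        qed
        then show ?thesis using f(2) x by (simp add: represents_def)
      qed
      ultimately show "f (y \<circ> p) - f y = 0" using lsymmetric_leval[OF h(2) p, of x] by simp
    qed
    then show "f (y \<circ> p) = f y" by simp
  qed
  then show ?thesis using that represents_degree[OF f(2) assms(2) f(1)] f(2) by blast
qed

theorem interp_represented:
  assumes mu: "mu \<in> partitions n"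
  obtains f where "polyfn n (int (psize n mu)) f" "symfn n f"
    "\<And>lam. lam \<in> partitions n \<Longrightarrow> psize n lam \<le> psize n mu \<Longrightarrow>
      f (grid_point Y n lam) = (if lam = mu then 1 else 0)"
    "\<And>lam. binom F n lam mu = f (grid_point Y n lam)"
proof -
  let ?d = "psize n mu"
  obtain f where f: "polyfn n (int ?d) f" "symfn n f"
    "\<And>lam. lam \<in> partitions n \<Longrightarrow> int (psize n lam) \<le> int ?d \<Longrightarrow>
      f (grid_point Y n lam) = (if lam = mu then 1 else 0)"
    using symfn_interpolation_exists[OF inj_gam_z, of n "int ?d" "\<lambda>lam. if lam = mu then 1 else 0"] by blast
  obtain h where h: "h \<in> subalgebra (g ` {1..n})" "ldegree h \<le> s * ?d" "represents h f"
    using polyfn_represented[OF f(1)] by blast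
  have "lsymmetric n h"
  proof (rule lsymmetricI)
    fix p :: "nat \<Rightarrow> nat" and x :: "nat \<Rightarrow> 'a"
    assume p: "p permutes {1..n}" and x: "\<And>i. x i \<noteq> 0"
    have "leval h (x \<circ> p) = f ((\<lambda>i. gam (x i)) \<circ> p)"
      using h(3) x nonzero_Om by (simp add: represents_def comp_def)
    also have "\<dots> = leval h x"
      using symfnD[OF f(2) p] h(3) x nonzero_Om by (simp add: represents_def)
    finally show "leval h (x \<circ> p) = leval h x" .
  qed
  then have hL: "h \<in> Lambda F n" using h(1) by (simp add: Lambda_def F)
  have "interp F n mu = h"
    unfolding interp_def
  proof (rule the_equality)
    show "h \<in> Lambda F n \<and> ldegree h \<le> deg_scale F * ?d \<and>
      (\<forall>lam\<in>partitions n. psize n lam \<le> ?d \<longrightarrow> leval h (shift F n lam) = (if lam = mu then 1 else 0))"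
      using hL h(2) f(3) by (simp add: F(2) represents_shift[OF h(3)])
    fix h' assume h': "h' \<in> Lambda F n \<and> ldegree h' \<le> deg_scale F * ?d \<and>
      (\<forall>lam\<in>partitions n. psize n lam \<le> ?d \<longrightarrow> leval h' (shift F n lam) = (if lam = mu then 1 else 0))"
    then obtain f' where f': "polyfn n (int ?d) f'" "symfn n f'" "represents h' f'"
      using Lambda_represented[of h' n ?d] by (auto simp: F(2))
    have "f' y - f y = 0" for y
    proof (rule symfn_unique[OF inj_gam_z, where f = "\<lambda>y. f' y - f y" and d = "int ?d"])
      show "polyfn n (int ?d) (\<lambda>y. f' y - f y)" by (rule polyfn_diff[OF f'(1) f(1)])
      show "symfn n (\<lambda>y. f' y - f y)" using f'(2) f(2) by (simp add: symfn_def)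
      fix lam assume "lam \<in> partitions n" "int (psize n lam) \<le> int ?d"
      then show "f' (grid_point Y n lam) - f (grid_point Y n lam) = 0"
        using h' f(3) by (simp add: represents_shift[OF f'(3)])
    qed
    then have "f' = f" by (simp add: fun_eq_iff)
    then show "h' = h" using f'(3) h(3) represents_unique by blast
  qed
  then have "binom F n lam mu = f (grid_point Y n lam)" for lam
    by (simp add: binom_def represents_shift[OF h(3)])
  then show ?thesis using that f by simp
qed

end

section \<open>Chain formulas\<close>

text \<open>In the coordinates \<open>gam (x i)\<close> the norm of each family is the sum of the
  coordinates, a symmetric function of degree 1.\<close>

locale chain_family = interpolation_family g s gam Om F z +
    shift_data "\<lambda>l j. gam (z l j)" W P0 P1 R1 U0 U1
  for g :: "nat \<Rightarrow> 'a::field_char_0 laurent" and s gam Om F z W P0 P1 R1 U0 U1 +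
  assumes fnorm: "fnorm F = (\<lambda>n x. \<Sum>i=1..n. gam (x i))"
    and snorm_neq: "lam \<in> partitions n \<Longrightarrow> mu \<in> partitions n \<Longrightarrow> psize n lam \<noteq> psize n mu \<Longrightarrow>
      snorm F n lam \<noteq> snorm F n mu"
begin

lemma snorm_eq: "snorm F n lam = (\<Sum>i=1..n. grid_point Y n lam i)"
  by (simp add: snorm_def fnorm F(3) grid_point_def)

lemma chain_data: "chain_data n (binom F n) (snorm F n)"
proof
  fix lam mu assume lam: "lam \<in> partitions n" and mu: "mu \<in> partitions n"
  {
    assume "psize n lam \<le> psize n mu"
    then show "binom F n lam mu = (if lam = mu then 1 else 0)"
      using interp_represented[OF mu] lam by metis
  next
    assume "psize n lam \<noteq> psize n mu"
    then show "snorm F n lam \<noteq> snorm F n mu" by (rule snorm_neq[OF lam mu])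
  next
    let ?d = "psize n mu" and ?N = "snorm F n"
    define R where "R nu f \<longleftrightarrow> polyfn n (int (psize n nu)) f \<and> symfn n f \<and>
        (\<forall>lam\<in>partitions n. psize n lam \<le> psize n nu \<longrightarrow> f (grid_point Y n lam) = (if lam = nu then 1 else 0)) \<and>
        (\<forall>lam. binom F n lam nu = f (grid_point Y n lam))" for nu f
    have "\<exists>f. nu \<in> partitions n \<longrightarrow> R nu f" for nu
    proof (cases "nu \<in> partitions n")
      case True
      show ?thesis by (rule interp_represented[OF True]) (auto simp: R_def)
    qed blast
    then obtain h where "\<And>nu. nu \<in> partitions n \<Longrightarrow> R nu (h nu)" by metis
    then have h: "\<And>nu. nu \<in> partitions n \<Longrightarrow> polyfn n (int (psize n nu)) (h nu)"
      "\<And>nu. nu \<in> partitions n \<Longrightarrow> symfn n (h nu)"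
      "\<And>nu lam. nu \<in> partitions n \<Longrightarrow> lam \<in> partitions n \<Longrightarrow> psize n lam \<le> psize n nu \<Longrightarrow>
        h nu (grid_point Y n lam) = (if lam = nu then 1 else 0)"
      "\<And>nu lam. nu \<in> partitions n \<Longrightarrow> binom F n lam nu = h nu (grid_point Y n lam)"
      unfolding R_def by blast+
    define A where "A = {nu \<in> partitions n. psize n nu = Suc ?d}"
    have "A \<subseteq> partitions_upto n (Suc ?d)" by (auto simp: A_def partitions_upto_def)
    then have fin: "finite A" by (rule finite_subset) (rule finite_partitions_upto)
    \<comment> \<open>The coefficient of \<open>h nu\<close> is the value at the point of
      \<open>nu\<close> of the product in front, because \<open>h nu\<close> is 1 there and the
      other functions in the sum are 0.\<close>
    define f where "f y = ((\<Sum>i=1..n. y i) - ?N mu) * h mu y -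
      (\<Sum>nu\<in>A. ((?N nu - ?N mu) * binom F n nu mu) * h nu y)" for y
    have "polyfn n 1 (\<lambda>y. (\<Sum>i=1..n. y i) - ?N mu)"
      by (intro polyfn_diff polyfn_sum polyfn_var polyfn_const) simp_all
    then have "polyfn n (1 + int ?d) (\<lambda>y. ((\<Sum>i=1..n. y i) - ?N mu) * h mu y)"
      using h(1)[OF mu] by (rule polyfn_mult)
    moreover have "polyfn n (1 + int ?d) (h nu)" if "nu \<in> A" for nu
      using h(1)[of nu] that by (simp add: A_def)
    ultimately have "polyfn n (1 + int ?d) f"
      unfolding f_def by (intro polyfn_diff polyfn_sum polyfn_scale)
    moreover have "symfn n f"
      unfolding symfn_def
    proof (intro allI impI)
      fix p :: "nat \<Rightarrow> nat" and y :: "nat \<Rightarrow> 'a" assume p: "p permutes {1..n}"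
      have "(\<Sum>i=1..n. (y \<circ> p) i) = (\<Sum>i=1..n. y i)"
        using sum.permute[OF p, of y] by simp
      moreover have "h nu (y \<circ> p) = h nu y" if "nu \<in> partitions n" for nu
        using symfnD[OF h(2)[OF that] p] .
      ultimately show "f (y \<circ> p) = f y"
        using mu unfolding f_def by (simp add: A_def)
    qed
    moreover have "f (grid_point Y n ka) = 0"
      if ka: "ka \<in> partitions n" "int (psize n ka) \<le> 1 + int ?d" for ka
    proof -
      have "h nu (grid_point Y n ka) = (if nu = ka then 1 else 0)" if "nu \<in> A" for nu
        using h(3)[of nu ka] that ka by (auto simp: A_def)
      then have "(\<Sum>nu\<in>A. ((?N nu - ?N mu) * binom F n nu mu) * h nu (grid_point Y n ka)) =
          (\<Sum>nu\<in>A. if nu = ka then (?N ka - ?N mu) * binom F n ka mu else 0)"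
        by (intro sum.cong) auto
      also have "\<dots> = (if ka \<in> A then (?N ka - ?N mu) * binom F n ka mu else 0)"
        using fin by (simp add: sum.delta')
      also have "\<dots> = (?N ka - ?N mu) * binom F n ka mu"
      \<comment> \<open>Off \<open>A\<close> the right-hand side is 0 as well: the binomial
        coefficient vanishes unless \<open>ka = mu\<close>, and then the norm difference
        does.\<close>
      proof (cases "ka \<in> A")
        case False
        then have "psize n ka \<le> ?d" using ka by (auto simp: A_def)
        then have "binom F n ka mu = (if ka = mu then 1 else 0)" using h(3,4) mu ka by simp
        then show ?thesis using False by simp
      qed simp
      finally show ?thesis
        using h(4)[OF mu, of ka] by (simp add: f_def snorm_eq)
    qed
    ultimately have "f (grid_point Y n lam) = 0"
      by (rule symfn_unique[OF inj_gam_z])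
    then have "(?N lam - ?N mu) * binom F n lam mu =
        (\<Sum>nu\<in>A. binom F n lam nu * ((?N nu - ?N mu) * binom F n nu mu))"
      using h(4)[OF mu, of lam] h(4)[of _ lam] by (simp add: f_def snorm_eq A_def mult.commute)
    also have "\<dots> = (\<Sum>nu | nu \<in> partitions n \<and> pcovers n nu mu.
        binom F n lam nu * ((?N nu - ?N mu) * binom F n nu mu))"
    proof (rule sum.mono_neutral_right[OF fin])
      show "{nu. nu \<in> partitions n \<and> pcovers n nu mu} \<subseteq> A" by (auto simp: A_def pcovers_def)
      have "binom F n nu mu = 0" if "nu \<in> A" "\<not> pcovers n nu mu" for nu
        using extra_vanishing[OF mu h(1,2)[OF mu], of nu] h(3,4)[OF mu] that
        by (auto simp: A_def pcovers_def)
      then show "\<forall>nu\<in>A - {nu. nu \<in> partitions n \<and> pcovers n nu mu}.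
          binom F n lam nu * ((?N nu - ?N mu) * binom F n nu mu) = 0"
        by (auto simp: A_def)
    qed
    finally show "(?N lam - ?N mu) * binom F n lam mu = (\<Sum>nu | nu \<in> partitions n \<and> pcovers n nu mu.
        binom F n lam nu * ((?N nu - ?N mu) * binom F n nu mu))" .
  }
qed

theorem binom_chain_formula:
  assumes lam: "lam \<in> partitions n" and mu: "mu \<in> partitions n" and k: "k = psize n lam - psize n mu"
  shows "binom F n lam mu = (\<Sum>zs\<in>saturated_chains n lam mu.
    wt F n k zs * (\<Prod>i<k. adj_binom F n (zs ! i) (zs ! Suc i)))"
  unfolding chain_data.b_eq_chain_sum[OF chain_data lam mu] chain_sum_def k[symmetric]
proof (rule sum.cong[OF refl])
  fix zs assume "zs \<in> saturated_chains n lam mu"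
  then have "zs ! 0 = lam" by (auto simp: saturated_chains_def hd_conv_nth)
  then show "(\<Prod>i<k. (snorm F n (zs ! i) - snorm F n (zs ! Suc i)) / (snorm F n lam - snorm F n (zs ! Suc i)) *
        binom F n (zs ! i) (zs ! Suc i)) = wt F n k zs * (\<Prod>i<k. adj_binom F n (zs ! i) (zs ! Suc i))"
    by (simp only: wt_def adj_binom_def prod.distrib)
qed

theorem inv_binom_chain_formula:
  assumes lam: "lam \<in> partitions n" and mu: "mu \<in> partitions n" and k: "k = psize n lam - psize n mu"
  shows "inv_binom F n lam mu = (\<Sum>zs\<in>saturated_chains n lam mu.
    wt' F n k zs * (\<Prod>i<k. adj_binom F n (zs ! i) (zs ! Suc i)))"
proof -
  have "inv_binom F n lam mu = chain_sum n (\<lambda>x y. - ((snorm F n y - snorm F n x) /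
      (snorm F n mu - snorm F n x)) * binom F n x y) lam mu"
    using lam mu
    by (simp add: inv_binom_def chain_data.inverse_matrix_eq[OF chain_data] chain_data.c_def[OF chain_data])
  also have "\<dots> = (\<Sum>zs\<in>saturated_chains n lam mu.
      wt' F n k zs * (\<Prod>i<k. adj_binom F n (zs ! i) (zs ! Suc i)))"
    unfolding chain_sum_def k[symmetric]
  proof (rule sum.cong[OF refl])
    fix zs assume zs: "zs \<in> saturated_chains n lam mu"
    then have "zs ! (length zs - 1) = mu" by (auto simp: saturated_chains_def last_conv_nth)
    then have last: "zs ! k = mu" using saturated_chains_length(2)[OF zs] by (simp add: k)
    let ?r = "\<lambda>i. (snorm F n (zs ! Suc i) - snorm F n (zs ! i)) / (snorm F n mu - snorm F n (zs ! i))"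
    have "(\<Prod>i<k. - ?r i * binom F n (zs ! i) (zs ! Suc i)) =
        (\<Prod>i<k. (- 1) * (?r i * binom F n (zs ! i) (zs ! Suc i)))"
      by (rule prod.cong) simp_all
    also have "\<dots> = wt' F n k zs * (\<Prod>i<k. adj_binom F n (zs ! i) (zs ! Suc i))"
      unfolding prod.distrib by (simp add: wt'_def adj_binom_def last)
    finally show "(\<Prod>i<k. - ?r i * binom F n (zs ! i) (zs ! Suc i)) =
        wt' F n k zs * (\<Prod>i<k. adj_binom F n (zs ! i) (zs ! Suc i))" .
  qed
  finally show ?thesis .
qed

end

section \<open>Polynomials inside their fraction field\<close>

lemma incl_add: "incl (p + q) = incl p + incl q"
  by (simp add: incl_def)

lemma incl_mult: "incl (p * q) = incl p * incl q"
  by (simp add: incl_def)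

lemma incl_0 [simp]: "incl 0 = 0" and incl_1 [simp]: "incl 1 = 1"
  by (simp_all add: incl_def fract_collapse)

lemma incl_eq_iff [simp]: "incl p = incl q \<longleftrightarrow> p = q"
  by (simp add: incl_def eq_fract)

lemma incl_eq_0_iff [simp]: "incl p = 0 \<longleftrightarrow> p = 0"
  using incl_eq_iff[of p 0] by (simp del: incl_eq_iff)

lemma incl_of_nat: "incl (of_nat k) = of_nat k"
  by (induction k) (simp_all add: incl_add)

lemma incl_power: "incl (p ^ k) = incl p ^ k"
  by (induction k) (simp_all add: incl_mult)

lemma incl_sum: "incl (\<Sum>i\<in>A. f i) = (\<Sum>i\<in>A. incl (f i))"
  by (induction A rule: infinite_finite_induct) (simp_all add: incl_add)

lemma degree_le_of_coeff_Suc: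
  assumes "degree p \<le> Suc d" "coeff p (Suc d) = 0" shows "degree p \<le> d"
  using assms by (metis le_SucE le_degree le_antisym leading_coeff_0_iff degree_0 zero_le order_refl)

section \<open>The three kinds of generators\<close>

lemma laurent_family_lvar: "laurent_family lvar 1 (\<lambda>x. x) (UNIV :: 'a::field_char_0 set)"
proof
  fix x :: "nat \<Rightarrow> 'a" and i
  show "regular_at x (lvar i)" by (auto simp: regular_at_def lvar_def lookup_single when_def)
  show "leval (lvar i) x = x i" by (simp add: lvar_def leval_single monom_val_single)
  show "ldegree (lvar i :: 'a laurent) \<le> 1"
    using ldegree_single[of i 1 "1 :: 'a"] by (simp add: lvar_def)
next
  fix w :: 'a
  show "\<exists>p. degree p \<le> 2 * 1 \<and> coeff p (2 * 1) = w ^ 1 \<and> (\<forall>T. T \<noteq> 0 \<longrightarrow> poly p T = T ^ 1 * (T * w))"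
    by (intro exI[of _ "monom w 2"]) (simp add: degree_monom_le poly_monom power2_eq_square)
qed simp_all

lemma laurent_family_lvar_square:
  "laurent_family (\<lambda>i. lvar i ^ 2) 2 (\<lambda>x. x ^ 2) (UNIV :: 'a::field_char_0 set)"
proof
  fix x :: "nat \<Rightarrow> 'a" and i
  have r: "regular_at x (lvar i)" by (auto simp: regular_at_def lvar_def lookup_single when_def)
  show "regular_at x (lvar i ^ 2)" by (simp add: power2_eq_square regular_at_mult r)
  show "leval (lvar i ^ 2) x = x i ^ 2"
    by (simp add: power2_eq_square leval_mult r) (simp add: lvar_def leval_single monom_val_single)
  have "ldegree (lvar i :: 'a laurent) \<le> 1"
    using ldegree_single[of i 1 "1 :: 'a"] by (simp add: lvar_def)
  then show "ldegree (lvar i ^ 2 :: 'a laurent) \<le> 2"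
    using ldegree_mult_le[of "lvar i :: 'a laurent" 1 "lvar i" 1] by (simp add: power2_eq_square numeral_2_eq_2)
next
  fix w :: 'a
  show "\<exists>p. degree p \<le> 2 * 2 \<and> coeff p (2 * 2) = w ^ 2 \<and> (\<forall>T. T \<noteq> 0 \<longrightarrow> poly p T = T ^ 2 * (T * w) ^ 2)"
    by (intro exI[of _ "monom (w ^ 2) 4"])
      (simp add: degree_monom_le poly_monom power_mult_distrib power4_eq_xxxx power2_eq_square)
qed simp_all

lemma laurent_family_lvar_inv:
  "laurent_family (\<lambda>i. lvar i + lvar_inv i) 1 (\<lambda>x. x + inverse x) (UNIV - {0 :: 'a::field_char_0})"
proof
  fix x :: "nat \<Rightarrow> 'a" and i
  assume x: "\<And>i. x i \<in> UNIV - {0}"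
  show "regular_at x (lvar i + lvar_inv i)" by (rule regular_at_nonzero) (use x in blast)
  show "leval (lvar i + lvar_inv i) x = x i + inverse (x i)"
    by (simp add: leval_add lvar_def lvar_inv_def leval_single monom_val_single power_int_minus)
next
  fix i
  show "ldegree (lvar i + lvar_inv i :: 'a laurent) \<le> 1"
    using ldegree_single[of i 1 "1 :: 'a"] ldegree_single[of i "-1" "1 :: 'a"]
    by (intro ldegree_add_le) (simp_all add: lvar_def lvar_inv_def)
next
  fix w :: 'a assume "w \<noteq> 0"
  then show "\<exists>p. degree p \<le> 2 * 1 \<and> coeff p (2 * 1) = w ^ 1 \<and>
      (\<forall>T. T \<noteq> 0 \<longrightarrow> poly p T = T ^ 1 * (T * w + inverse (T * w)))"
    by (intro exI[of _ "[:inverse w, 0, w:]"]) (auto simp: numeral_2_eq_2 field_simps)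
qed simp_all

section \<open>Difference operators of the four families\<close>

text \<open>Here \<open>Y\<close>, \<open>W\<close> and \<open>P0\<close> coincide. In
  \<open>poly_shift\<close> both summands have degree k + m + 1 in \<open>z l j\<close>, with top
  coefficients 1 and -1, so their sum has degree at most k + m. The lowering weight
  \<open>- z l j\<close> vanishes at \<open>z 0 0 = 0\<close>.\<close>

lemma shift_data_AJ:
  fixes tau :: "'a::field_char_0" and z :: "nat \<Rightarrow> nat \<Rightarrow> 'a"
  assumes z: "\<And>l j. z l j = of_nat l + of_nat j * tau" and inj: "inj2 z"
  shows "shift_data z z z (\<lambda>l j. z l j - tau) (\<lambda>l j. z l j - 1)
    (\<lambda>l0 j0 l j. z l j - z l0 j0) (\<lambda>l0 j0 l j. - z l j)"
proof
  fix l l' j j' l0 j0 k m :: nat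
  show "inj2 z" by (fact inj)
  show "z (Suc l) j - 1 = z l j" "z l (Suc j) - tau = z l j" "- z 0 0 = 0"
    by (simp_all add: z algebra_simps)
  show "j \<noteq> j' \<Longrightarrow> z l j \<noteq> z l' j'" "z l j - z l0 j0 = 0 \<longleftrightarrow> l = l0 \<and> j = j0"
    using inj by (auto simp: inj2_def)
  let ?b = "z l0 j0"
  let ?L = "\<lambda>l j. (z l j - ?b) * z l j ^ k * z l j ^ m + - z l j * (z l j - tau) ^ k * (z l j - 1) ^ m"
  let ?A = "[:0, 1:] ^ (k + m) :: 'a poly" and ?B = "[:- tau, 1:] ^ k * [:- 1, 1:] ^ m :: 'a poly"
  define p where "p = [:- ?b, 1:] * ?A - [:0, 1:] * ?B"
  have A: "degree ?A \<le> k + m" "coeff ?A (k + m) = 1"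
    by (simp_all only: degree_linear_power coeff_linear_power order_refl)
  have B: "degree ?B \<le> k + m" "coeff ?B (k + m) = 1"
    using coeff_mult_top[of "[:- tau, 1:] ^ k" k "[:- 1, 1:] ^ m" m]
      degree_mult_le[of "[:- tau, 1:] ^ k" "[:- 1, 1:] ^ m"]
    by (simp_all only: degree_linear_power coeff_linear_power order_refl mult_1)
  have "degree ([:- ?b, 1:] * ?A) \<le> Suc (k + m)" "degree ([:0, 1:] * ?B) \<le> Suc (k + m)"
    using A(1) B(1) degree_mult_le[of "[:- ?b, 1:]" ?A] degree_mult_le[of "[:0, 1:]" ?B] by simp_all
  then have "degree p \<le> Suc (k + m)" unfolding p_def by (rule degree_diff_le)
  moreover have "coeff p (Suc (k + m)) = 0"
    using coeff_mult_top[OF _ A(1), of "[:- ?b, 1:]" 1] coeff_mult_top[OF _ B(1), of "[:0, 1:]" 1] A(2) B(2)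
    by (simp add: p_def)
  ultimately have "degree p \<le> k + m" by (rule degree_le_of_coeff_Suc)
  moreover have "?L l j = poly p (z l j)" for l j
    by (simp add: p_def power_add algebra_simps)
  ultimately show "\<exists>p. degree p \<le> k + m \<and> (\<forall>l j. ?L l j = poly p (z l j))"
    by blast
qed

text \<open>The poles of the weights at 0 are absorbed by the power k + m of \<open>z l j\<close>.
  For k = m = 0 there is no such power; the factor \<open>- z l0 j0\<close> in the lowering weight
  is chosen so that the two poles cancel.\<close>

lemma shift_data_AM:
  fixes q t :: "'a::field_char_0" and z :: "nat \<Rightarrow> nat \<Rightarrow> 'a"
  assumes z: "\<And>l j. z l j = q ^ l * t ^ j" and nz: "q \<noteq> 0" "t \<noteq> 0" and inj: "inj2 z"
  shows "shift_data z z z (\<lambda>l j. z l j / t) (\<lambda>l j. z l j / q)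
    (\<lambda>l0 j0 l j. 1 - z l0 j0 / z l j) (\<lambda>l0 j0 l j. - z l0 j0 * (1 - 1 / z l j))"
proof
  fix l l' j j' l0 j0 k m :: nat
  have z0: "z l j \<noteq> 0" for l j using nz by (simp add: z)
  show "inj2 z" by (fact inj)
  show "z (Suc l) j / q = z l j" "z l (Suc j) / t = z l j" "- z l0 j0 * (1 - 1 / z 0 0) = 0"
    using nz by (simp_all add: z)
  show "j \<noteq> j' \<Longrightarrow> z l j \<noteq> z l' j'" using inj by (auto simp: inj2_def)
  show "1 - z l0 j0 / z l j = 0 \<longleftrightarrow> l = l0 \<and> j = j0"
    using inj z0[of l j] by (auto simp: inj2_def divide_simps)
  let ?b = "z l0 j0"
  let ?L = "\<lambda>l j. (1 - ?b / z l j) * z l j ^ k * z l j ^ m +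
      - ?b * (1 - 1 / z l j) * (z l j / t) ^ k * (z l j / q) ^ m"
  define u where "u = inverse (t ^ k * q ^ m)"
  define p where "p = (if k + m = 0 then [:1 - ?b:] else
    monom (1 - ?b * u) (k + m) - monom (?b * (1 - u)) (k + m - 1))"
  have "degree p \<le> k + m"
    by (auto simp: p_def intro!: degree_diff_le intro: order_trans[OF degree_monom_le])
  moreover have "?L l j = poly p (z l j)" for l j
  proof (cases "k + m")
    case 0
    then show ?thesis using z0[of l j] by (simp add: p_def field_simps)
  next
    case (Suc d)
    have eq: "(z l j / t) ^ k * (z l j / q) ^ m = u * z l j ^ (k + m)"
      using nz by (simp add: u_def power_divide power_add field_simps)
    have "?L l j =
        (1 - ?b / z l j) * z l j ^ (k + m) - ?b * (1 - 1 / z l j) * (u * z l j ^ (k + m))"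
      unfolding eq[symmetric] by (simp add: power_add mult.assoc)
    also have "\<dots> = (1 - ?b * u) * z l j ^ Suc d - ?b * (1 - u) * z l j ^ d"
      unfolding Suc using z0[of l j] by (simp add: field_simps)
    finally show ?thesis using Suc by (simp add: p_def poly_monom)
  qed
  ultimately show "\<exists>p. degree p \<le> k + m \<and> (\<forall>l j. ?L l j = poly p (z l j))"
    by blast
qed

section \<open>Antisymmetric parts under an involution\<close>

lemma poly_combination:
  fixes G :: "'a::comm_ring_1 poly" and phi :: "nat \<Rightarrow> 'b \<Rightarrow> 'a"
  assumes "degree G \<le> M" "\<And>e. e \<le> M \<Longrightarrow> \<exists>p. degree p \<le> D \<and> (\<forall>x\<in>X. phi e x = poly p (w x))"
  shows "\<exists>p. degree p \<le> D \<and> (\<forall>x\<in>X. (\<Sum>e\<le>M. coeff G e * phi e x) = poly p (w x))"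
proof -
  have "\<forall>e. \<exists>p. e \<le> M \<longrightarrow> degree p \<le> D \<and> (\<forall>x\<in>X. phi e x = poly p (w x))"
    using assms(2) by blast
  then obtain p where p: "\<And>e. e \<le> M \<Longrightarrow> degree (p e) \<le> D" "\<And>e x. e \<le> M \<Longrightarrow> x \<in> X \<Longrightarrow> phi e x = poly (p e) (w x)"
    by metis
  have "degree (\<Sum>e\<le>M. smult (coeff G e) (p e)) \<le> D"
    by (rule degree_sum_le) (use p(1) in \<open>auto intro: order_trans[OF degree_smult_le]\<close>)
  moreover have "(\<Sum>e\<le>M. coeff G e * phi e x) = poly (\<Sum>e\<le>M. smult (coeff G e) (p e)) (w x)" if "x \<in> X" for x
    using p(2) that by (simp add: poly_sum)
  ultimately show ?thesis by blast
qed

lemma poly_eq_sum_le: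
  fixes G :: "'a::comm_ring_1 poly"
  assumes "degree G \<le> M" shows "poly G x = (\<Sum>e\<le>M. coeff G e * x ^ e)"
  unfolding poly_altdef
  by (rule sum.mono_neutral_left) (use assms in \<open>auto simp: coeff_eq_0\<close>)

text \<open>Only odd exponents survive, so the bound 2 D + 2 leaves exponents at most 2 D + 1;
  division by x gives even powers up to 2 D.\<close>

lemma odd_part:
  fixes G :: "'a::field poly"
  assumes "degree G \<le> 2 * D + 2"
  obtains p where "degree p \<le> D" "\<And>x. x \<noteq> 0 \<Longrightarrow> (poly G x - poly G (- x)) / x = poly p (x ^ 2)"
proof -
  have "\<exists>p. degree p \<le> D \<and> (\<forall>x\<in>UNIV - {0}. (\<Sum>e\<le>2 * D + 2. coeff G e * ((x ^ e - (- x) ^ e) / x)) =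
      poly p (x ^ 2))"
  proof (rule poly_combination[OF assms])
    fix e assume e: "e \<le> 2 * D + 2"
    show "\<exists>p :: 'a poly. degree p \<le> D \<and> (\<forall>x\<in>UNIV - {0}. (x ^ e - (- x) ^ e) / x = poly p (x ^ 2))"
    proof (cases "even e")
      case True
      then show ?thesis by (intro exI[of _ 0]) simp
    next
      case False
      then obtain c where c: "e = 2 * c + 1" by (auto elim: oddE)
      then have "degree (monom (2 :: 'a) c) \<le> D" using e degree_monom_le[of "2 :: 'a" c] by linarith
      then show ?thesis using c
        by (intro exI[of _ "monom 2 c"]) (simp add: poly_monom power_mult)
    qed
  qed
  then obtain p where p: "degree p \<le> D" "\<And>x. x \<noteq> 0 \<Longrightarrow>
      (\<Sum>e\<le>2 * D + 2. coeff G e * ((x ^ e - (- x) ^ e) / x)) = poly p (x ^ 2)" by blast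
  have "(poly G x - poly G (- x)) / x = (\<Sum>e\<le>2 * D + 2. coeff G e * ((x ^ e - (- x) ^ e) / x))" for x
    unfolding poly_eq_sum_le[OF assms] sum_subtractf[symmetric] sum_divide_distrib
    by (simp add: algebra_simps)
  then show ?thesis using that p by metis
qed

text \<open>
  In the families BJ and BM the two alternatives of the operator are exchanged by the involution
  y to -y (where y = z - 1/2), respectively z to q/z, and W is the invariant of this involution.
  So poly_shift amounts to dividing an odd function by y, respectively z - q/z.
\<close>

lemma shift_data_BJ:
  fixes tau alpha :: "'a::field_char_0" and z :: "nat \<Rightarrow> nat \<Rightarrow> 'a"
  assumes z: "\<And>l j. z l j = of_nat l + of_nat j * tau + alpha" and inj: "inj2 z"
    and neq: "\<And>l j l' j'. z l j + z l' j' \<notin> {0, 1, 1 - tau}"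
  defines "x \<equiv> \<lambda>l j. z l j - 1 / 2"
    and "A \<equiv> \<lambda>l0 j0 y. (y + (z 0 0 - 1 / 2)) * (y - (z l0 j0 - 1 / 2))"
  shows "shift_data (\<lambda>l j. z l j ^ 2) (\<lambda>l j. x l j ^ 2) (\<lambda>l j. (x l j + tau / 2) ^ 2)
    (\<lambda>l j. (- x l j + tau / 2) ^ 2) (\<lambda>l j. (- x l j + 1 / 2) ^ 2)
    (\<lambda>l0 j0 l j. A l0 j0 (x l j) / x l j) (\<lambda>l0 j0 l j. - A l0 j0 (- x l j) / x l j)"
proof
  fix l l' j j' l0 j0 k m :: nat
  have inj': "l = l' \<and> j = j'" if "z l j = z l' j'" for l j l' j'
    using inj that by (auto simp: inj2_def)
  \<comment> \<open>Of the excluded sums of two values of \<open>z\<close>, 1 and 1 - tau become 0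
    and - tau for \<open>x\<close>; they give the injectivity of \<open>W\<close> and the separation
    of \<open>P0\<close>, while 0 gives the injectivity of \<open>Y\<close>.\<close>
  have x_sum: "x l j + x l' j' \<noteq> 0" "x l j + x l' j' \<noteq> - tau" for l j l' j'
    using neq[of l j l' j'] by (auto simp: x_def algebra_simps)
  have x0: "x l j \<noteq> 0" for l j using x_sum(1)[of l j l j] by auto
  show "inj2 (\<lambda>l j. z l j ^ 2)"
    unfolding inj2_def
  proof (intro allI impI)
    fix l j l' j' assume "z l j ^ 2 = z l' j' ^ 2"
    then have "z l j = z l' j' \<or> z l j + z l' j' = 0" by (auto simp: power2_eq_iff)
    then show "l = l' \<and> j = j'" using inj' neq[of l j l' j'] by auto
  qed
  show "inj2 (\<lambda>l j. x l j ^ 2)"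
    unfolding inj2_def
  proof (intro allI impI)
    fix l j l' j' assume "x l j ^ 2 = x l' j' ^ 2"
    then have "x l j = x l' j' \<or> x l j + x l' j' = 0" by (auto simp: power2_eq_iff)
    then show "l = l' \<and> j = j'" using inj' x_sum(1)[of l j l' j'] by (auto simp: x_def)
  qed
  \<comment> \<open>Changing the sign of \<open>x\<close> turns z^2 into (z - 1)^2, its value after
    lowering a part, and \<open>P0\<close> into \<open>P1\<close>. Raising \<open>j\<close> by 1
    adds tau to \<open>x\<close>, so \<open>P1\<close> at \<open>Suc j\<close> and \<open>P0\<close>
    at \<open>j\<close> are squares of opposite elements.\<close>
  have "- x (Suc l) j + 1 / 2 = - z l j" "- x l (Suc j) + tau / 2 = - (x l j + tau / 2)"
    by (simp_all add: x_def z field_simps)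
  then show "(- x (Suc l) j + 1 / 2) ^ 2 = z l j ^ 2" "(- x l (Suc j) + tau / 2) ^ 2 = (x l j + tau / 2) ^ 2"
    by (simp_all only: power2_minus)
  show "(x l j + tau / 2) ^ 2 \<noteq> (x l' j' + tau / 2) ^ 2" if "j \<noteq> j'"
  proof
    assume "(x l j + tau / 2) ^ 2 = (x l' j' + tau / 2) ^ 2"
    then have "x l j + tau / 2 = x l' j' + tau / 2 \<or> x l j + tau / 2 = - (x l' j' + tau / 2)"
      by (simp only: power2_eq_iff)
    moreover have "x l j + x l' j' = - tau" if "x l j + tau / 2 = - (x l' j' + tau / 2)"
    proof -
      have "x l j + x l' j' = (x l j + tau / 2) + (x l' j' + tau / 2) - tau"
        by (simp add: field_simps)
      then show ?thesis using that by simp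
    qed
    ultimately have "x l j = x l' j' \<or> x l j + x l' j' = - tau" by auto
    then show False using that inj'[of l j l' j'] x_sum(2)[of l j l' j'] by (auto simp: x_def)
  qed
  \<comment> \<open>The first factor of \<open>A\<close> is chosen to vanish at
    \<open>- x 0 0\<close>, the second one at the spectral point \<open>x l0 j0\<close>.\<close>
  show "- A l0 j0 (- x 0 0) / x 0 0 = 0" by (simp add: A_def x_def)
  have "x l j + (z 0 0 - 1 / 2) \<noteq> 0" using x_sum(1)[of l j 0 0] by (simp add: x_def)
  then show "A l0 j0 (x l j) / x l j = 0 \<longleftrightarrow> l = l0 \<and> j = j0"
    using x0[of l j] inj'[of l j l0 j0] by (auto simp: A_def x_def)
  let ?L = "\<lambda>l j. A l0 j0 (x l j) / x l j * ((x l j + tau / 2) ^ 2) ^ k * (z l j ^ 2) ^ m +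
      - A l0 j0 (- x l j) / x l j * ((- x l j + tau / 2) ^ 2) ^ k * ((- x l j + 1 / 2) ^ 2) ^ m"
  \<comment> \<open>\<open>G\<close> gives the numerator of the unlowered alternative at y = x and
    of the lowered one at y = - x. Its degree bound 2 (k + m) + 2 is what \<open>odd_part\<close>
    turns into k + m.\<close>
  define G where "G = [:z 0 0 - 1 / 2, 1:] * [:- (z l0 j0 - 1 / 2), 1:] * ([:tau / 2, 1:] ^ (2 * k) * [:1 / 2, 1:] ^ (2 * m))"
  have "degree G \<le> (1 + 1) + (2 * k + 2 * m)"
    unfolding G_def
    by (intro order_trans[OF degree_mult_le] add_mono) (simp_all add: degree_linear_power)
  then have "degree G \<le> 2 * (k + m) + 2" by simp
  then obtain p where p: "degree p \<le> k + m"
    "\<And>y. y \<noteq> 0 \<Longrightarrow> (poly G y - poly G (- y)) / y = poly p (y ^ 2)"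
    using odd_part by blast
  have G: "poly G y = A l0 j0 y * ((y + tau / 2) ^ 2) ^ k * ((y + 1 / 2) ^ 2) ^ m" for y
    by (simp add: G_def A_def power_mult[symmetric] algebra_simps)
  have "?L l j = poly p (x l j ^ 2)" for l j
  proof -
    have "x l j + 1 / 2 = z l j" by (simp add: x_def)
    then have "?L l j =
      (poly G (x l j) - poly G (- x l j)) / x l j"
      unfolding G by (simp only: times_divide_eq_left diff_divide_distrib minus_divide_left mult_minus_left) simp
    then show ?thesis using p(2)[OF x0] by simp
  qed
  then show "\<exists>p. degree p \<le> k + m \<and> (\<forall>l j. ?L l j = poly p (x l j ^ 2))"
    using p(1) by blast
qed

text \<open>With y = q / z the quotients satisfy the recurrence S_(c+2) = (z + y) S_(c+1) - q S_c of
  Chebyshev polynomials of the second kind, starting from S_0 = 0 and S_1 = 1.\<close>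

lemma chebyshev_quotient:
  fixes q :: "'a::field"
  shows "\<exists>p. degree p \<le> c - 1 \<and> (\<forall>z. z \<noteq> 0 \<longrightarrow> z \<noteq> q / z \<longrightarrow> (z ^ c - (q / z) ^ c) / (z - q / z) = poly p (z + q / z))"
proof (induction c rule: induct_nat_012)
  case 0
  show ?case by (intro exI[of _ 0]) simp
next
  case 1
  show ?case by (intro exI[of _ 1]) simp
next
  case (ge2 c)
  obtain p0 where p0: "degree p0 \<le> c - 1"
    "\<And>z. z \<noteq> 0 \<Longrightarrow> z \<noteq> q / z \<Longrightarrow> (z ^ c - (q / z) ^ c) / (z - q / z) = poly p0 (z + q / z)"
    using ge2.IH(1) by blast
  obtain p1 where p1: "degree p1 \<le> c"
    "\<And>z. z \<noteq> 0 \<Longrightarrow> z \<noteq> q / z \<Longrightarrow> (z ^ Suc c - (q / z) ^ Suc c) / (z - q / z) = poly p1 (z + q / z)"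
    using ge2.IH(2) by auto
  have "degree ([:0, 1:] * p1) \<le> Suc c"
    using degree_mult_le[of "[:0, 1:]" p1] p1(1) by simp
  moreover have "degree (smult q p0) \<le> Suc c"
    using p0(1) degree_smult_le[of q p0] by linarith
  ultimately have "degree ([:0, 1:] * p1 - smult q p0) \<le> Suc (Suc c) - 1"
    using degree_diff_le by fastforce
  moreover have "(z ^ Suc (Suc c) - (q / z) ^ Suc (Suc c)) / (z - q / z) = poly ([:0, 1:] * p1 - smult q p0) (z + q / z)"
    if z: "z \<noteq> 0" "z \<noteq> q / z" for z
  proof -
    define y where "y = q / z"
    have q: "q = z * y" using z(1) by (simp add: y_def)
    have "poly ([:0, 1:] * p1 - smult q p0) (z + q / z) =
        (z + y) * ((z ^ Suc c - y ^ Suc c) / (z - y)) - (z * y) * ((z ^ c - y ^ c) / (z - y))"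
      using p0(2)[OF z] p1(2)[OF z] unfolding y_def[symmetric] by (simp add: q)
    also have "\<dots> = ((z + y) * (z ^ Suc c - y ^ Suc c) - (z * y) * (z ^ c - y ^ c)) / (z - y)"
      by (simp only: diff_divide_distrib[symmetric] times_divide_eq_right)
    also have "(z + y) * (z ^ Suc c - y ^ Suc c) - (z * y) * (z ^ c - y ^ c) = z ^ Suc (Suc c) - y ^ Suc (Suc c)"
      by (simp add: algebra_simps)
    finally show ?thesis by (simp add: y_def)
  qed
  ultimately show ?case by blast
qed

text \<open>N(z) / z^(D+1) has exponents between -(D+1) and D+1. Subtracting its image under z to q
  / z and dividing by z - q / z shrinks this range by one at both ends; this is checked on
  monomials.\<close>

lemma laurent_odd_part:
  fixes N :: "'a::field poly"
  assumes deg: "degree N \<le> 2 * D + 2" and q: "q \<noteq> 0"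
  obtains p where "degree p \<le> D" "\<And>z. z \<noteq> 0 \<Longrightarrow> z \<noteq> q / z \<Longrightarrow>
    (poly N z / z ^ Suc D - poly N (q / z) / (q / z) ^ Suc D) / (z - q / z) = poly p (z + q / z)"
proof -
  let ?X = "{z. z \<noteq> 0 \<and> z \<noteq> q / z}"
  let ?phi = "\<lambda>e z. (z ^ e / z ^ Suc D - (q / z) ^ e / (q / z) ^ Suc D) / (z - q / z)"
  have "\<exists>p. degree p \<le> D \<and> (\<forall>z\<in>?X. (\<Sum>e\<le>2 * D + 2. coeff N e * ?phi e z) = poly p (z + q / z))"
  proof (rule poly_combination[OF deg])
    fix e assume e: "e \<le> 2 * D + 2"
    show "\<exists>p. degree p \<le> D \<and> (\<forall>z\<in>?X. ?phi e z = poly p (z + q / z))"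
    proof (cases "Suc D \<le> e")
      case True
      obtain p where p: "degree p \<le> e - Suc D - 1" "\<And>z. z \<noteq> 0 \<Longrightarrow> z \<noteq> q / z \<Longrightarrow>
          (z ^ (e - Suc D) - (q / z) ^ (e - Suc D)) / (z - q / z) = poly p (z + q / z)"
        using chebyshev_quotient[of "e - Suc D" q] by blast
      have "?phi e z = poly p (z + q / z)" if "z \<in> ?X" for z
        using that p(2)[of z] True q by (simp add: power_diff)
      moreover have "degree p \<le> D" using p(1) e by linarith
      ultimately show ?thesis by blast
    next
      case False
      let ?c = "Suc D - e"
      obtain p where p: "degree p \<le> ?c - 1" "\<And>z. z \<noteq> 0 \<Longrightarrow> z \<noteq> q / z \<Longrightarrow>
          (z ^ ?c - (q / z) ^ ?c) / (z - q / z) = poly p (z + q / z)"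
        using chebyshev_quotient[of ?c q] by blast
      \<comment> \<open>A negative exponent is turned around: with y = q / z, 1 / z^c - 1 / y^c = -
        (z^c - y^c) / q^c.\<close>
      have "?phi e z = poly (smult (- 1 / q ^ ?c) p) (z + q / z)" if z: "z \<in> ?X" for z
      proof -
        define y where "y = q / z"
        have zy: "z \<noteq> 0" "y \<noteq> 0" "q = z * y" using z q by (auto simp: y_def)
        have inv: "w ^ e / w ^ Suc D = 1 / w ^ ?c" if "w \<noteq> 0" for w :: 'a
          using that False by (simp add: power_diff)
        have "?phi e z = (1 / z ^ ?c - 1 / y ^ ?c) / (z - y)"
          unfolding y_def[symmetric] inv[OF zy(1)] inv[OF zy(2)] ..
        also have "1 / z ^ ?c - 1 / y ^ ?c = (- 1 / q ^ ?c) * (z ^ ?c - y ^ ?c)"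
          using zy(1,2) unfolding zy(3) power_mult_distrib by (simp add: field_simps)
        also have "(- 1 / q ^ ?c) * (z ^ ?c - y ^ ?c) / (z - y) = (- 1 / q ^ ?c) * poly p (z + q / z)"
        proof -
          have pz: "(z ^ ?c - y ^ ?c) / (z - y) = poly p (z + q / z)"
            using p(2)[of z] z by (simp add: y_def)
          show ?thesis unfolding pz[symmetric] by (rule times_divide_eq_right[symmetric])
        qed
        finally show ?thesis by (simp only: poly_smult)
      qed
      moreover have "degree (smult (- 1 / q ^ ?c) p) \<le> D"
        using p(1) degree_smult_le[of "- 1 / q ^ ?c" p] by linarith
      ultimately show ?thesis by blast
    qed
  qed
  then obtain p where p: "degree p \<le> D" "\<And>z. z \<noteq> 0 \<Longrightarrow> z \<noteq> q / z \<Longrightarrow>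
      (\<Sum>e\<le>2 * D + 2. coeff N e * ?phi e z) = poly p (z + q / z)" by blast
  have "(poly N z / z ^ Suc D - poly N (q / z) / (q / z) ^ Suc D) / (z - q / z) =
      (\<Sum>e\<le>2 * D + 2. coeff N e * ?phi e z)" for z
    unfolding poly_eq_sum_le[OF deg] sum_divide_distrib sum_subtractf[symmetric]
    by (intro sum.cong refl) (simp only: right_diff_distrib times_divide_eq_right)
  then show ?thesis using that p by metis
qed

text \<open>The fibre of z + c / z consists of z and c / z, and the second is excluded by z w
  \<noteq> c.\<close>

lemma add_div_inj:
  assumes "z + c / z = w + c / (w :: 'a::field)" "z \<noteq> 0" "w \<noteq> 0" "z * w \<noteq> c"
  shows "z = w"
proof -
  have "(z - w) * (z * w - c) = 0" using assms(1-3) by (simp add: field_simps)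
  then show ?thesis using assms(4) by auto
qed

text \<open>The first factor of \<open>A\<close> vanishes at q / a, which is q / z at the index (0,
  0), and so blocks the lowering of a last part 0. The division by y in \<open>A\<close> centres its
  exponents at 0, as the degree count of \<open>laurent_odd_part\<close> with D = k + m requires.
  The constant q / t makes \<open>P\<close> invariant under y to q / (t y), which is the relation
  between \<open>P1\<close> and \<open>P0\<close>.\<close>

lemma shift_data_BM:
  fixes q t a :: "'a::field_char_0" and z :: "nat \<Rightarrow> nat \<Rightarrow> 'a"
  assumes z: "\<And>l j. z l j = a * q ^ l * t ^ j" and nz: "q \<noteq> 0" "t \<noteq> 0" "a \<noteq> 0" and inj: "inj2 z"
    and neq: "\<And>l j l' j'. z l j * z l' j' \<notin> {1, q}"
  defines "A \<equiv> \<lambda>l0 j0 y. (y - q / a) * (y - z l0 j0) / y"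
    and "P \<equiv> \<lambda>y. y + (q / t) / y"
  shows "shift_data (\<lambda>l j. z l j + inverse (z l j)) (\<lambda>l j. z l j + q / z l j)
    (\<lambda>l j. P (z l j)) (\<lambda>l j. P (q / z l j)) (\<lambda>l j. q / z l j + inverse (q / z l j))
    (\<lambda>l0 j0 l j. A l0 j0 (z l j) / (z l j - q / z l j)) (\<lambda>l0 j0 l j. - A l0 j0 (q / z l j) / (z l j - q / z l j))"
proof
  fix l l' j j' l0 j0 k m :: nat
  have inj': "l = l' \<and> j = j'" if "z l j = z l' j'" for l j l' j'
    using inj that by (auto simp: inj2_def)
  have z0: "z l j \<noteq> 0" for l j using nz by (simp add: z)
  have zq: "z l j \<noteq> q / z l j" for l j using neq[of l j l j] z0[of l j] by (auto simp: field_simps)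
  have inj_add: "inj2 (\<lambda>l j. z l j + c / z l j)" if "c \<in> {1, q}" for c
    unfolding inj2_def
  proof (intro allI impI)
    fix l j l' j' assume eq: "z l j + c / z l j = z l' j' + c / z l' j'"
    have "z l j * z l' j' \<noteq> c" using neq[of l j l' j'] that by auto
    then have "z l j = z l' j'" by (rule add_div_inj[OF eq z0 z0])
    then show "l = l' \<and> j = j'" by (rule inj')
  qed
  show "inj2 (\<lambda>l j. z l j + inverse (z l j))" "inj2 (\<lambda>l j. z l j + q / z l j)"
    using inj_add[of 1] inj_add[of q] by (simp_all add: inverse_eq_divide)
  show "q / z (Suc l) j + inverse (q / z (Suc l) j) = z l j + inverse (z l j)"
    using nz by (simp add: z field_simps)
  show "P (q / z l (Suc j)) = P (z l j)"
    using nz by (simp add: z P_def field_simps)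
  show "P (z l j) \<noteq> P (z l' j')" if "j \<noteq> j'"
  proof
    assume eq: "P (z l j) = P (z l' j')"
    have "z l j * z l' j' \<noteq> q / t"
    proof
      assume "z l j * z l' j' = q / t"
      then have "z l (Suc j) * z l' j' = q" using nz by (simp add: z field_simps)
      then show False using neq by blast
    qed
    then have "z l j = z l' j'" by (rule add_div_inj[OF eq[unfolded P_def] z0 z0])
    then show False using inj' that by blast
  qed
  show "- A l0 j0 (q / z 0 0) / (z 0 0 - q / z 0 0) = 0" by (simp add: A_def z)
  have "z l j \<noteq> q / a"
  proof
    assume "z l j = q / a"
    then have "z l j * z 0 0 = q" using nz by (simp add: z)
    then show False using neq by blast
  qed
  then show "A l0 j0 (z l j) / (z l j - q / z l j) = 0 \<longleftrightarrow> l = l0 \<and> j = j0"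
    using z0[of l j] zq[of l j] inj'[of l j l0 j0] by (auto simp: A_def)
  let ?L = "\<lambda>l j. A l0 j0 (z l j) / (z l j - q / z l j) * P (z l j) ^ k * (z l j + inverse (z l j)) ^ m +
      - A l0 j0 (q / z l j) / (z l j - q / z l j) * P (q / z l j) ^ k * (q / z l j + inverse (q / z l j)) ^ m"
  define N where "N = [:- (q / a), 1:] * [:- z l0 j0, 1:] * ([:q / t, 0, 1:] ^ k * [:1, 0, 1:] ^ m)"
  have pow: "degree ([:c, 0, 1 :: 'a:] ^ i) \<le> 2 * i" for c i
    using degree_power_le[of "[:c, 0, 1 :: 'a:]" i] by simp
  have "degree N \<le> (1 + 1) + (2 * k + 2 * m)"
    unfolding N_def by (intro order_trans[OF degree_mult_le] add_mono pow) simp_all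
  then have "degree N \<le> 2 * (k + m) + 2" by simp
  then obtain p where p: "degree p \<le> k + m" "\<And>y. y \<noteq> 0 \<Longrightarrow> y \<noteq> q / y \<Longrightarrow>
      (poly N y / y ^ Suc (k + m) - poly N (q / y) / (q / y) ^ Suc (k + m)) / (y - q / y) = poly p (y + q / y)"
    using laurent_odd_part nz(1) by blast
  have N: "A l0 j0 y * P y ^ k * (y + inverse y) ^ m = poly N y / y ^ Suc (k + m)" if "y \<noteq> 0" for y
  proof -
    have "P y = (q / t + y * y) / y" "y + inverse y = (1 + y * y) / y"
      using that by (simp_all add: P_def add_divide_distrib inverse_eq_divide)
    moreover have "poly N y = (y - q / a) * (y - z l0 j0) * ((q / t + y * y) ^ k * (1 + y * y) ^ m)"
      by (simp only: N_def poly_mult poly_power) simp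
    ultimately show ?thesis
      by (simp add: A_def power_divide power_add mult_ac)
  qed
  have "?L l j = poly p (z l j + q / z l j)" for l j
  proof -
    have y0: "q / z l j \<noteq> 0" using z0[of l j] nz by simp
    have "?L l j =
      (A l0 j0 (z l j) * P (z l j) ^ k * (z l j + inverse (z l j)) ^ m -
       A l0 j0 (q / z l j) * P (q / z l j) ^ k * (q / z l j + inverse (q / z l j)) ^ m) / (z l j - q / z l j)"
      by (simp only: diff_divide_distrib times_divide_eq_left minus_divide_left mult_minus_left) simp
    also have "\<dots> = poly p (z l j + q / z l j)"
      unfolding N[OF z0] N[OF y0] by (rule p(2)[OF z0 zq])
    finally show ?thesis .
  qed
  then show "\<exists>p. degree p \<le> k + m \<and> (\<forall>l j. ?L l j = poly p (z l j + q / z l j))"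
    using p(1) by blast
qed

section \<open>The four families\<close>

lemma sum_monom_inj:
  assumes "(\<Sum>i=1..n. monom (c i) (n - i)) = (\<Sum>i=1..n. monom (d i) (n - i))" "i \<in> {1..n}"
  shows "c i = (d i :: 'a::comm_ring_1)"
proof -
  have "coeff (\<Sum>k=1..n. monom (c k) (n - k)) (n - i) = c i" for c :: "nat \<Rightarrow> 'a"
  proof -
    have "coeff (\<Sum>k=1..n. monom (c k) (n - k)) (n - i) = (\<Sum>k=1..n. if k = i then c i else 0)"
      unfolding coeff_sum using assms(2) by (intro sum.cong) auto
    then show ?thesis using assms(2) by simp
  qed
  then show ?thesis using assms(1) by metis
qed

lemma psize_cong: "(\<And>i. i \<in> {1..n} \<Longrightarrow> lam i = mu i) \<Longrightarrow> psize n lam = psize n mu"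
  unfolding psize_def by (rule sum.cong) auto

lemma AJ_chain_family: "\<exists>g s gam Om z W P0 P1 R1 U0 U1. chain_family g s gam Om AJ z W P0 P1 R1 U0 U1"
proof -
  define tau :: "rat poly fract" where "tau = incl [:0, 1:]"
  define z where "z l j = of_nat l + of_nat j * tau" for l j
  have z_incl: "z l j = incl [:of_nat l, of_nat j:]" for l j
  proof -
    have "[:of_nat l, of_nat j:] = of_nat l + of_nat j * [:0, 1 :: rat:]" by (simp add: of_nat_poly)
    then show ?thesis by (simp only: z_def tau_def incl_add incl_mult incl_of_nat)
  qed
  have inj: "inj2 z" by (simp add: inj2_def z_incl)
  have "interpolation_family lvar 1 (\<lambda>x. x) UNIV AJ z"
    by (intro interpolation_family.intro laurent_family_lvar interpolation_family_axioms.intro)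
      (use inj in \<open>simp_all add: AJ_def Let_def tau_def[symmetric] z_def[abs_def]\<close>)
  moreover note shift_data_AJ[OF z_def inj]
  moreover have "snorm AJ n lam \<noteq> snorm AJ n mu" if "psize n lam \<noteq> psize n mu" for n lam mu
  proof -
    have "snorm AJ n lam = of_nat (psize n lam) + (\<Sum>i=1..n. of_nat (n - i) * tau)" for lam
      by (simp add: snorm_def AJ_def Let_def tau_def[symmetric] sum.distrib psize_def)
    then show ?thesis using that by simp
  qed
  moreover have "fnorm AJ = (\<lambda>n x. \<Sum>i=1..n. x i)" by (simp add: AJ_def Let_def)
  ultimately have "\<exists>W P0 P1 R1 U0 U1. chain_family lvar 1 (\<lambda>x. x) UNIV AJ z W P0 P1 R1 U0 U1"
    by (intro exI chain_family.intro chain_family_axioms.intro) auto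
  then show ?thesis by blast
qed

lemma AM_chain_family: "\<exists>g s gam Om z W P0 P1 R1 U0 U1. chain_family g s gam Om AM z W P0 P1 R1 U0 U1"
proof -
  define q :: "rat poly poly fract" where "q = incl [:[:0, 1:]:]"
  define t :: "rat poly poly fract" where "t = incl [:0, 1:]"
  define z where "z l j = q ^ l * t ^ j" for l j
  have z_incl: "z l j = incl (monom (monom 1 l) j)" for l j
  proof -
    have "q = incl (monom (monom 1 1) 0)" "t = incl (monom 1 1)"
      by (simp_all add: q_def t_def monom_altdef)
    then show ?thesis by (simp add: z_def mult_monom monom_power flip: incl_mult incl_power)
  qed
  have inj: "inj2 z" by (auto simp: inj2_def z_incl monom_eq_iff')
  have nz: "q \<noteq> 0" "t \<noteq> 0" by (simp_all add: q_def t_def)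
  have "interpolation_family lvar 1 (\<lambda>x. x) UNIV AM z"
    by (intro interpolation_family.intro laurent_family_lvar interpolation_family_axioms.intro)
      (use inj in \<open>simp_all add: AM_def Let_def q_def[symmetric] t_def[symmetric] z_def[abs_def]\<close>)
  moreover note shift_data_AM[OF z_def nz inj]
  moreover have "snorm AM n lam \<noteq> snorm AM n mu" if "psize n lam \<noteq> psize n mu" for n lam mu
  proof
    assume "snorm AM n lam = snorm AM n mu"
    moreover have "snorm AM n lam = incl (\<Sum>i=1..n. monom (monom 1 (lam i)) (n - i))" for lam
      by (simp add: snorm_def AM_def Let_def q_def[symmetric] t_def[symmetric] z_def[symmetric]
          z_incl incl_sum)
    \<comment> \<open>As a polynomial in t the norm has coefficient q^(lam i) at t^(n - i), so it
      even determines the partition.\<close>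
    ultimately have "(\<Sum>i=1..n. monom (monom (1 :: rat) (lam i)) (n - i)) =
        (\<Sum>i=1..n. monom (monom 1 (mu i)) (n - i))"
      by simp
    then have "monom (1 :: rat) (lam i) = monom 1 (mu i)" if "i \<in> {1..n}" for i
      using that by (rule sum_monom_inj)
    then have "psize n lam = psize n mu" by (intro psize_cong) (simp add: monom_eq_iff')
    then show False using that by simp
  qed
  moreover have "fnorm AM = (\<lambda>n x. \<Sum>i=1..n. x i)" by (simp add: AM_def Let_def)
  ultimately have "\<exists>W P0 P1 R1 U0 U1. chain_family lvar 1 (\<lambda>x. x) UNIV AM z W P0 P1 R1 U0 U1"
    by (intro exI chain_family.intro chain_family_axioms.intro) auto
  then show ?thesis by blast
qed

lemma BJ_chain_family: "\<exists>g s gam Om z W P0 P1 R1 U0 U1. chain_family g s gam Om BJ z W P0 P1 R1 U0 U1"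
proof -
  define tau :: "rat poly poly fract" where "tau = incl [:[:0, 1:]:]"
  define alpha :: "rat poly poly fract" where "alpha = incl [:0, 1:]"
  define z where "z l j = of_nat l + of_nat j * tau + alpha" for l j
  have z_incl: "z l j = incl [:[:of_nat l, of_nat j:], 1:]" for l j
  proof -
    have "[:[:of_nat l, of_nat j:], 1:] = of_nat l + of_nat j * [:[:0, 1 :: rat:]:] + [:0, 1:]"
      by (simp add: of_nat_poly)
    then show ?thesis by (simp only: z_def tau_def alpha_def incl_add incl_mult incl_of_nat)
  qed
  have inj: "inj2 z" by (simp add: inj2_def z_incl)
  have neq: "z l j + z l' j' \<notin> {0, 1, 1 - tau}" for l j l' j'
  proof -
    \<comment> \<open>The sum has degree 1 in alpha, with coefficient 2, while the excluded values
      do not involve alpha.\<close>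
    have "z l j + z l' j' \<noteq> incl [:c:]" for c
      by (simp add: z_incl flip: incl_add)
    moreover have "1 - tau = incl [:1 - [:0, 1:]:]"
      unfolding diff_eq_eq tau_def incl_add[symmetric] by (simp flip: one_pCons)
    ultimately show ?thesis
      using incl_0 incl_1 by (metis insertE one_pCons pCons_0_0 singletonD)
  qed
  have "interpolation_family (\<lambda>i. lvar i ^ 2) 2 (\<lambda>x. x ^ 2) UNIV BJ z"
  proof (intro interpolation_family.intro laurent_family_lvar_square interpolation_family_axioms.intro)
    show "inj2 (\<lambda>l j. z l j ^ 2)"
      unfolding inj2_def
    proof (intro allI impI)
      fix l j l' j' assume "z l j ^ 2 = z l' j' ^ 2"
      then have "z l j = z l' j' \<or> z l j + z l' j' = 0" by (auto simp: power2_eq_iff)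
      then show "l = l' \<and> j = j'" using inj neq[of l j l' j'] by (auto simp: inj2_def)
    qed
  qed (simp_all add: BJ_def Let_def tau_def[symmetric] alpha_def[symmetric] z_def[abs_def])
  moreover note shift_data_BJ[OF z_def inj neq]
  moreover have "snorm BJ n lam \<noteq> snorm BJ n mu" if "psize n lam \<noteq> psize n mu" for n lam mu
  proof
    assume "snorm BJ n lam = snorm BJ n mu"
    moreover define S where "S lam = (\<Sum>i=1..n. [:[:of_nat (lam i), of_nat (n - i) :: rat:], 1:] ^ 2)" for lam
    have "snorm BJ n lam = incl (S lam)" for lam
      by (simp add: snorm_def BJ_def Let_def tau_def[symmetric] alpha_def[symmetric] z_def[symmetric]
          z_incl S_def incl_sum incl_power)
    ultimately have "coeff (coeff (S lam) 1) 0 = coeff (coeff (S mu) 1) 0" by simp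
    \<comment> \<open>In the square of lam_i + (n - i) tau + alpha the coefficient of alpha, taken
      at tau = 0, is 2 lam_i.\<close>
    moreover have "coeff (coeff (S lam) 1) 0 = 2 * of_nat (psize n lam)" for lam
      by (simp add: S_def coeff_sum power2_eq_square psize_def sum_distrib_left)
    ultimately show False using that by simp
  qed
  moreover have "fnorm BJ = (\<lambda>n x. \<Sum>i=1..n. x i ^ 2)" by (simp add: BJ_def Let_def)
  ultimately have "\<exists>W P0 P1 R1 U0 U1. chain_family (\<lambda>i. lvar i ^ 2) 2 (\<lambda>x. x ^ 2) UNIV BJ z W P0 P1 R1 U0 U1"
    by (intro exI chain_family.intro chain_family_axioms.intro) auto
  then show ?thesis by blast
qed

lemma BM_chain_family: "\<exists>g s gam Om z W P0 P1 R1 U0 U1. chain_family g s gam Om BM z W P0 P1 R1 U0 U1"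
proof -
  define q :: "rat poly poly poly fract" where "q = incl [:[:[:0, 1:]:]:]"
  define t :: "rat poly poly poly fract" where "t = incl [:[:0, 1:]:]"
  define a :: "rat poly poly poly fract" where "a = incl [:0, 1:]"
  define z where "z l j = a * q ^ l * t ^ j" for l j
  have qta: "q = incl (monom (monom (monom 1 1) 0) 0)" "t = incl (monom (monom 1 1) 0)" "a = incl (monom 1 1)"
    by (simp_all add: q_def t_def a_def monom_altdef)
  have c_incl: "q ^ l * t ^ j = incl (monom (monom (monom 1 l) j) 0)" for l j
    by (simp add: qta mult_monom monom_power flip: incl_mult incl_power)
  have z_incl: "z l j = incl (monom (monom (monom 1 l) j) 1)" for l j
    unfolding z_def mult.assoc c_incl by (simp add: qta mult_monom flip: incl_mult)
  have inj: "inj2 z" by (auto simp: inj2_def z_incl monom_eq_iff')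
  have nz: "q \<noteq> 0" "t \<noteq> 0" "a \<noteq> 0" by (simp_all add: q_def t_def a_def)
  have z0: "z l j \<noteq> 0" for l j using nz by (simp add: z_def)
  have neq: "z l j * z l' j' \<notin> {1, q}" for l j l' j'
  proof -
    \<comment> \<open>The product has degree 2 in \<open>a\<close>, whereas 1 and q have degree
      0.\<close>
    have "z l j * z l' j' \<noteq> incl (monom c 0)" for c
      by (simp add: z_incl mult_monom monom_eq_iff' flip: incl_mult)
    then show ?thesis using qta(1) incl_1 by (metis insertE monom_eq_1 singletonD)
  qed
  note shift = shift_data_BM[OF z_def nz inj neq]
  have "interpolation_family (\<lambda>i. lvar i + lvar_inv i) 1 (\<lambda>x. x + inverse x) (UNIV - {0}) BM z"
    by (intro interpolation_family.intro laurent_family_lvar_inv interpolation_family_axioms.intro)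
      (use z0 shift_data.inj_Y[OF shift] in
        \<open>simp_all add: BM_def Let_def q_def[symmetric] t_def[symmetric] a_def[symmetric] z_def[abs_def]\<close>)
  moreover note shift
  moreover have "snorm BM n lam \<noteq> snorm BM n mu" if "psize n lam \<noteq> psize n mu" for n lam mu
  proof
    assume eq: "snorm BM n lam = snorm BM n mu"
    \<comment> \<open>The factor a q^N t^N will clear all denominators of the norm: \<open>N\<close>
      is at least every part and every n - i.\<close>
    define N where "N = n + (\<Sum>i=1..n. lam i) + (\<Sum>i=1..n. mu i)"
    define C where "C lam = (\<Sum>i=1..n. monom (monom (1 :: rat) (lam i)) (n - i))" for lam
    define D where "D lam = (\<Sum>i=1..n. monom (monom (1 :: rat) (N - lam i)) (N - (n - i)))" for lam
    define M where "M = monom (monom (1 :: rat) N) N"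
    have snorm: "a * incl (monom M 0) * snorm BM n lam = incl (monom (M * C lam) 2) + incl (monom (D lam) 0)"
      if le: "\<And>i. i \<in> {1..n} \<Longrightarrow> lam i \<le> N" for lam
    proof -
      have "a * incl (monom M 0) * (z (lam i) (n - i) + inverse (z (lam i) (n - i))) =
          incl (monom (M * monom (monom 1 (lam i)) (n - i)) 2) +
          incl (monom (monom (monom 1 (N - lam i)) (N - (n - i))) 0)" if "i \<in> {1..n}" for i
      proof -
        have "a * incl (monom M 0) = incl (monom (monom (monom 1 (N - lam i)) (N - (n - i))) 0) * z (lam i) (n - i)"
          using le[OF that] unfolding z_incl qta(3) M_def N_def
          by (simp add: mult_monom flip: incl_mult)
        then have "a * incl (monom M 0) * inverse (z (lam i) (n - i)) =
            incl (monom (monom (monom 1 (N - lam i)) (N - (n - i))) 0)"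
          using z0[of "lam i" "n - i"] by simp
        moreover have "a * incl (monom M 0) * z (lam i) (n - i) = incl (monom (M * monom (monom 1 (lam i)) (n - i)) 2)"
          unfolding z_incl qta(3) by (simp add: mult_monom numeral_2_eq_2 flip: incl_mult)
        ultimately show ?thesis by (simp add: distrib_left)
      qed
      moreover have "snorm BM n lam = (\<Sum>i=1..n. z (lam i) (n - i) + inverse (z (lam i) (n - i)))"
        by (simp add: snorm_def BM_def Let_def q_def[symmetric] t_def[symmetric] a_def[symmetric] z_def)
      ultimately have "a * incl (monom M 0) * snorm BM n lam =
          (\<Sum>i=1..n. incl (monom (M * monom (monom 1 (lam i)) (n - i)) 2) +
            incl (monom (monom (monom 1 (N - lam i)) (N - (n - i))) 0))"
        by (simp add: sum_distrib_left)
      also have "\<dots> = incl (monom (M * C lam) 2) + incl (monom (D lam) 0)"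
        by (simp add: C_def D_def sum.distrib sum_distrib_left monom_sum incl_sum)
      finally show ?thesis .
    qed
    have le: "lam i \<le> N" "mu i \<le> N" if "i \<in> {1..n}" for i
      using member_le_sum[of i "{1..n}" lam] member_le_sum[of i "{1..n}" mu] that by (auto simp: N_def)
    have "incl (monom (M * C lam) 2 + monom (D lam) 0) = incl (monom (M * C mu) 2 + monom (D mu) 0)"
      using snorm[of lam] snorm[of mu] le eq by (simp add: incl_add)
    \<comment> \<open>Terms from \<open>z\<close> now have degree 2 in \<open>a\<close> and terms
      from the inverses degree 0, so this coefficient isolates the former.\<close>
    then have "coeff (monom (M * C lam) 2 + monom (D lam) 0) 2 = coeff (monom (M * C mu) 2 + monom (D mu) 0) 2"
      by simp
    then have "C lam = C mu" by (simp add: M_def)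
    then have "monom (1 :: rat) (lam i) = monom 1 (mu i)" if "i \<in> {1..n}" for i
      using that unfolding C_def by (rule sum_monom_inj)
    then have "psize n lam = psize n mu" by (intro psize_cong) (simp add: monom_eq_iff')
    then show False using that by simp
  qed
  moreover have "fnorm BM = (\<lambda>n x. \<Sum>i=1..n. x i + inverse (x i))" by (simp add: BM_def Let_def)
  ultimately have "\<exists>W P0 P1 R1 U0 U1. chain_family (\<lambda>i. lvar i + lvar_inv i) 1 (\<lambda>x. x + inverse x)
      (UNIV - {0}) BM z W P0 P1 R1 U0 U1"
    by (intro exI chain_family.intro chain_family_axioms.intro) auto
  then show ?thesis by blast
qed

lemma chain_formulas:
  assumes "\<exists>g s gam Om z W P0 P1 R1 U0 U1. chain_family g s gam Om F z W P0 P1 R1 U0 U1"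
    and "lam \<in> partitions n" "mu \<in> partitions n" "k = psize n lam - psize n mu"
  shows "binom F n lam mu = (\<Sum>zs\<in>saturated_chains n lam mu.
      wt F n k zs * (\<Prod>i<k. adj_binom F n (zs ! i) (zs ! Suc i))) \<and>
    inv_binom F n lam mu = (\<Sum>zs\<in>saturated_chains n lam mu.
      wt' F n k zs * (\<Prod>i<k. adj_binom F n (zs ! i) (zs ! Suc i)))"
proof -
  obtain g s gam Om z W P0 P1 R1 U0 U1 where "chain_family g s gam Om F z W P0 P1 R1 U0 U1"
    using assms(1) by (elim exE)
  then show ?thesis
    using assms(2-4) by (intro conjI chain_family.binom_chain_formula chain_family.inv_binom_chain_formula)
qed

theorem theorem3p3:
  fixes n k :: nat and lam mu :: "nat \<Rightarrow> nat"
  assumes "n \<ge> 1"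
    and "lam \<in> partitions n" and "mu \<in> partitions n"
    and "pcontains n lam mu"
    and "k = psize n lam - psize n mu"
  shows
   "(binom AJ n lam mu = (\<Sum>zs\<in>saturated_chains n lam mu. wt AJ n k zs * (\<Prod>i<k. adj_binom AJ n (zs ! i) (zs ! Suc i))) \<and>
     inv_binom AJ n lam mu = (\<Sum>zs\<in>saturated_chains n lam mu. wt' AJ n k zs * (\<Prod>i<k. adj_binom AJ n (zs ! i) (zs ! Suc i)))) \<and>
    (binom BJ n lam mu = (\<Sum>zs\<in>saturated_chains n lam mu. wt BJ n k zs * (\<Prod>i<k. adj_binom BJ n (zs ! i) (zs ! Suc i))) \<and>
     inv_binom BJ n lam mu = (\<Sum>zs\<in>saturated_chains n lam mu. wt' BJ n k zs * (\<Prod>i<k. adj_binom BJ n (zs ! i) (zs ! Suc i)))) \<and>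
    (binom AM n lam mu = (\<Sum>zs\<in>saturated_chains n lam mu. wt AM n k zs * (\<Prod>i<k. adj_binom AM n (zs ! i) (zs ! Suc i))) \<and>
     inv_binom AM n lam mu = (\<Sum>zs\<in>saturated_chains n lam mu. wt' AM n k zs * (\<Prod>i<k. adj_binom AM n (zs ! i) (zs ! Suc i)))) \<and>
    (binom BM n lam mu = (\<Sum>zs\<in>saturated_chains n lam mu. wt BM n k zs * (\<Prod>i<k. adj_binom BM n (zs ! i) (zs ! Suc i))) \<and>
     inv_binom BM n lam mu = (\<Sum>zs\<in>saturated_chains n lam mu. wt' BM n k zs * (\<Prod>i<k. adj_binom BM n (zs ! i) (zs ! Suc i))))"
  using assms by (intro conjI[OF _ conjI[OF _ conjI]] chain_formulas
    AJ_chain_family BJ_chain_family AM_chain_family BM_chain_family)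

end
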